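(* Let $m\ge 2$ and $1\le n\le m$ be integers. Let $\rho$ be a density operator on $\mathcal{H}_A\otimes\mathcal{H}_{B_1}\otimes\cdots\otimes\mathcal{H}_{B_n}$ (finite-dimensional, $\dim\mathcal{H}_A=d$). Let $M_1,\dots,M_m$ be observables on $\mathcal{H}_A$ with orthonormal eigenbases $\{|\psi^i_k\rangle\}_{k=1}^d$. Let $\mathbf{S}_1,\dots,\mathbf{S}_n$ be nonempty, pairwise disjoint subsets of $\{M_1,\dots,M_m\}$ whose union is $\{M_1,\dots,M_m\}$, and $m_t=|\mathbf{S}_t|$. Let $U$ be a real number such that $\sum_{i=1}^m H(M_i)\geqslant U$. Then $$\sum_{t=1}^n\sum_{M_i\in\mathbf{S}_t}S(M_i|B_t)\geqslant U_{SCB}+\max\Big\{0,\;U-U_{SCB}-\sum_{t=1}^n\sum_{M_i\in\mathbf{S}_t}\mathcal{I}(M_i:B_t)\Big\},$$ where $$U_{SCB}=-\frac{1}{m-1}\log_2\Big(\prod_{1\le i<j\le m}c_{ij}\Big)+\frac{1}{m-1}\sum_{t=1}^n\frac{m_t(m_t-1)}{2}S(A|B_t).$$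
   Context: All logarithms are base 2. $S(\sigma)=-\mathrm{Tr}\,\sigma\log_2\sigma$; $\rho^X$ is the reduced state of $\rho$ on subsystem(s) $X$. $H(M_i)=-\sum_k p^i_k\log_2p^i_k$ with $p^i_k=\langle\psi^i_k|\rho^A|\psi^i_k\rangle$ (Shannon entropy of the outcome distribution of $M_i$). $c_{ij}=\max_{k,l}|\langle\psi^i_k|\psi^j_l\rangle|^2$. $S(A|B_t)=S(\rho^{AB_t})-S(\rho^{B_t})$. Post-measurement state: $\rho^{M_iB_t}=\sum_k(|\psi^i_k\rangle\langle\psi^i_k|\otimes\mathbb{I})\rho^{AB_t}(|\psi^i_k\rangle\langle\psi^i_k|\otimes\mathbb{I})$, with reduced state $\rho^{M_i}$ on $A$. $S(M_i|B_t)=S(\rho^{M_iB_t})-S(\rho^{B_t})$, and $\mathcal{I}(M_i:B_t)=S(\rho^{M_i})+S(\rho^{B_t})-S(\rho^{M_iB_t})$. *)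

theory Defs
  imports Complex_Main "Jordan_Normal_Form.Matrix" "Jordan_Normal_Form.Char_Poly"
begin

definition braket :: "complex vec \<Rightarrow> complex vec \<Rightarrow> complex" where
  "braket u v = (\<Sum>a<dim_vec v. cnj (u $ a) * v $ a)"

definition hermitian_mat :: "complex mat \<Rightarrow> bool" where
  "hermitian_mat A \<longleftrightarrow> square_mat A \<and>
     (\<forall>i<dim_row A. \<forall>j<dim_row A. A $$ (j, i) = cnj (A $$ (i, j)))"

definition mtrace :: "complex mat \<Rightarrow> complex" where
  "mtrace A = (\<Sum>i<dim_row A. A $$ (i, i))"

definition density_op :: "nat \<Rightarrow> complex mat \<Rightarrow> bool" where
  "density_op N \<rho> \<longleftrightarrow> \<rho> \<in> carrier_mat N N \<and> hermitian_mat \<rho> \<and>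
     (\<forall>v \<in> carrier_vec N. 0 \<le> Re (braket v (\<rho> *\<^sub>v v))) \<and> mtrace \<rho> = 1"

text \<open>Kronecker (tensor) product, first factor = most significant index.\<close>
definition kron :: "complex mat \<Rightarrow> complex mat \<Rightarrow> complex mat" where
  "kron A B = mat (dim_row A * dim_row B) (dim_col A * dim_col B)
     (\<lambda>(i, j). A $$ (i div dim_row B, j div dim_col B) * B $$ (i mod dim_row B, j mod dim_col B))"

definition proj :: "complex vec \<Rightarrow> complex mat" where
  "proj v = mat (dim_vec v) (dim_vec v) (\<lambda>(i, j). v $ i * cnj (v $ j))"

text \<open>A composite system is described by the list ds of local dimensions; the
  global basis index is the mixed-radix number whose k-th digit is the index of
  subsystem k (subsystem 0 most significant, matching kron).\<close>

definition digit :: "nat list \<Rightarrow> nat \<Rightarrow> nat \<Rightarrow> nat" where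
  "digit ds k i = (i div prod_list (drop (Suc k) ds)) mod (ds ! k)"

definition sub_dim :: "nat list \<Rightarrow> nat set \<Rightarrow> nat" where
  "sub_dim ds K = (\<Prod>k \<in> K \<inter> {..<length ds}. ds ! k)"

text \<open>Index in the subsystem K (kept in increasing order) of a global index.\<close>
definition restr :: "nat list \<Rightarrow> nat set \<Rightarrow> nat \<Rightarrow> nat" where
  "restr ds K i = (\<Sum>k \<in> K \<inter> {..<length ds}.
       digit ds k i * (\<Prod>l \<in> K \<inter> {Suc k..<length ds}. ds ! l))"

definition reduced :: "nat list \<Rightarrow> nat set \<Rightarrow> complex mat \<Rightarrow> complex mat" where
  "reduced ds K \<rho> = mat (sub_dim ds K) (sub_dim ds K) (\<lambda>(a, b).
     (\<Sum>i < prod_list ds. \<Sum>j < prod_list ds.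
        if restr ds K i = a \<and> restr ds K j = b \<and>
           (\<forall>k < length ds. k \<notin> K \<longrightarrow> digit ds k i = digit ds k j)
        then \<rho> $$ (i, j) else 0))"

definition eta :: "real \<Rightarrow> real" where
  "eta x = (if x = 0 then 0 else - x * log 2 x)"

text \<open>Eigenvalues (with multiplicity) of a square complex matrix: the roots of its
  characteristic polynomial, which splits over the complex numbers.\<close>
definition eigvals :: "complex mat \<Rightarrow> complex list" where
  "eigvals A = (SOME as. char_poly A = (\<Prod>a \<leftarrow> as. [:- a, 1:]))"

definition vn_entropy :: "complex mat \<Rightarrow> real" where
  "vn_entropy \<sigma> = (\<Sum>a \<leftarrow> eigvals \<sigma>. eta (Re a))"

definition shannon_meas :: "nat \<Rightarrow> (nat \<Rightarrow> complex vec) \<Rightarrow> complex mat \<Rightarrow> real" where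
  "shannon_meas d psi \<rho>A = (\<Sum>k<d. eta (Re (braket (psi k) (\<rho>A *\<^sub>v psi k))))"

definition post_meas :: "nat \<Rightarrow> nat \<Rightarrow> (nat \<Rightarrow> complex vec) \<Rightarrow> complex mat \<Rightarrow> complex mat" where
  "post_meas d db psi \<sigma> =
     (let P = (\<lambda>k. kron (proj (psi k)) (1\<^sub>m db)) in
      mat (d * db) (d * db) (\<lambda>(i, j). \<Sum>k<d. (P k * \<sigma> * P k) $$ (i, j)))"

definition overlap :: "nat \<Rightarrow> (nat \<Rightarrow> nat \<Rightarrow> complex vec) \<Rightarrow> nat \<Rightarrow> nat \<Rightarrow> real" where
  "overlap d psi i j = Max {(cmod (braket (psi i k) (psi j l)))\<^sup>2 | k l. k < d \<and> l < d}"

end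

theory Submission
  imports Defs "Jordan_Normal_Form.Schur_Decomposition"
begin

text \<open>
  Since \<open>S(\<rho>\<^sup>M) = H(M)\<close>, the left-hand side equals the sum of all \<open>H(M\<^sub>i)\<close> minus the sum of all mutual
  informations, which gives one half of the maximum.  For the other half it suffices to bound
  \<open>S(M\<^sub>i|B\<^sub>t) + S(M\<^sub>j|B\<^sub>s)\<close> for each pair \<open>i < j\<close> and to add up: every observable occurs in \<open>m - 1\<close>
  pairs.  For \<open>s = t\<close> the bound is the uncertainty relation \<open>- log c + S(A|B\<^sub>t)\<close> with quantum memory,
  for \<open>s \<noteq> t\<close> it is the tripartite relation \<open>- log c\<close>.

  The bipartite relation is monotonicity of \<open>D(\<rho> \<parallel> \<sigma>)\<close>, where \<open>\<sigma>\<close> is \<open>\<rho>\<close> pinched in one basis,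
  under the pinching in the other basis.  The tripartite relation for a pure state is the bipartite
  one, as complementary marginals have equal spectra; mixed states follow from superadditivity
  of \<open>S(M|B)\<close>, which is joint convexity of \<open>D\<close>.  Both properties of \<open>D\<close> come from one
  argument.  The double spectral sum \<open>\<Sum> p\<^sub>i |\<langle>v\<^sub>j|u\<^sub>i\<rangle>|\<^sup>2 (ln (q\<^sub>j + t p\<^sub>i) - ln (1 + t))\<close> tends to
  \<open>Tr \<rho> ln \<sigma>\<close> as \<open>t \<rightarrow> 0\<close> and to \<open>Tr \<rho> ln \<rho>\<close> as \<open>t \<rightarrow> \<infinity>\<close>, and up to a term that only depends on the
  trace its derivative is the maximum over \<open>X\<close> of
  \<open>2 Re Tr \<rho> X\<^sup>* - Tr \<sigma> X X\<^sup>* - t Tr \<rho> X\<^sup>* X\<close>.  This expression is linear in \<open>(\<rho>, \<sigma>)\<close>, so that derivatives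
  are compared by exhibiting a suitable \<open>X\<close>, and no integral representation is needed.

  Operators are functions on a finite index set, so that composite systems can be indexed by pairs.
\<close>

subsection \<open>Spectral theorem and von Neumann entropy\<close>

text \<open>The vectors are numbered by the index set of the coordinates itself:
  \<open>u j a\<close> is coordinate \<open>a\<close> of vector \<open>j\<close>. That there are as
  many vectors as dimensions is thereby built in.\<close>

definition onb :: "'a set \<Rightarrow> ('a \<Rightarrow> 'a \<Rightarrow> complex) \<Rightarrow> bool" where
  "onb I u \<longleftrightarrow> (\<forall>i\<in>I. \<forall>j\<in>I. (\<Sum>a\<in>I. cnj (u i a) * u j a) = of_bool (i = j)) \<and>
     (\<forall>a\<in>I. \<forall>b\<in>I. (\<Sum>j\<in>I. u j a * cnj (u j b)) = of_bool (a = b))"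

text \<open>A spectral decomposition with nonnegative eigenvalues, listed with multiplicity. It
  constrains \<open>\<alpha>\<close> on \<open>I\<close> only, so values at other indices are
  irrelevant.\<close>

definition eigsys :: "'a set \<Rightarrow> ('a \<Rightarrow> 'a \<Rightarrow> complex) \<Rightarrow> ('a \<Rightarrow> 'a \<Rightarrow> complex) \<Rightarrow> ('a \<Rightarrow> real) \<Rightarrow> bool" where
  "eigsys I \<alpha> u p \<longleftrightarrow> onb I u \<and> (\<forall>j\<in>I. 0 \<le> p j) \<and>
     (\<forall>a\<in>I. \<forall>b\<in>I. \<alpha> a b = (\<Sum>j\<in>I. p j * (u j a * cnj (u j b))))"

definition qform :: "'a set \<Rightarrow> ('a \<Rightarrow> 'a \<Rightarrow> complex) \<Rightarrow> ('a \<Rightarrow> complex) \<Rightarrow> complex" where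
  "qform I \<alpha> v = (\<Sum>a\<in>I. \<Sum>b\<in>I. cnj (v a) * \<alpha> a b * v b)"

definition psd :: "'a set \<Rightarrow> ('a \<Rightarrow> 'a \<Rightarrow> complex) \<Rightarrow> bool" where
  "psd I \<alpha> \<longleftrightarrow> (\<forall>a\<in>I. \<forall>b\<in>I. \<alpha> b a = cnj (\<alpha> a b)) \<and> (\<forall>v. 0 \<le> Re (qform I \<alpha> v))"

lemma onb_orthonormal:
  "onb I u \<Longrightarrow> i \<in> I \<Longrightarrow> j \<in> I \<Longrightarrow> (\<Sum>a\<in>I. cnj (u i a) * u j a) = of_bool (i = j)"
  by (simp add: onb_def)

lemma onb_complete:
  "onb I u \<Longrightarrow> a \<in> I \<Longrightarrow> b \<in> I \<Longrightarrow> (\<Sum>j\<in>I. u j a * cnj (u j b)) = of_bool (a = b)"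
  by (simp add: onb_def)

text \<open>The vectors form the columns of a square matrix \<open>P\<close>. Orthonormality says
  that its adjoint \<open>Q\<close> is a left inverse, hence a right inverse, which is
  completeness.\<close>

lemma orthonormal_imp_onb:
  assumes fin: "finite I"
    and on: "\<And>i j. i \<in> I \<Longrightarrow> j \<in> I \<Longrightarrow> (\<Sum>a\<in>I. cnj (u i a) * u j a) = of_bool (i = j)"
  shows "onb I u"
proof -
  obtain g where g: "bij_betw g {0..<card I} I" using ex_bij_betw_nat_finite[OF fin] by blast
  let ?n = "card I"
  have gI: "g i \<in> I" if "i < ?n" for i using g that by (auto dest: bij_betwE)
  have ginj: "g i = g j \<longleftrightarrow> i = j" if "i < ?n" "j < ?n" for i j
    using g that by (auto simp: bij_betw_def inj_on_def)
  have reidx: "(\<Sum>k = 0..<?n. f (g k)) = sum f I" for f :: "'a \<Rightarrow> complex"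
    using sum.reindex_bij_betw[OF g] .
  define P where "P = mat ?n ?n (\<lambda>(i, j). u (g j) (g i))"
  define Q where "Q = mat ?n ?n (\<lambda>(i, j). cnj (u (g i) (g j)))"
  have PC: "P \<in> carrier_mat ?n ?n" and QC: "Q \<in> carrier_mat ?n ?n" by (auto simp: P_def Q_def)
  have "Q * P = 1\<^sub>m ?n"
    by (intro eq_matI) (auto simp: scalar_prod_def P_def Q_def on gI ginj
        reidx[of "\<lambda>a. cnj (u (g i) a) * u (g j) a" for i j])
  hence PQ: "P * Q = 1\<^sub>m ?n" using mat_mult_left_right_inverse[OF QC PC] by blast
  have "(\<Sum>j\<in>I. u j a * cnj (u j b)) = of_bool (a = b)" if ab: "a \<in> I" "b \<in> I" for a b
  proof -
    have "a \<in> g ` {0..<?n}" "b \<in> g ` {0..<?n}" using ab bij_betw_imp_surj_on[OF g] by auto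
    then obtain i j where ij: "i < ?n" "j < ?n" "a = g i" "b = g j" by auto
    have "(P * Q) $$ (i, j) = (\<Sum>k = 0..<?n. u (g k) (g i) * cnj (u (g k) (g j)))"
      using ij by (simp add: P_def Q_def scalar_prod_def)
    also have "\<dots> = (\<Sum>k\<in>I. u k a * cnj (u k b))"
      unfolding ij(3,4) by (rule reidx)
    finally show ?thesis unfolding PQ using ij(1,2) ginj[OF ij(1,2)] by (simp add: ij(3,4) split: if_splits)
  qed
  thus ?thesis using on by (auto simp: onb_def)
qed

section \<open>Characteristic polynomials and the entropy of a diagonalised matrix\<close>

lemma index_mult_mat_sum:
  assumes "A \<in> carrier_mat n n" "B \<in> carrier_mat n n" "i < n" "j < n"
  shows "(A * B) $$ (i, j) = (\<Sum>l<n. A $$ (i, l) * B $$ (l, j))"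
  using assms by (simp add: scalar_prod_def atLeast0LessThan)

text \<open>This pins down the choice in \<open>eigvals\<close> up to order, so that sums over the
  list are determined. A root of one product must occur in the other one, and the common factor
  cancels.\<close>

lemma linear_factors_unique:
  assumes "(\<Prod>a\<leftarrow>as. [:- a, 1:]) = (\<Prod>b\<leftarrow>bs. [:- b, 1 :: 'a :: field:])"
  shows "mset as = mset bs"
  using assms
proof (induction as arbitrary: bs)
  case Nil
  have "bs = []"
  proof (rule ccontr)
    assume "bs \<noteq> []"
    then obtain b bs' where "bs = b # bs'" by (cases bs) auto
    with Nil have "poly 1 b = poly ([:-b, 1:] * (\<Prod>b\<leftarrow>bs'. [:- b, 1:])) b" by simp
    thus False by simp
  qed
  thus ?case by simp
next
  case (Cons a as)
  have "poly (\<Prod>b\<leftarrow>bs. [:- b, 1:]) a = 0"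
    by (simp add: Cons.prems[symmetric])
  hence a: "a \<in> set bs" by (auto simp: poly_prod_list prod_list_zero_iff)
  have "(\<Prod>b\<leftarrow>bs. [:- b, 1:]) = [:- a, 1:] * (\<Prod>b\<leftarrow>remove1 a bs. [:- b, 1:])"
    using prod_list_map_remove1[OF a, of "\<lambda>b. [:- b, 1:]"] by simp
  with Cons.prems have "[:- a, 1:] * (\<Prod>b\<leftarrow>as. [:- b, 1:]) = [:- a, 1:] * (\<Prod>b\<leftarrow>remove1 a bs. [:- b, 1:])"
    by simp
  hence "(\<Prod>b\<leftarrow>as. [:- b, 1:]) = (\<Prod>b\<leftarrow>remove1 a bs. [:- b, 1:])"
    by (subst (asm) mult_cancel_left) simp
  from Cons.IH[OF this] show ?case using a by simp
qed

text \<open>The unitary made of the eigenvectors turns \<open>A\<close> into the diagonal matrix of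
  the \<open>p j\<close>, so both have the same characteristic polynomial. The bijection
  \<open>h\<close> lets \<open>I\<close> be a set of pairs although matrices are indexed by
  numbers.\<close>

lemma vn_entropy_eigsys:
  assumes fin: "finite I" and h: "bij_betw h I {..<N}" and A: "A \<in> carrier_mat N N"
    and \<alpha>: "\<And>a b. a \<in> I \<Longrightarrow> b \<in> I \<Longrightarrow> A $$ (h a, h b) = \<alpha> a b"
    and e: "eigsys I \<alpha> u p"
  shows "vn_entropy A = (\<Sum>j\<in>I. eta (p j))"
proof -
  define g where "g = inv_into I h"
  have g: "bij_betw g {..<N} I" unfolding g_def by (rule bij_betw_inv_into[OF h])
  have gI: "g i \<in> I" if "i < N" for i using g that by (auto dest: bij_betwE)
  have hg: "h (g i) = i" if "i < N" for i
    using bij_betw_inv_into_right[OF h] that by (simp add: g_def)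
  have ginj: "g i = g j \<longleftrightarrow> i = j" if "i < N" "j < N" for i j
    using g that by (auto simp: bij_betw_def inj_on_def)
  have reidx: "(\<Sum>k = 0..<N. f (g k)) = sum f I" for f :: "'a \<Rightarrow> complex"
    using sum.reindex_bij_betw[OF g, of f] unfolding atLeast0LessThan .
  have u: "onb I u" using e by (simp add: eigsys_def)
  define P where "P = mat N N (\<lambda>(i, j). u (g j) (g i))"
  define Q where "Q = mat N N (\<lambda>(i, j). cnj (u (g i) (g j)))"
  define D where "D = mat N N (\<lambda>(i, j). if i = j then complex_of_real (p (g i)) else 0)"
  have PC: "P \<in> carrier_mat N N" and QC: "Q \<in> carrier_mat N N" and DC: "D \<in> carrier_mat N N"
    by (auto simp: P_def Q_def D_def)
  have QP: "Q * P = 1\<^sub>m N"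
    by (intro eq_matI) (auto simp: scalar_prod_def P_def Q_def onb_orthonormal[OF u] gI ginj
        reidx[of "\<lambda>a. cnj (u (g i) a) * u (g j) a" for i j])
  have PQ: "P * Q = 1\<^sub>m N" using mat_mult_left_right_inverse[OF QC PC QP] .
  have PD: "(P * D) $$ (i, j) = u (g j) (g i) * p (g j)" if "i < N" "j < N" for i j
  proof -
    have "(P * D) $$ (i, j) = (\<Sum>k = 0..<N. u (g k) (g i) * (if k = j then complex_of_real (p (g k)) else 0))"
      using that by (simp add: P_def D_def scalar_prod_def)
    also have "\<dots> = (\<Sum>k = 0..<N. if k = j then u (g k) (g i) * p (g k) else 0)"
      by (rule sum.cong) auto
    finally show ?thesis using that by simp
  qed
  have "A = P * D * Q"
  proof (rule eq_matI)
    fix i j assume "i < dim_row (P * D * Q)" "j < dim_col (P * D * Q)"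
    hence ij: "i < N" "j < N" by (auto simp: P_def Q_def)
    have "(P * D * Q) $$ (i, j) = (\<Sum>k<N. (P * D) $$ (i, k) * Q $$ (k, j))"
      by (rule index_mult_mat_sum[OF mult_carrier_mat[OF PC DC] QC ij])
    also have "\<dots> = (\<Sum>k = 0..<N. (P * D) $$ (i, k) * Q $$ (k, j))" by (simp only: atLeast0LessThan)
    also have "\<dots> = (\<Sum>k = 0..<N. p (g k) * (u (g k) (g i) * cnj (u (g k) (g j))))"
    proof (rule sum.cong[OF refl])
      fix k assume "k \<in> {0..<N}"
      hence k: "k < N" by simp
      have "Q $$ (k, j) = cnj (u (g k) (g j))" using k ij by (simp add: Q_def)
      thus "(P * D) $$ (i, k) * Q $$ (k, j) = p (g k) * (u (g k) (g i) * cnj (u (g k) (g j)))"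
        unfolding PD[OF ij(1) k] by simp
    qed
    also have "\<dots> = (\<Sum>k\<in>I. p k * (u k (g i) * cnj (u k (g j))))" by (rule reidx)
    also have "\<dots> = \<alpha> (g i) (g j)" using e ij gI by (simp add: eigsys_def)
    also have "\<dots> = A $$ (i, j)" using \<alpha>[of "g i" "g j"] gI hg ij by simp
    finally show "A $$ (i, j) = (P * D * Q) $$ (i, j)" by simp
  qed (use A PC QC in auto)
  hence "similar_mat_wit A D P Q"
    by (intro similar_mat_witI[OF PQ QP _ A DC PC QC])
  hence "char_poly A = char_poly D"
    by (intro char_poly_similar) (auto simp: similar_mat_def)
  also have "\<dots> = (\<Prod>a\<leftarrow>diag_mat D. [:- a, 1:])"
    by (rule char_poly_upper_triangular[OF DC]) (auto simp: D_def)
  finally have cp: "char_poly A = (\<Prod>a\<leftarrow>diag_mat D. [:- a, 1:])" .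
  hence "char_poly A = (\<Prod>a\<leftarrow>eigvals A. [:- a, 1:])"
    unfolding eigvals_def
    by (rule someI[of "\<lambda>as. char_poly A = (\<Prod>a\<leftarrow>as. [:- a, 1:])"])
  with cp have "mset (eigvals A) = mset (diag_mat D)"
    by (intro linear_factors_unique) simp
  hence "vn_entropy A = (\<Sum>a\<leftarrow>diag_mat D. eta (Re a))"
    unfolding vn_entropy_def sum_mset_sum_list[symmetric] mset_map by simp
  also have "\<dots> = (\<Sum>i<N. eta (p (g i)))"
    by (simp add: diag_mat_def D_def sum_list_sum_nth comp_def atLeast0LessThan)
  also have "\<dots> = (\<Sum>j\<in>I. eta (p j))" by (rule sum.reindex_bij_betw[OF g])
  finally show ?thesis .
qed

section \<open>Existence of eigenvectors and the spectral theorem\<close>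

lemma mtrace_comm:
  assumes "A \<in> carrier_mat n n" "B \<in> carrier_mat n n"
  shows "mtrace (A * B) = mtrace (B * A)"
proof -
  have "mtrace (A * B) = (\<Sum>i<n. \<Sum>k<n. A $$ (i, k) * B $$ (k, i))"
    using assms by (simp add: mtrace_def scalar_prod_def atLeast0LessThan)
  also have "\<dots> = (\<Sum>k<n. \<Sum>i<n. A $$ (i, k) * B $$ (k, i))" by (rule sum.swap)
  also have "\<dots> = mtrace (B * A)"
    using assms by (simp add: mtrace_def scalar_prod_def atLeast0LessThan mult.commute)
  finally show ?thesis .
qed

text \<open>By a Schur decomposition the trace is the sum of the roots of the characteristic
  polynomial, so a nonzero trace forces a nonzero root.\<close>

lemma mtrace_nonzero_imp_eigenvector:
  assumes A: "A \<in> carrier_mat n n" and tr: "mtrace A \<noteq> 0"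
  shows "\<exists>v e. e \<noteq> 0 \<and> eigenvector A v e"
proof -
  obtain es where es: "char_poly A = (\<Prod>a\<leftarrow>es. [:- a, 1:])"
    using char_poly_factorized[OF A] by auto
  obtain B P Q where "schur_decomposition A es = (B, P, Q)" by (cases "schur_decomposition A es") auto
  from schur_decomposition[OF A es this]
  have sim: "similar_mat_wit A B P Q" and diag: "diag_mat B = es" by auto
  note simD = similar_mat_witD2[OF A sim]
  have "P * B * Q = P * (B * Q)" using simD by (intro assoc_mult_mat) auto
  hence "mtrace A = mtrace (P * (B * Q))" using simD by simp
  also have "\<dots> = mtrace ((B * Q) * P)" using simD by (intro mtrace_comm) auto
  also have "(B * Q) * P = B * (Q * P)" using simD by (intro assoc_mult_mat) auto
  also have "\<dots> = B" using simD by simp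
  also have "mtrace B = sum_list es"
    unfolding diag[symmetric] using simD
    by (simp add: mtrace_def diag_mat_def sum_list_sum_nth atLeast0LessThan)
  finally have "sum_list es \<noteq> 0" using tr by simp
  moreover have "sum_list es = 0" if "\<forall>e\<in>set es. e = 0"
    using that by (induction es) auto
  ultimately obtain e where e: "e \<in> set es" "e \<noteq> 0" by blast
  have "poly (char_poly A) e = 0" using e unfolding es by (auto simp: poly_prod_list prod_list_zero_iff)
  hence "eigenvalue A e" by (simp add: eigenvalue_root_char_poly[OF A])
  thus ?thesis using e(2) unfolding eigenvalue_def by blast
qed

definition cip :: "'a set \<Rightarrow> ('a \<Rightarrow> complex) \<Rightarrow> ('a \<Rightarrow> complex) \<Rightarrow> complex" where
  "cip I f g = (\<Sum>a\<in>I. cnj (f a) * g a)"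

definition mv :: "'a set \<Rightarrow> ('a \<Rightarrow> 'a \<Rightarrow> complex) \<Rightarrow> ('a \<Rightarrow> complex) \<Rightarrow> 'a \<Rightarrow> complex" where
  "mv I \<alpha> f a = (\<Sum>b\<in>I. \<alpha> a b * f b)"

lemma cip_cnj: "cnj (cip I f g) = cip I g f"
  by (simp add: cip_def mult.commute)

lemma cip_add_right: "cip I f (\<lambda>a. g a + h a) = cip I f g + cip I f h"
  by (simp add: cip_def sum.distrib distrib_left)

lemma cip_scale_right: "cip I f (\<lambda>a. c * g a) = c * cip I f g"
  by (simp add: cip_def sum_distrib_left mult_ac)

lemma cip_scale_left: "cip I (\<lambda>a. c * f a) g = cnj c * cip I f g"
  by (simp add: cip_def sum_distrib_left mult_ac)

lemma cip_sum_right: "cip I f (\<lambda>a. \<Sum>j\<in>J. g j a) = (\<Sum>j\<in>J. cip I f (g j))"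
  unfolding cip_def sum_distrib_left by (rule sum.swap)

lemma cip_cong: "(\<And>a. a \<in> I \<Longrightarrow> f a = f' a) \<Longrightarrow> (\<And>a. a \<in> I \<Longrightarrow> g a = g' a) \<Longrightarrow> cip I f g = cip I f' g'"
  by (simp add: cip_def)

lemma cip_self: "cip I f f = of_real (\<Sum>a\<in>I. (cmod (f a))\<^sup>2)"
  by (simp add: cip_def complex_norm_square mult.commute flip: of_real_power)

lemma qform_eq_cip: "qform I \<alpha> v = cip I v (mv I \<alpha> v)"
  by (simp add: qform_def cip_def mv_def sum_distrib_left mult.assoc)

lemma cip_mv_hermitian:
  assumes "\<And>a b. a \<in> I \<Longrightarrow> b \<in> I \<Longrightarrow> \<alpha> b a = cnj (\<alpha> a b)"
  shows "cip I f (mv I \<alpha> g) = cip I (mv I \<alpha> f) g"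
proof -
  have "cip I f (mv I \<alpha> g) = (\<Sum>a\<in>I. \<Sum>b\<in>I. cnj (f a) * \<alpha> a b * g b)"
    by (simp add: cip_def mv_def sum_distrib_left mult.assoc)
  also have "\<dots> = (\<Sum>b\<in>I. \<Sum>a\<in>I. cnj (f a) * \<alpha> a b * g b)" by (rule sum.swap)
  also have "\<dots> = (\<Sum>b\<in>I. \<Sum>a\<in>I. cnj (f a) * cnj (\<alpha> b a) * g b)"
  proof (intro sum.cong refl)
    fix b a assume "b \<in> I" "a \<in> I"
    hence "\<alpha> a b = cnj (\<alpha> b a)" by (rule assms)
    thus "cnj (f a) * \<alpha> a b * g b = cnj (f a) * cnj (\<alpha> b a) * g b" by (rule arg_cong)
  qed
  also have "\<dots> = cip I (mv I \<alpha> f) g"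
    by (simp add: cip_def mv_def sum_distrib_left sum_distrib_right mult_ac)
  finally show ?thesis .
qed

lemma trace_nonzero_imp_eigenvector:
  assumes fin: "finite I" and tr: "(\<Sum>a\<in>I. \<alpha> a a) \<noteq> 0"
  shows "\<exists>v e. e \<noteq> 0 \<and> (\<exists>a\<in>I. v a \<noteq> 0) \<and> (\<forall>a\<in>I. mv I \<alpha> v a = e * v a)"
proof -
  let ?n = "card I"
  obtain g where g: "bij_betw g {0..<?n} I" using ex_bij_betw_nat_finite[OF fin] by blast
  have reidx: "(\<Sum>k = 0..<?n. f (g k)) = sum f I" for f :: "'a \<Rightarrow> complex"
    using sum.reindex_bij_betw[OF g] .
  define h where "h = inv_into {0..<?n} g"
  have hg: "h (g i) = i" if "i < ?n" for i
    using bij_betw_inv_into_left[OF g] that by (simp add: h_def)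
  have gh: "g (h a) = a" if "a \<in> I" for a
    using bij_betw_inv_into_right[OF g] that by (simp add: h_def)
  have hI: "h a < ?n" if "a \<in> I" for a
    using bij_betwE[OF bij_betw_inv_into[OF g]] that by (simp add: h_def)
  have gI: "g i \<in> I" if "i < ?n" for i using g that by (auto dest: bij_betwE)
  define A where "A = mat ?n ?n (\<lambda>(i, j). \<alpha> (g i) (g j))"
  have A: "A \<in> carrier_mat ?n ?n" by (simp add: A_def)
  have "mtrace A = (\<Sum>i = 0..<?n. \<alpha> (g i) (g i))"
    by (simp add: mtrace_def A_def atLeast0LessThan)
  also have "\<dots> = (\<Sum>a\<in>I. \<alpha> a a)" by (rule reidx)
  finally have "mtrace A \<noteq> 0" using tr by simp
  from mtrace_nonzero_imp_eigenvector[OF A this] obtain w e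
    where e: "e \<noteq> 0" and ev: "eigenvector A w e" by blast
  have w: "w \<in> carrier_vec ?n" "w \<noteq> 0\<^sub>v ?n" and Aw: "A *\<^sub>v w = e \<cdot>\<^sub>v w"
    using ev A by (auto simp: eigenvector_def)
  define v where "v a = w $ h a" for a
  have "mv I \<alpha> v a = e * v a" if a: "a \<in> I" for a
  proof -
    have "mv I \<alpha> v a = (\<Sum>k = 0..<?n. \<alpha> a (g k) * v (g k))"
      unfolding mv_def by (rule reidx[symmetric])
    also have "\<dots> = (\<Sum>k = 0..<?n. A $$ (h a, k) * w $ k)"
      using hI[OF a] gh[OF a] by (intro sum.cong) (auto simp: A_def v_def hg)
    also have "\<dots> = (A *\<^sub>v w) $ h a"
      using A w hI[OF a] by (simp add: scalar_prod_def)
    also have "\<dots> = e * v a" unfolding Aw v_def using w hI[OF a] by simp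
    finally show ?thesis .
  qed
  moreover have "\<exists>a\<in>I. v a \<noteq> 0"
  proof (rule ccontr)
    assume "\<not> ?thesis"
    hence "w $ i = 0" if "i < ?n" for i using gI[OF that] hg[OF that] by (auto simp: v_def)
    hence "w = 0\<^sub>v ?n" using w(1) by (intro eq_vecI) auto
    thus False using w(2) by simp
  qed
  ultimately show ?thesis using e by blast
qed

text \<open>Let \<open>Q\<close> be the projection onto the complement of the vectors found so far,
  and \<open>B = Q (\<alpha> + 1) Q\<close>. The added identity makes the trace of \<open>B\<close>
  positive even where \<open>\<alpha>\<close> vanishes, so \<open>B\<close> has an eigenvector with
  nonzero eigenvalue \<open>e\<close>. It lies in the range of \<open>Q\<close> and is an
  eigenvector of \<open>\<alpha>\<close> for \<open>e - 1\<close>.\<close>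

lemma psd_extend_eigenvectors:
  assumes fin: "finite I" and psd: "psd I \<alpha>" and S: "S \<subset> I"
    and on: "\<And>i j. i \<in> S \<Longrightarrow> j \<in> S \<Longrightarrow> cip I (u i) (u j) = of_bool (i = j)"
    and ev: "\<And>j a. j \<in> S \<Longrightarrow> a \<in> I \<Longrightarrow> mv I \<alpha> (u j) a = of_real (p j) * u j a"
  shows "\<exists>w q. cip I w w = 1 \<and> (\<forall>j\<in>S. cip I (u j) w = 0) \<and> (\<forall>a\<in>I. mv I \<alpha> w a = of_real q * w a)"
proof -
  have finS: "finite S" using S fin by (meson finite_subset psubset_imp_subset)
  have herm: "\<alpha> b a = cnj (\<alpha> a b)" if "a \<in> I" "b \<in> I" for a b
    using psd that unfolding psd_def by blast
  have nonneg: "0 \<le> Re (qform I \<alpha> v)" for v using psd unfolding psd_def by blast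
  define Q where "Q a b = of_bool (a = b) - (\<Sum>j\<in>S. u j a * cnj (u j b))" for a b
  have Qherm: "Q a b = cnj (Q b a)" for a b by (simp add: Q_def mult.commute)
  have mvQ: "mv I Q f a = f a - (\<Sum>j\<in>S. u j a * cip I (u j) f)" if "a \<in> I" for f a
  proof -
    have "mv I Q f a = (\<Sum>b\<in>I. of_bool (a = b) * f b) - (\<Sum>b\<in>I. \<Sum>j\<in>S. u j a * cnj (u j b) * f b)"
      by (simp add: mv_def Q_def left_diff_distrib sum_subtractf sum_distrib_right)
    also have "(\<Sum>b\<in>I. of_bool (a = b) * f b) = f a" using that fin by simp
    also have "(\<Sum>b\<in>I. \<Sum>j\<in>S. u j a * cnj (u j b) * f b) = (\<Sum>j\<in>S. u j a * cip I (u j) f)"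
      unfolding cip_def sum_distrib_left by (subst sum.swap) (simp add: mult.assoc)
    finally show ?thesis .
  qed
  define \<beta> where "\<beta> a b = \<alpha> a b + of_bool (a = b)" for a b
  have mv\<beta>: "mv I \<beta> f a = mv I \<alpha> f a + f a" if "a \<in> I" for f a
    using that fin by (simp add: mv_def \<beta>_def distrib_right sum.distrib)
  define B where "B a b = mv I Q (mv I \<beta> (\<lambda>d. Q d b)) a" for a b
  have mvB: "mv I B f a = mv I Q (mv I \<beta> (mv I Q f)) a" for f a
  proof -
    have "mv I B f a = (\<Sum>b\<in>I. \<Sum>c\<in>I. \<Sum>d\<in>I. Q a c * (\<beta> c d * (Q d b * f b)))"
      by (simp add: B_def mv_def sum_distrib_left sum_distrib_right mult.assoc)
    also have "\<dots> = (\<Sum>c\<in>I. \<Sum>b\<in>I. \<Sum>d\<in>I. Q a c * (\<beta> c d * (Q d b * f b)))" by (rule sum.swap)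
    also have "\<dots> = (\<Sum>c\<in>I. \<Sum>d\<in>I. \<Sum>b\<in>I. Q a c * (\<beta> c d * (Q d b * f b)))"
      by (intro sum.cong refl sum.swap)
    also have "\<dots> = mv I Q (mv I \<beta> (mv I Q f)) a" by (simp add: mv_def sum_distrib_left)
    finally show ?thesis .
  qed
  have trB: "(\<Sum>a\<in>I. B a a) = (\<Sum>a\<in>I. qform I \<alpha> (\<lambda>d. Q d a) + cip I (\<lambda>d. Q d a) (\<lambda>d. Q d a))"
  proof (rule sum.cong[OF refl])
    fix a assume "a \<in> I"
    have "B a a = cip I (\<lambda>d. Q d a) (mv I \<beta> (\<lambda>d. Q d a))"
      unfolding B_def by (subst mv_def, subst Qherm) (simp add: cip_def)
    also have "\<dots> = cip I (\<lambda>d. Q d a) (\<lambda>c. mv I \<alpha> (\<lambda>d. Q d a) c + Q c a)"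
      by (rule cip_cong) (simp_all add: mv\<beta>)
    finally show "B a a = qform I \<alpha> (\<lambda>d. Q d a) + cip I (\<lambda>d. Q d a) (\<lambda>d. Q d a)"
      by (simp add: cip_add_right qform_eq_cip)
  qed
  \<comment> \<open>A vanishing trace would make every column of \<open>Q\<close> vanish, because
    each contributes at least its squared norm. But the trace of \<open>Q\<close> is
    \<open>card I - card S\<close>, which is not zero.\<close>
  have "(\<Sum>a\<in>I. B a a) \<noteq> 0"
  proof
    assume "(\<Sum>a\<in>I. B a a) = 0"
    hence "(\<Sum>a\<in>I. Re (qform I \<alpha> (\<lambda>d. Q d a)) + (\<Sum>d\<in>I. (cmod (Q d a))\<^sup>2)) = 0"
      unfolding trB by (simp add: cip_self complex_eq_iff)
    moreover have "0 \<le> Re (qform I \<alpha> (\<lambda>d. Q d a)) + (\<Sum>d\<in>I. (cmod (Q d a))\<^sup>2)" for a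
      using nonneg by (intro add_nonneg_nonneg sum_nonneg) auto
    ultimately have z: "Re (qform I \<alpha> (\<lambda>d. Q d a)) + (\<Sum>d\<in>I. (cmod (Q d a))\<^sup>2) = 0" if "a \<in> I" for a
      using sum_nonneg_eq_0_iff[OF fin, of "\<lambda>a. Re (qform I \<alpha> (\<lambda>d. Q d a)) + (\<Sum>d\<in>I. (cmod (Q d a))\<^sup>2)"] that by simp
    have "(cmod (Q a a))\<^sup>2 \<le> 0" if a: "a \<in> I" for a
    proof -
      have "(cmod (Q a a))\<^sup>2 \<le> (\<Sum>d\<in>I. (cmod (Q d a))\<^sup>2)"
        using member_le_sum[of a I "\<lambda>d. (cmod (Q d a))\<^sup>2"] fin a by simp
      thus ?thesis using z[OF a] nonneg[of "\<lambda>d. Q d a"] by linarith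
    qed
    hence Q0: "Q a a = 0" if "a \<in> I" for a using that by simp
    have "(\<Sum>a\<in>I. Q a a) = of_nat (card I) - (\<Sum>a\<in>I. \<Sum>j\<in>S. u j a * cnj (u j a))"
      by (simp add: Q_def sum_subtractf)
    also have "(\<Sum>a\<in>I. \<Sum>j\<in>S. u j a * cnj (u j a)) = (\<Sum>j\<in>S. cip I (u j) (u j))"
      unfolding cip_def by (subst sum.swap) (simp add: mult.commute)
    also have "\<dots> = of_nat (card S)" using on by simp
    finally have "complex_of_nat (card I) = of_nat (card S)" using Q0 by simp
    thus False using psubset_card_mono[OF fin S] by (metis nat_less_le of_nat_eq_iff)
  qed
  from trace_nonzero_imp_eigenvector[where \<alpha> = B, OF fin this] obtain v e
    where e: "e \<noteq> 0" and v0: "\<exists>a\<in>I. v a \<noteq> 0" and Bv: "\<And>a. a \<in> I \<Longrightarrow> mv I B v a = e * v a" by blast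
  have orthQ: "cip I (u j) (mv I Q f) = 0" if j: "j \<in> S" for j f
  proof -
    have "cip I (u j) (mv I Q f) = cip I (u j) (\<lambda>a. f a + (\<Sum>i\<in>S. - cip I (u i) f * u i a))"
      by (rule cip_cong) (simp_all add: mvQ sum_negf mult.commute)
    also have "\<dots> = cip I (u j) f + (\<Sum>i\<in>S. - cip I (u i) f * of_bool (j = i))"
      using j on by (simp only: cip_add_right cip_sum_right cip_scale_right cong: sum.cong)
    also have "\<dots> = 0" using j finS by (simp add: sum_negf)
    finally show ?thesis .
  qed
  have orth: "cip I (u j) v = 0" if j: "j \<in> S" for j
  proof -
    have "e * cip I (u j) v = cip I (u j) (mv I B v)"
      unfolding cip_scale_right[symmetric] by (rule cip_cong) (simp_all add: Bv)
    also have "\<dots> = 0" unfolding ext[of "mv I B v", OF mvB] by (rule orthQ[OF j])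
    finally show ?thesis using e by simp
  qed
  have Qv: "mv I Q v a = v a" if "a \<in> I" for a using that by (simp add: mvQ orth)
  have mv_cong: "mv I \<beta> (mv I Q v) = mv I \<beta> v" using Qv by (auto simp: mv_def[of I \<beta>] fun_eq_iff)
  have \<alpha>v: "mv I \<alpha> v a = (e - 1) * v a" if a: "a \<in> I" for a
  proof -
    \<comment> \<open>Being Hermitian with eigenvectors \<open>u j\<close>, the operator preserves
      their orthogonal complement. The outer \<open>Q\<close> therefore acts as the identity on
      \<open>mv I \<beta> v\<close>.\<close>
    have "cip I (u j) (mv I \<beta> v) = 0" if j: "j \<in> S" for j
    proof -
      have "cip I (u j) (mv I \<beta> v) = cip I (u j) (\<lambda>a. mv I \<alpha> v a + v a)"
        by (rule cip_cong) (simp_all add: mv\<beta>)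
      also have "\<dots> = cip I (mv I \<alpha> (u j)) v"
        by (simp add: cip_add_right orth[OF j] cip_mv_hermitian[OF herm])
      also have "\<dots> = cip I (\<lambda>a. of_real (p j) * u j a) v"
        by (rule cip_cong) (simp_all add: ev j)
      finally show ?thesis by (simp add: cip_scale_left orth[OF j])
    qed
    hence "mv I Q (mv I \<beta> v) a = mv I \<alpha> v a + v a" using a by (simp add: mvQ mv\<beta>)
    moreover have "mv I Q (mv I \<beta> v) a = e * v a" using Bv[OF a] unfolding mvB mv_cong .
    ultimately show ?thesis by (simp add: algebra_simps)
  qed
  define s where "s = (\<Sum>a\<in>I. (cmod (v a))\<^sup>2)"
  have s: "s > 0" 
  proof -
    obtain a where a: "a \<in> I" "v a \<noteq> 0" using v0 by blast
    hence "0 < (cmod (v a))\<^sup>2" by simp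
    also have "\<dots> \<le> s" unfolding s_def
      using member_le_sum[of a I "\<lambda>d. (cmod (v d))\<^sup>2"] fin a by simp
    finally show ?thesis .
  qed
  have vv: "cip I v v = of_real s" by (simp add: cip_self s_def)
  \<comment> \<open>The eigenvalue is real, because the quadratic form of a Hermitian operator
    is.\<close>
  have "(e - 1) * of_real s = cip I v (mv I \<alpha> v)"
    unfolding vv[symmetric] cip_scale_right[symmetric] by (rule cip_cong) (simp_all add: \<alpha>v)
  moreover have "cnj (cip I v (mv I \<alpha> v)) = cip I v (mv I \<alpha> v)"
    by (simp add: cip_cnj cip_mv_hermitian[OF herm])
  ultimately have "cnj ((e - 1) * of_real s) = (e - 1) * of_real s" by metis
  hence "cnj (e - 1) = e - 1" using s by simp
  hence er: "e - 1 = of_real (Re (e - 1))" by (metis Reals_cnj_iff of_real_Re)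
  define w where "w a = of_real (1 / sqrt s) * v a" for a
  have "cip I w w = 1"
    unfolding w_def cip_scale_left cip_scale_right vv complex_cnj_complex_of_real of_real_mult[symmetric]
    using s by simp
  moreover have "cip I (u j) w = 0" if "j \<in> S" for j
    unfolding w_def cip_scale_right orth[OF that] by simp
  moreover have "mv I \<alpha> w a = of_real (Re (e - 1)) * w a" if "a \<in> I" for a
  proof -
    have "mv I \<alpha> w a = of_real (1 / sqrt s) * mv I \<alpha> v a"
      by (simp add: mv_def w_def sum_distrib_left mult_ac)
    also have "\<dots> = (e - 1) * w a" by (simp add: \<alpha>v[OF that] w_def)
    finally show ?thesis using er by metis
  qed
  ultimately show ?thesis by blast
qed

text \<open>Eigenvectors are added one at a time until every index carries one. Completeness of the
  resulting basis gives the decomposition, and the quadratic form at \<open>u j\<close> shows that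
  \<open>p j\<close> is nonnegative.\<close>

theorem psd_imp_eigsys:
  assumes fin: "finite I" and psd: "psd I \<alpha>"
  shows "\<exists>u p. eigsys I \<alpha> u p"
proof -
  have ex: "\<exists>u p. (\<forall>i\<in>S. \<forall>j\<in>S. cip I (u i) (u j) = of_bool (i = j)) \<and>
      (\<forall>j\<in>S. \<forall>a\<in>I. mv I \<alpha> (u j) a = of_real (p j) * u j a)" if "S \<subseteq> I" for S
    using finite_subset[OF that fin] that
  proof (induction S rule: finite_induct)
    case empty
    show ?case by simp
  next
    case (insert j S)
    then obtain u p where u: "\<forall>i\<in>S. \<forall>j\<in>S. cip I (u i) (u j) = of_bool (i = j)"
      and p: "\<forall>j\<in>S. \<forall>a\<in>I. mv I \<alpha> (u j) a = of_real (p j :: real) * u j a" by auto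
    have S: "S \<subset> I" using insert by auto
    obtain w q where w: "cip I w w = 1" "\<forall>j\<in>S. cip I (u j) w = 0"
      "\<forall>a\<in>I. mv I \<alpha> w a = of_real (q :: real) * w a"
      using psd_extend_eigenvectors[OF fin psd S, of u p] u p by blast
    have w': "\<forall>j\<in>S. cip I w (u j) = 0" using w(2) cip_cnj by (metis complex_cnj_zero)
    show ?case
      by (rule exI[of _ "u(j := w)"], rule exI[of _ "p(j := q)"]) (use insert(2) u p w w' in auto)
  qed
  obtain u p where u: "\<forall>i\<in>I. \<forall>j\<in>I. cip I (u i) (u j) = of_bool (i = j)"
      and p: "\<forall>j\<in>I. \<forall>a\<in>I. mv I \<alpha> (u j) a = of_real (p j :: real) * u j a"
    using ex[OF subset_refl] by blast
  have onb: "onb I u" by (rule orthonormal_imp_onb[OF fin]) (use u in \<open>auto simp: cip_def\<close>)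
  have "\<alpha> a b = (\<Sum>j\<in>I. p j * (u j a * cnj (u j b)))" if ab: "a \<in> I" "b \<in> I" for a b
  proof -
    have "(\<Sum>j\<in>I. p j * (u j a * cnj (u j b))) = (\<Sum>j\<in>I. mv I \<alpha> (u j) a * cnj (u j b))"
      using p ab by (intro sum.cong) auto
    also have "\<dots> = (\<Sum>j\<in>I. \<Sum>c\<in>I. \<alpha> a c * (u j c * cnj (u j b)))"
      by (simp add: mv_def sum_distrib_right mult.assoc)
    also have "\<dots> = (\<Sum>c\<in>I. \<Sum>j\<in>I. \<alpha> a c * (u j c * cnj (u j b)))" by (rule sum.swap)
    also have "\<dots> = (\<Sum>c\<in>I. \<alpha> a c * of_bool (c = b))"
      unfolding sum_distrib_left[symmetric] using onb_complete[OF onb] ab by (intro sum.cong) auto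
    also have "\<dots> = \<alpha> a b" using ab fin by simp
    finally show ?thesis by simp
  qed
  moreover have "0 \<le> p j" if j: "j \<in> I" for j
  proof -
    have "qform I \<alpha> (u j) = cip I (u j) (\<lambda>a. of_real (p j) * u j a)"
      unfolding qform_eq_cip by (rule cip_cong) (use p j in auto)
    also have "\<dots> = p j" using u j by (simp add: cip_scale_right)
    finally have "Re (qform I \<alpha> (u j)) = p j" by simp
    thus ?thesis using psd unfolding psd_def by metis
  qed
  ultimately have "eigsys I \<alpha> u p" using onb unfolding eigsys_def by blast
  thus ?thesis by blast
qed

subsection \<open>Monotonicity of the relative entropy\<close>

definition mm :: "'a set \<Rightarrow> ('a \<Rightarrow> 'a \<Rightarrow> complex) \<Rightarrow> ('a \<Rightarrow> 'a \<Rightarrow> complex) \<Rightarrow> 'a \<Rightarrow> 'a \<Rightarrow> complex" where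
  "mm I A B x y = (\<Sum>z\<in>I. A x z * B z y)"

definition adj :: "('a \<Rightarrow> 'a \<Rightarrow> complex) \<Rightarrow> 'a \<Rightarrow> 'a \<Rightarrow> complex" where
  "adj A x y = cnj (A y x)"

text \<open>The trace of the product, used as the pairing between states and test operators.\<close>

definition trp :: "'a set \<Rightarrow> ('a \<Rightarrow> 'a \<Rightarrow> complex) \<Rightarrow> ('a \<Rightarrow> 'a \<Rightarrow> complex) \<Rightarrow> complex" where
  "trp I A B = (\<Sum>x\<in>I. \<Sum>y\<in>I. A x y * B y x)"

lemma mv_mm: "mv I (mm I A B) f = mv I A (mv I B f)"
proof
  fix a
  have "mv I (mm I A B) f a = (\<Sum>b\<in>I. \<Sum>c\<in>I. A a c * (B c b * f b))"
    by (simp add: mv_def mm_def sum_distrib_right mult.assoc)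
  also have "\<dots> = (\<Sum>c\<in>I. \<Sum>b\<in>I. A a c * (B c b * f b))" by (rule sum.swap)
  finally show "mv I (mm I A B) f a = mv I A (mv I B f) a"
    by (simp add: mv_def sum_distrib_left)
qed

lemma cip_mv_adj: "cip I (mv I (adj A) f) g = cip I f (mv I A g)"
proof -
  have "cip I (mv I (adj A) f) g = (\<Sum>a\<in>I. \<Sum>b\<in>I. cnj (f b) * A b a * g a)"
    by (simp add: cip_def mv_def adj_def sum_distrib_right sum_distrib_left mult_ac)
  also have "\<dots> = (\<Sum>b\<in>I. \<Sum>a\<in>I. cnj (f b) * A b a * g a)" by (rule sum.swap)
  finally show ?thesis by (simp add: cip_def mv_def sum_distrib_left mult.assoc)
qed

lemma cip_adj_mv: "cip I f (mv I (adj A) g) = cip I (mv I A f) g"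
  by (metis cip_cnj cip_mv_adj)

lemma parseval:
  assumes fin: "finite I" and v: "onb I v"
  shows "(\<Sum>j\<in>I. cnj (cip I (v j) f) * cip I (v j) g) = cip I f g"
proof -
  have "(\<Sum>j\<in>I. cnj (cip I (v j) f) * cip I (v j) g)
      = (\<Sum>j\<in>I. \<Sum>a\<in>I. \<Sum>b\<in>I. cnj (f a) * g b * (v j a * cnj (v j b)))"
    unfolding cip_def cnj_sum sum_product by (simp add: mult_ac)
  also have "\<dots> = (\<Sum>a\<in>I. \<Sum>j\<in>I. \<Sum>b\<in>I. cnj (f a) * g b * (v j a * cnj (v j b)))" by (rule sum.swap)
  also have "\<dots> = (\<Sum>a\<in>I. \<Sum>b\<in>I. \<Sum>j\<in>I. cnj (f a) * g b * (v j a * cnj (v j b)))"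
    by (intro sum.cong refl sum.swap)
  also have "\<dots> = (\<Sum>a\<in>I. \<Sum>b\<in>I. cnj (f a) * g b * of_bool (a = b))"
    unfolding sum_distrib_left[symmetric] by (intro sum.cong refl) (simp add: onb_complete[OF v])
  also have "\<dots> = cip I f g" using fin by (simp add: cip_def)
  finally show ?thesis .
qed

lemma cnj_mult_self: "cnj z * z = of_real ((cmod z)\<^sup>2)"
  by (simp only: complex_norm_square mult.commute)

lemma parseval_norm:
  assumes "finite I" and "onb I v"
  shows "of_real (\<Sum>j\<in>I. (cmod (cip I (v j) f))\<^sup>2) = cip I f f"
  using parseval[OF assms, of f f] by (simp only: cnj_mult_self of_real_sum)

lemma eigsys_onb: "eigsys I \<alpha> u p \<Longrightarrow> onb I u"
  and eigsys_nonneg: "eigsys I \<alpha> u p \<Longrightarrow> j \<in> I \<Longrightarrow> 0 \<le> p j"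
  and eigsys_eq: "eigsys I \<alpha> u p \<Longrightarrow> a \<in> I \<Longrightarrow> b \<in> I \<Longrightarrow> \<alpha> a b = (\<Sum>j\<in>I. p j * (u j a * cnj (u j b)))"
  by (simp_all add: eigsys_def)

lemma onb_norm: "onb I u \<Longrightarrow> i \<in> I \<Longrightarrow> cip I (u i) (u i) = 1"
  using onb_orthonormal[of I u i i] by (simp add: cip_def)

section \<open>The variational formula in two eigenbases\<close>

lemma trp_eigsys:
  assumes "eigsys I \<alpha> u p"
  shows "trp I \<alpha> Y = (\<Sum>i\<in>I. p i * qform I Y (u i))"
proof -
  have "trp I \<alpha> Y = (\<Sum>x\<in>I. \<Sum>y\<in>I. \<Sum>i\<in>I. p i * (cnj (u i y) * Y y x * u i x))"
    unfolding trp_def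
    by (intro sum.cong refl) (simp add: eigsys_eq[OF assms] sum_distrib_left sum_distrib_right mult_ac)
  also have "\<dots> = (\<Sum>x\<in>I. \<Sum>i\<in>I. \<Sum>y\<in>I. p i * (cnj (u i y) * Y y x * u i x))"
    by (intro sum.cong refl sum.swap)
  also have "\<dots> = (\<Sum>i\<in>I. \<Sum>x\<in>I. \<Sum>y\<in>I. p i * (cnj (u i y) * Y y x * u i x))" by (rule sum.swap)
  also have "\<dots> = (\<Sum>i\<in>I. \<Sum>y\<in>I. \<Sum>x\<in>I. p i * (cnj (u i y) * Y y x * u i x))"
    by (intro sum.cong refl sum.swap)
  finally show ?thesis by (simp add: qform_def sum_distrib_left)
qed

lemma qform_eigsys:
  assumes e: "eigsys I \<alpha> u p"
  shows "qform I \<alpha> f = of_real (\<Sum>i\<in>I. p i * (cmod (cip I f (u i)))\<^sup>2)"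
proof -
  have rank1: "qform I (\<lambda>y x. f y * cnj (f x)) g = of_real ((cmod (cip I f g))\<^sup>2)" for g
  proof -
    have "qform I (\<lambda>y x. f y * cnj (f x)) g = cnj (cip I f g) * cip I f g"
      unfolding qform_def cip_def cnj_sum sum_product by (simp add: mult_ac)
    thus ?thesis by (simp only: cnj_mult_self)
  qed
  have "qform I \<alpha> f = trp I \<alpha> (\<lambda>y x. f y * cnj (f x))"
    by (simp add: qform_def trp_def mult_ac)
  also have "\<dots> = (\<Sum>i\<in>I. p i * qform I (\<lambda>y x. f y * cnj (f x)) (u i))" by (rule trp_eigsys[OF e])
  finally show ?thesis by (simp add: rank1)
qed

text \<open>For fixed \<open>X\<close> this is linear over the reals in the pair
  \<open>\<alpha>\<close>, \<open>\<beta>\<close>. For \<open>t > 0\<close> its maximum over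
  \<open>X\<close> is \<open>resolvent_form\<close>.\<close>

definition test_functional :: "'a set \<Rightarrow> real \<Rightarrow> ('a \<Rightarrow> 'a \<Rightarrow> complex) \<Rightarrow> ('a \<Rightarrow> 'a \<Rightarrow> complex) \<Rightarrow> ('a \<Rightarrow> 'a \<Rightarrow> complex) \<Rightarrow> real" where
  "test_functional I t \<alpha> \<beta> X =
     2 * Re (trp I \<alpha> (adj X)) - Re (trp I \<beta> (mm I X (adj X))) - t * Re (trp I \<alpha> (mm I (adj X) X))"

text \<open>The quadratic form at \<open>\<alpha>\<close> of the inverse of the map
  \<open>X \<mapsto> \<beta> X + t X \<alpha>\<close>, whose eigenvalues are
  \<open>q j + t * p i\<close> on the rank-one operators built from \<open>v j\<close> and
  \<open>u i\<close>.\<close>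

definition resolvent_form ::
  "'a set \<Rightarrow> real \<Rightarrow> ('a \<Rightarrow> 'a \<Rightarrow> complex) \<Rightarrow> ('a \<Rightarrow> real) \<Rightarrow> ('a \<Rightarrow> 'a \<Rightarrow> complex) \<Rightarrow> ('a \<Rightarrow> real) \<Rightarrow> real" where
  "resolvent_form I t u p v q =
     (\<Sum>i\<in>I. \<Sum>j\<in>I. (p i)\<^sup>2 * (cmod (cip I (v j) (u i)))\<^sup>2 / (q j + t * p i))"

text \<open>Parseval in both eigenbases diagonalises the three traces at once: only the matrix
  elements of \<open>X\<close> from \<open>u i\<close> to \<open>v j\<close> enter, and each in a
  summand of its own.\<close>

lemma test_functional_expand:
  assumes fin: "finite I" and \<alpha>: "eigsys I \<alpha> u p" and \<beta>: "eigsys I \<beta> v q"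
  shows "test_functional I t \<alpha> \<beta> X =
    (\<Sum>i\<in>I. \<Sum>j\<in>I. 2 * p i * Re (cnj (cip I (v j) (mv I X (u i))) * cip I (v j) (u i))
       - (q j + t * p i) * (cmod (cip I (v j) (mv I X (u i))))\<^sup>2)"
proof -
  note u = eigsys_onb[OF \<alpha>] and v = eigsys_onb[OF \<beta>]
  let ?x = "\<lambda>j i. cip I (v j) (mv I X (u i))"
  have a: "trp I \<alpha> (adj X) = (\<Sum>i\<in>I. p i * (\<Sum>j\<in>I. cnj (?x j i) * cip I (v j) (u i)))"
    unfolding trp_eigsys[OF \<alpha>] qform_eq_cip cip_adj_mv parseval[OF fin v] ..
  have b: "trp I \<beta> (mm I X (adj X)) = of_real (\<Sum>j\<in>I. q j * (\<Sum>i\<in>I. (cmod (?x j i))\<^sup>2))"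
  proof -
    have "qform I (mm I X (adj X)) (v j) = of_real (\<Sum>i\<in>I. (cmod (?x j i))\<^sup>2)" for j
    proof -
      have "cmod (cip I (u i) (mv I (adj X) (v j))) = cmod (?x j i)" for i
        by (metis cip_adj_mv cip_cnj complex_mod_cnj)
      thus ?thesis
        using parseval_norm[OF fin u, of "mv I (adj X) (v j)"]
        by (simp add: qform_eq_cip mv_mm cip_mv_adj[symmetric])
    qed
    thus ?thesis unfolding trp_eigsys[OF \<beta>] by simp
  qed
  have c: "trp I \<alpha> (mm I (adj X) X) = of_real (\<Sum>i\<in>I. p i * (\<Sum>j\<in>I. (cmod (?x j i))\<^sup>2))"
  proof -
    have "qform I (mm I (adj X) X) (u i) = of_real (\<Sum>j\<in>I. (cmod (?x j i))\<^sup>2)" for i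
      using parseval_norm[OF fin v, of "mv I X (u i)"]
      by (simp add: qform_eq_cip mv_mm cip_adj_mv)
    thus ?thesis unfolding trp_eigsys[OF \<alpha>] by simp
  qed
  have b': "(\<Sum>j\<in>I. q j * (\<Sum>i\<in>I. (cmod (?x j i))\<^sup>2)) = (\<Sum>i\<in>I. \<Sum>j\<in>I. q j * (cmod (?x j i))\<^sup>2)"
    unfolding sum_distrib_left by (rule sum.swap)
  have a': "Re (trp I \<alpha> (adj X)) = (\<Sum>i\<in>I. \<Sum>j\<in>I. p i * Re (cnj (?x j i) * cip I (v j) (u i)))"
    unfolding a by (simp add: sum_distrib_left)
  show ?thesis
    unfolding test_functional_def a' b c Re_complex_of_real b'
    by (simp only: sum_distrib_left sum_subtractf[symmetric]) (simp add: algebra_simps)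
qed

text \<open>Since the matrix elements of \<open>X\<close> are decoupled, it suffices to complete the
  square in each of them.\<close>

lemma test_functional_le:
  assumes fin: "finite I" and \<alpha>: "eigsys I \<alpha> u p" and \<beta>: "eigsys I \<beta> v q" and t: "t > 0"
  shows "test_functional I t \<alpha> \<beta> X \<le> resolvent_form I t u p v q"
proof -
  have scalar: "2 * P * Re (cnj x * w) - (Q + t * P) * (cmod x)\<^sup>2 \<le> P\<^sup>2 * (cmod w)\<^sup>2 / (Q + t * P)"
    if "P \<ge> 0" "Q \<ge> 0" for P Q :: real and x w :: complex
  proof (cases "Q + t * P = 0")
    \<comment> \<open>As \<open>t > 0\<close>, a vanishing denominator forces \<open>P = 0\<close>.
      Then both sides are zero, division by zero giving zero.\<close>
    case True
    hence "P = 0" using that t by (metis add_nonneg_eq_0_iff mult_eq_0_iff less_eq_real_def mult_nonneg_nonneg less_irrefl)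
    with True show ?thesis by simp
  next
    case False
    let ?s = "Q + t * P"
    have s: "?s > 0" using False that t by (simp add: add_nonneg_nonneg order_less_le)
    have "Re (cnj x * w) \<le> cmod x * cmod w"
      using complex_Re_le_cmod[of "cnj x * w"] by (simp add: norm_mult)
    hence "2 * P * Re (cnj x * w) \<le> 2 * P * (cmod x * cmod w)" using that by (intro mult_left_mono) auto
    moreover have "2 * P * (cmod x * cmod w) - ?s * (cmod x)\<^sup>2 \<le> P\<^sup>2 * (cmod w)\<^sup>2 / ?s"
    proof -
      have "0 \<le> (?s * cmod x - P * cmod w)\<^sup>2" by simp
      hence "(2 * P * (cmod x * cmod w) - ?s * (cmod x)\<^sup>2) * ?s \<le> P\<^sup>2 * (cmod w)\<^sup>2"
        by (simp add: power2_eq_square algebra_simps)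
      thus ?thesis using s by (simp add: pos_le_divide_eq)
    qed
    ultimately show ?thesis by linarith
  qed
  show ?thesis
    unfolding test_functional_expand[OF fin \<alpha> \<beta>] resolvent_form_def
    by (intro sum_mono scalar eigsys_nonneg[OF \<alpha>] eigsys_nonneg[OF \<beta>])
qed

lemma test_functional_attained:
  assumes fin: "finite I" and \<alpha>: "eigsys I \<alpha> u p" and \<beta>: "eigsys I \<beta> v q"
  shows "\<exists>X. test_functional I t \<alpha> \<beta> X = resolvent_form I t u p v q"
proof -
  note u = eigsys_onb[OF \<alpha>] and v = eigsys_onb[OF \<beta>]
  \<comment> \<open>These values make every completed square vanish. The next line assembles the
    operator that has them as its matrix elements between the two bases.\<close>
  define y where "y j i = complex_of_real (p i / (q j + t * p i)) * cip I (v j) (u i)" for i j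
  define X where "X a b = (\<Sum>k\<in>I. \<Sum>l\<in>I. y k l * (v k a * cnj (u l b)))" for a b
  have mvX: "mv I X (u i) = (\<lambda>a. \<Sum>k\<in>I. y k i * v k a)" if i: "i \<in> I" for i
  proof
    fix a
    have "mv I X (u i) a = (\<Sum>b\<in>I. \<Sum>k\<in>I. \<Sum>l\<in>I. y k l * v k a * (cnj (u l b) * u i b))"
      by (simp add: mv_def X_def sum_distrib_right sum_distrib_left mult_ac)
    also have "\<dots> = (\<Sum>k\<in>I. \<Sum>b\<in>I. \<Sum>l\<in>I. y k l * v k a * (cnj (u l b) * u i b))" by (rule sum.swap)
    also have "\<dots> = (\<Sum>k\<in>I. \<Sum>l\<in>I. \<Sum>b\<in>I. y k l * v k a * (cnj (u l b) * u i b))"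
      by (intro sum.cong refl sum.swap)
    also have "\<dots> = (\<Sum>k\<in>I. \<Sum>l\<in>I. y k l * v k a * of_bool (l = i))"
      unfolding sum_distrib_left[symmetric] using i
      by (intro sum.cong refl) (simp add: onb_orthonormal[OF u])
    also have "\<dots> = (\<Sum>k\<in>I. y k i * v k a)" using fin i by simp
    finally show "mv I X (u i) a = (\<Sum>k\<in>I. y k i * v k a)" .
  qed
  have x: "cip I (v j) (mv I X (u i)) = y j i" if "i \<in> I" "j \<in> I" for i j
  proof -
    have "cip I (v j) (v k) = of_bool (j = k)" if "k \<in> I" for k
      using onb_orthonormal[OF v \<open>j \<in> I\<close> that] by (simp add: cip_def)
    thus ?thesis using that fin
      by (simp add: mvX cip_sum_right cip_scale_right cong: sum.cong)
  qed
  have scalar: "2 * P * Re (cnj (complex_of_real (P / s) * w) * w) - s * (cmod (complex_of_real (P / s) * w))\<^sup>2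
      = P\<^sup>2 * (cmod w)\<^sup>2 / s" for P s :: real and w
  proof -
    have "cnj w * w = of_real ((cmod w)\<^sup>2)" by (simp only: cnj_mult_self)
    hence "Re (cnj (complex_of_real (P / s) * w) * w) = P / s * (cmod w)\<^sup>2"
      by (simp only: complex_cnj_mult complex_cnj_complex_of_real mult.assoc of_real_mult[symmetric] Re_complex_of_real)
    moreover have "(cmod (complex_of_real (P / s) * w))\<^sup>2 = (P / s)\<^sup>2 * (cmod w)\<^sup>2"
      by (simp add: norm_mult norm_divide power_mult_distrib power_divide)
    ultimately show ?thesis by (cases "s = 0") (simp_all add: power2_eq_square field_simps)
  qed
  have "test_functional I t \<alpha> \<beta> X = resolvent_form I t u p v q"
    unfolding test_functional_expand[OF fin \<alpha> \<beta>] resolvent_form_def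
    by (intro sum.cong refl) (simp only: x y_def scalar)
  thus ?thesis by blast
qed

text \<open>Subtracting \<open>ln (1 + t)\<close> keeps the sum bounded for large \<open>t\<close>,
  where \<open>ln (q j + t * p i)\<close> alone would diverge.\<close>

definition log_resolvent ::
  "'a set \<Rightarrow> ('a \<Rightarrow> 'a \<Rightarrow> complex) \<Rightarrow> ('a \<Rightarrow> real) \<Rightarrow> ('a \<Rightarrow> 'a \<Rightarrow> complex) \<Rightarrow> ('a \<Rightarrow> real) \<Rightarrow> real \<Rightarrow> real" where
  "log_resolvent I u p v q t =
     (\<Sum>i\<in>I. \<Sum>j\<in>I. p i * (cmod (cip I (v j) (u i)))\<^sup>2 * (ln (q j + t * p i) - ln (1 + t)))"

section \<open>Derivative and limits of the logarithmic double sum\<close>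

lemma sum_overlap_right:
  assumes fin: "finite I" and u: "onb I u" and v: "onb I v" and i: "i \<in> I"
  shows "(\<Sum>j\<in>I. (cmod (cip I (v j) (u i)))\<^sup>2) = 1"
  using parseval_norm[OF fin v, of "u i"] unfolding onb_norm[OF u i] by (metis of_real_eq_1_iff)

text \<open>Differentiation is termwise; summands with \<open>p i = 0\<close> are constantly zero.
  The squared overlaps of \<open>u i\<close> with the basis \<open>v\<close> add up to one, so the
  part coming from \<open>ln (1 + t)\<close> depends on the trace only.\<close>

lemma log_resolvent_deriv:
  assumes fin: "finite I" and \<alpha>: "eigsys I \<alpha> u p" and \<beta>: "eigsys I \<beta> v q" and t: "t > 0"
  shows "(log_resolvent I u p v q has_real_derivative
     resolvent_form I t u p v q - (\<Sum>i\<in>I. p i) / (1 + t)) (at t)"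
proof -
  note u = eigsys_onb[OF \<alpha>] and v = eigsys_onb[OF \<beta>]
  let ?w = "\<lambda>j i. (cmod (cip I (v j) (u i)))\<^sup>2"
  have d: "((\<lambda>t. P * w * (ln (Q + t * P) - ln (1 + t))) has_real_derivative
      (P\<^sup>2 * w / (Q + t * P) - P * w / (1 + t))) (at t)" if "P \<ge> 0" "Q \<ge> 0" for P Q w :: real
  proof (cases "P = 0")
    case False
    with that have "P > 0" by simp
    hence "Q + t * P > 0" using that t by (simp add: add_nonneg_pos)
    with t show ?thesis
      by (auto intro!: derivative_eq_intros simp: power2_eq_square divide_simps) (simp add: algebra_simps)
  qed simp
  have "(log_resolvent I u p v q has_real_derivative
      (\<Sum>i\<in>I. \<Sum>j\<in>I. ((p i)\<^sup>2 * ?w j i / (q j + t * p i) - p i * ?w j i / (1 + t)))) (at t)"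
    unfolding log_resolvent_def
    by (intro DERIV_sum d eigsys_nonneg[OF \<alpha>] eigsys_nonneg[OF \<beta>])
  also have "(\<Sum>i\<in>I. \<Sum>j\<in>I. ((p i)\<^sup>2 * ?w j i / (q j + t * p i) - p i * ?w j i / (1 + t)))
      = resolvent_form I t u p v q - (\<Sum>i\<in>I. \<Sum>j\<in>I. p i * ?w j i) / (1 + t)"
    by (simp add: resolvent_form_def sum_subtractf sum_divide_distrib)
  also have "(\<Sum>i\<in>I. \<Sum>j\<in>I. p i * ?w j i) = (\<Sum>i\<in>I. p i)"
    unfolding sum_distrib_left[symmetric] by (intro sum.cong refl) (simp add: sum_overlap_right[OF fin u v])
  finally show ?thesis .
qed

text \<open>Under the support condition every summand with \<open>q j = 0\<close> has weight zero,
  which removes the logarithms that would diverge. The remaining summands are continuous at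
  zero.\<close>

lemma log_resolvent_at_right_0:
  assumes fin: "finite I" and \<alpha>: "eigsys I \<alpha> u p" and \<beta>: "eigsys I \<beta> v q"
    and supp: "\<And>j. j \<in> I \<Longrightarrow> q j = 0 \<Longrightarrow> Re (qform I \<alpha> (v j)) = 0"
  shows "(log_resolvent I u p v q \<longlongrightarrow> (\<Sum>j\<in>I. Re (qform I \<alpha> (v j)) * ln (q j))) (at_right 0)"
proof -
  let ?w = "\<lambda>j i. (cmod (cip I (v j) (u i)))\<^sup>2"
  have q: "Re (qform I \<alpha> (v j)) = (\<Sum>i\<in>I. p i * ?w j i)" for j
    unfolding qform_eigsys[OF \<alpha>] by simp
  have "(log_resolvent I u p v q \<longlongrightarrow> (\<Sum>i\<in>I. \<Sum>j\<in>I. p i * ?w j i * ln (q j))) (at_right 0)"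
    unfolding log_resolvent_def
  proof (intro tendsto_sum)
    fix i j assume i: "i \<in> I" and j: "j \<in> I"
    show "((\<lambda>t. p i * ?w j i * (ln (q j + t * p i) - ln (1 + t))) \<longlongrightarrow> p i * ?w j i * ln (q j)) (at_right 0)"
    proof (cases "q j = 0")
      case True
      have "(\<Sum>i\<in>I. p i * ?w j i) = 0" using supp[OF j True] q by simp
      hence z: "p i * ?w j i = 0"
        using sum_nonneg_eq_0_iff[OF fin, of "\<lambda>i. p i * ?w j i"] eigsys_nonneg[OF \<alpha>] i by simp
      show ?thesis unfolding z by simp
    next
      case False
      hence "((\<lambda>t. p i * ?w j i * (ln (q j + t * p i) - ln (1 + t)))
          \<longlongrightarrow> p i * ?w j i * (ln (q j + 0 * p i) - ln (1 + 0))) (at_right 0)"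
        by (intro tendsto_intros) auto
      thus ?thesis by simp
    qed
  qed
  also have "(\<Sum>i\<in>I. \<Sum>j\<in>I. p i * ?w j i * ln (q j)) = (\<Sum>j\<in>I. Re (qform I \<alpha> (v j)) * ln (q j))"
    unfolding q sum_distrib_right by (rule sum.swap)
  finally show ?thesis .
qed

text \<open>For \<open>P > 0\<close> the bracket equals \<open>ln (P + (Q - P) / (1 + t))\<close>
  and tends to \<open>ln P\<close>; summands with \<open>p i = 0\<close> vanish throughout.\<close>

lemma log_resolvent_at_top:
  assumes fin: "finite I" and \<alpha>: "eigsys I \<alpha> u p" and \<beta>: "eigsys I \<beta> v q"
  shows "(log_resolvent I u p v q \<longlongrightarrow> (\<Sum>i\<in>I. p i * ln (p i))) at_top"
proof -
  note u = eigsys_onb[OF \<alpha>] and v = eigsys_onb[OF \<beta>]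
  let ?w = "\<lambda>j i. (cmod (cip I (v j) (u i)))\<^sup>2"
  have lim: "((\<lambda>t. ln (Q + t * P) - ln (1 + t)) \<longlongrightarrow> ln P) at_top" if "P > 0" "Q \<ge> 0" for P Q :: real
  proof -
    have "((\<lambda>t. P + (Q - P) / (1 + t)) \<longlongrightarrow> P + 0) at_top"
      by (intro tendsto_add tendsto_const real_tendsto_divide_at_top[OF tendsto_const] filterlim_tendsto_add_at_top[OF tendsto_const filterlim_ident])
    hence "((\<lambda>t. ln (P + (Q - P) / (1 + t))) \<longlongrightarrow> ln P) at_top"
      using that by (intro tendsto_ln) auto
    moreover have "eventually (\<lambda>t. ln (P + (Q - P) / (1 + t)) = ln (Q + t * P) - ln (1 + t)) at_top"
      using eventually_gt_at_top[of 0]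
    proof eventually_elim
      case (elim t)
      have "P + (Q - P) / (1 + t) = (Q + t * P) / (1 + t)" using elim by (simp add: field_simps)
      moreover have "Q + t * P > 0" using elim that by (simp add: add_nonneg_pos)
      ultimately show ?case using elim by (simp add: ln_div)
    qed
    ultimately show ?thesis by (rule Lim_transform_eventually)
  qed
  have "(log_resolvent I u p v q \<longlongrightarrow> (\<Sum>i\<in>I. \<Sum>j\<in>I. p i * ?w j i * ln (p i))) at_top"
    unfolding log_resolvent_def
  proof (intro tendsto_sum)
    fix i j assume i: "i \<in> I" and j: "j \<in> I"
    show "((\<lambda>t. p i * ?w j i * (ln (q j + t * p i) - ln (1 + t))) \<longlongrightarrow> p i * ?w j i * ln (p i)) at_top"
    proof (cases "p i = 0")
      case False
      thus ?thesis using eigsys_nonneg[OF \<alpha> i] eigsys_nonneg[OF \<beta> j]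
        by (intro tendsto_mult_left lim) auto
    qed simp
  qed
  also have "(\<Sum>i\<in>I. \<Sum>j\<in>I. p i * ?w j i * ln (p i)) = (\<Sum>i\<in>I. p i * ln (p i) * (\<Sum>j\<in>I. ?w j i))"
    by (simp add: sum_distrib_left mult_ac)
  also have "\<dots> = (\<Sum>i\<in>I. p i * ln (p i))"
    by (intro sum.cong refl) (simp add: sum_overlap_right[OF fin u v])
  finally show ?thesis .
qed

text \<open>The difference \<open>G\<close> of the two logarithmic sums is nondecreasing for
  \<open>t > 0\<close>; comparing its limits at zero and at infinity gives the claim. Equal total
  traces cancel the terms with \<open>1 + t\<close>. Families on both sides let the same argument
  cover joint convexity and measurements.\<close>

theorem relative_entropy_monotone:
  assumes fin: "finite I" "finite J" "finite R" "finite K"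
    and \<alpha>: "\<And>r. r \<in> R \<Longrightarrow> eigsys I (\<alpha> r) (u r) (p r)" and \<beta>: "\<And>r. r \<in> R \<Longrightarrow> eigsys I (\<beta> r) (v r) (q r)"
    and \<alpha>': "\<And>k. k \<in> K \<Longrightarrow> eigsys J (\<alpha>' k) (u' k) (p' k)" and \<beta>': "\<And>k. k \<in> K \<Longrightarrow> eigsys J (\<beta>' k) (v' k) (q' k)"
    and supp: "\<And>r j. r \<in> R \<Longrightarrow> j \<in> I \<Longrightarrow> q r j = 0 \<Longrightarrow> Re (qform I (\<alpha> r) (v r j)) = 0"
    and supp': "\<And>k j. k \<in> K \<Longrightarrow> j \<in> J \<Longrightarrow> q' k j = 0 \<Longrightarrow> Re (qform J (\<alpha>' k) (v' k j)) = 0"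
    and tr: "(\<Sum>r\<in>R. \<Sum>i\<in>I. p r i) = (\<Sum>k\<in>K. \<Sum>i\<in>J. p' k i)"
    and test: "\<And>t Y. t > 0 \<Longrightarrow> \<exists>X. (\<Sum>k\<in>K. test_functional J t (\<alpha>' k) (\<beta>' k) (Y k)) \<le>
       (\<Sum>r\<in>R. test_functional I t (\<alpha> r) (\<beta> r) (X r))"
  shows "(\<Sum>k\<in>K. (\<Sum>i\<in>J. p' k i * ln (p' k i)) - (\<Sum>j\<in>J. Re (qform J (\<alpha>' k) (v' k j)) * ln (q' k j)))
     \<le> (\<Sum>r\<in>R. (\<Sum>i\<in>I. p r i * ln (p r i)) - (\<Sum>j\<in>I. Re (qform I (\<alpha> r) (v r j)) * ln (q r j)))"
proof -
  define G where "G t = (\<Sum>r\<in>R. log_resolvent I (u r) (p r) (v r) (q r) t)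
      - (\<Sum>k\<in>K. log_resolvent J (u' k) (p' k) (v' k) (q' k) t)" for t
  \<comment> \<open>The optimal operators \<open>Y\<close> of the target are handed to
    \<open>test\<close>, and the operators \<open>X\<close> obtained bound the maxima of the source
    from below.\<close>
  have res: "(\<Sum>k\<in>K. resolvent_form J t (u' k) (p' k) (v' k) (q' k))
      \<le> (\<Sum>r\<in>R. resolvent_form I t (u r) (p r) (v r) (q r))" if t: "t > 0" for t
  proof -
    have "\<forall>k. \<exists>Y. k \<in> K \<longrightarrow> test_functional J t (\<alpha>' k) (\<beta>' k) Y = resolvent_form J t (u' k) (p' k) (v' k) (q' k)"
      using test_functional_attained[OF fin(2) \<alpha>' \<beta>'] by blast
    then obtain Y where Y: "\<And>k. k \<in> K \<Longrightarrow>
        test_functional J t (\<alpha>' k) (\<beta>' k) (Y k) = resolvent_form J t (u' k) (p' k) (v' k) (q' k)" by metis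
    obtain X where X: "(\<Sum>k\<in>K. test_functional J t (\<alpha>' k) (\<beta>' k) (Y k)) \<le>
       (\<Sum>r\<in>R. test_functional I t (\<alpha> r) (\<beta> r) (X r))" using test[OF t] by blast
    also have "\<dots> \<le> (\<Sum>r\<in>R. resolvent_form I t (u r) (p r) (v r) (q r))"
      by (intro sum_mono test_functional_le[OF fin(1) \<alpha> \<beta> t])
    finally show ?thesis using Y by simp
  qed
  have dG: "\<exists>D\<ge>0. (G has_real_derivative D) (at t)" if t: "t > 0" for t
  proof -
    have "(G has_real_derivative
       (\<Sum>r\<in>R. resolvent_form I t (u r) (p r) (v r) (q r) - (\<Sum>i\<in>I. p r i) / (1 + t))
       - (\<Sum>k\<in>K. resolvent_form J t (u' k) (p' k) (v' k) (q' k) - (\<Sum>i\<in>J. p' k i) / (1 + t))) (at t)"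
      unfolding G_def
      by (intro DERIV_diff DERIV_sum log_resolvent_deriv[OF fin(1) \<alpha> \<beta> t] log_resolvent_deriv[OF fin(2) \<alpha>' \<beta>' t])
    moreover have "0 \<le> (\<Sum>r\<in>R. resolvent_form I t (u r) (p r) (v r) (q r) - (\<Sum>i\<in>I. p r i) / (1 + t))
       - (\<Sum>k\<in>K. resolvent_form J t (u' k) (p' k) (v' k) (q' k) - (\<Sum>i\<in>J. p' k i) / (1 + t))"
      using res[OF t] by (simp add: sum_subtractf sum_divide_distrib[symmetric] tr)
    ultimately show ?thesis by blast
  qed
  have mono: "G s \<le> G t" if "0 < s" "s \<le> t" for s t
  proof (rule DERIV_nonneg_imp_nondecreasing[OF that(2)])
    fix x assume "s \<le> x" "x \<le> t"
    with that have "x > 0" by simp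
    thus "\<exists>y. (G has_real_derivative y) (at x) \<and> 0 \<le> y" using dG by blast
  qed
  let ?G0 = "(\<Sum>r\<in>R. \<Sum>j\<in>I. Re (qform I (\<alpha> r) (v r j)) * ln (q r j))
      - (\<Sum>k\<in>K. \<Sum>j\<in>J. Re (qform J (\<alpha>' k) (v' k j)) * ln (q' k j))"
  let ?G1 = "(\<Sum>r\<in>R. \<Sum>i\<in>I. p r i * ln (p r i)) - (\<Sum>k\<in>K. \<Sum>i\<in>J. p' k i * ln (p' k i))"
  have G0: "(G \<longlongrightarrow> ?G0) (at_right 0)"
    unfolding G_def
    by (intro tendsto_diff tendsto_sum log_resolvent_at_right_0[OF fin(1) \<alpha> \<beta> supp]
        log_resolvent_at_right_0[OF fin(2) \<alpha>' \<beta>' supp'])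
  have G1: "(G \<longlongrightarrow> ?G1) at_top"
    unfolding G_def
    by (intro tendsto_diff tendsto_sum log_resolvent_at_top[OF fin(1) \<alpha> \<beta>] log_resolvent_at_top[OF fin(2) \<alpha>' \<beta>'])
  have "G s \<le> ?G1" if "s > 0" for s
    using mono[OF that] by (intro tendsto_lowerbound[OF G1]) (auto simp: eventually_at_top_linorder)
  hence "?G0 \<le> ?G1"
    by (intro tendsto_upperbound[OF G0]) (auto simp: eventually_at_right_field intro!: exI[of _ 1])
  thus ?thesis by (simp add: sum_subtractf)
qed

subsection \<open>Superadditivity of the conditional entropy\<close>

lemma eigsys_cong:
  "(\<And>a b. a \<in> I \<Longrightarrow> b \<in> I \<Longrightarrow> \<alpha> a b = \<beta> a b) \<Longrightarrow> eigsys I \<alpha> u p = eigsys I \<beta> u p"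
  by (simp add: eigsys_def)

lemma qform_sum: "qform I (\<lambda>a b. \<Sum>k\<in>K. \<alpha> k a b) v = (\<Sum>k\<in>K. qform I (\<alpha> k) v)"
proof -
  have "qform I (\<lambda>a b. \<Sum>k\<in>K. \<alpha> k a b) v = (\<Sum>a\<in>I. \<Sum>b\<in>I. \<Sum>k\<in>K. cnj (v a) * \<alpha> k a b * v b)"
    by (simp add: qform_def sum_distrib_left sum_distrib_right)
  also have "\<dots> = (\<Sum>a\<in>I. \<Sum>k\<in>K. \<Sum>b\<in>I. cnj (v a) * \<alpha> k a b * v b)"
    by (intro sum.cong refl sum.swap)
  also have "\<dots> = (\<Sum>k\<in>K. \<Sum>a\<in>I. \<Sum>b\<in>I. cnj (v a) * \<alpha> k a b * v b)" by (rule sum.swap)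
  finally show ?thesis by (simp add: qform_def)
qed

lemma trp_sum_left: "trp I (\<lambda>a b. \<Sum>k\<in>K. \<alpha> k a b) Y = (\<Sum>k\<in>K. trp I (\<alpha> k) Y)"
proof -
  have "trp I (\<lambda>a b. \<Sum>k\<in>K. \<alpha> k a b) Y = (\<Sum>a\<in>I. \<Sum>b\<in>I. \<Sum>k\<in>K. \<alpha> k a b * Y b a)"
    by (simp add: trp_def sum_distrib_right)
  also have "\<dots> = (\<Sum>a\<in>I. \<Sum>k\<in>K. \<Sum>b\<in>I. \<alpha> k a b * Y b a)" by (intro sum.cong refl sum.swap)
  also have "\<dots> = (\<Sum>k\<in>K. \<Sum>a\<in>I. \<Sum>b\<in>I. \<alpha> k a b * Y b a)" by (rule sum.swap)
  finally show ?thesis by (simp add: trp_def)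
qed

lemma trp_cong:
  "(\<And>a b. a \<in> I \<Longrightarrow> b \<in> I \<Longrightarrow> \<alpha> a b = \<beta> a b) \<Longrightarrow> trp I \<alpha> Y = trp I \<beta> Y"
  by (simp add: trp_def)

lemma trp_scale_left: "trp I (\<lambda>a b. c * \<alpha> a b) Y = c * trp I \<alpha> Y"
  by (simp add: trp_def sum_distrib_left mult.assoc)

lemma psdD:
  assumes "psd I \<alpha>"
  shows "a \<in> I \<Longrightarrow> b \<in> I \<Longrightarrow> \<alpha> b a = cnj (\<alpha> a b)" and "0 \<le> Re (qform I \<alpha> v)"
  using assms unfolding psd_def by blast+

lemma psd_sum:
  assumes "\<And>k. k \<in> K \<Longrightarrow> psd I (\<alpha> k)"
  shows "psd I (\<lambda>a b. \<Sum>k\<in>K. \<alpha> k a b)"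
  unfolding psd_def qform_sum Re_sum cnj_sum
  by (intro conjI ballI allI sum_nonneg sum.cong refl psdD(1)[OF assms] psdD(2)[OF assms])

lemma psd_gram: "psd I (\<lambda>a b. \<Sum>c\<in>C. f c a * cnj (f c b))"
proof (rule psd_sum)
  fix c
  have "qform I (\<lambda>a b. f c a * cnj (f c b)) v = cnj (cip I (f c) v) * cip I (f c) v" for v
    unfolding qform_def cip_def cnj_sum sum_product by (simp add: mult_ac)
  hence "qform I (\<lambda>a b. f c a * cnj (f c b)) v = of_real ((cmod (cip I (f c) v))\<^sup>2)" for v
    by (simp only: cnj_mult_self)
  thus "psd I (\<lambda>a b. f c a * cnj (f c b))" by (simp add: psd_def mult.commute)
qed

section \<open>Eigenvalue equations and equality of spectra\<close>

lemma mv_eigsys: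
  assumes fin: "finite I" and e: "eigsys I \<alpha> u p" and i: "i \<in> I" and a: "a \<in> I"
  shows "mv I \<alpha> (u i) a = p i * u i a"
proof -
  have "mv I \<alpha> (u i) a = (\<Sum>b\<in>I. \<Sum>j\<in>I. p j * u j a * (cnj (u j b) * u i b))"
    unfolding mv_def
    by (intro sum.cong refl) (simp add: eigsys_eq[OF e a] sum_distrib_right mult.assoc)
  also have "\<dots> = (\<Sum>j\<in>I. \<Sum>b\<in>I. p j * u j a * (cnj (u j b) * u i b))" by (rule sum.swap)
  also have "\<dots> = (\<Sum>j\<in>I. p j * u j a * of_bool (j = i))"
    unfolding sum_distrib_left[symmetric] using i
    by (intro sum.cong refl) (simp add: onb_orthonormal[OF eigsys_onb[OF e]])
  also have "\<dots> = p i * u i a" using fin i by simp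
  finally show ?thesis .
qed

lemma qform_eigenvector:
  assumes fin: "finite I" and e: "eigsys I \<alpha> u p" and i: "i \<in> I"
  shows "qform I \<alpha> (u i) = p i"
proof -
  have "qform I \<alpha> (u i) = cip I (u i) (\<lambda>a. p i * u i a)"
    unfolding qform_eq_cip by (rule cip_cong) (simp_all add: mv_eigsys[OF fin e i])
  thus ?thesis by (simp add: cip_scale_right onb_norm[OF eigsys_onb[OF e] i])
qed

lemma eigsys_hermitian:
  assumes "eigsys I \<alpha> u p" "a \<in> I" "b \<in> I"
  shows "\<alpha> b a = cnj (\<alpha> a b)"
  unfolding eigsys_eq[OF assms(1) assms(3,2)] eigsys_eq[OF assms] by (simp add: mult.commute)

lemma eigsys_trace:
  assumes "eigsys I \<alpha> u p"
  shows "(\<Sum>i\<in>I. p i) = Re (\<Sum>a\<in>I. \<alpha> a a)"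
proof -
  have "(\<Sum>a\<in>I. \<alpha> a a) = (\<Sum>a\<in>I. \<Sum>j\<in>I. p j * (u j a * cnj (u j a)))"
    by (intro sum.cong refl eigsys_eq[OF assms])
  also have "\<dots> = (\<Sum>j\<in>I. \<Sum>a\<in>I. p j * (u j a * cnj (u j a)))" by (rule sum.swap)
  also have "\<dots> = (\<Sum>j\<in>I. of_real (p j) * cip I (u j) (u j))"
    by (simp add: sum_distrib_left cip_def mult.commute)
  also have "\<dots> = of_real (\<Sum>j\<in>I. p j)"
    using onb_norm[OF eigsys_onb[OF assms]] by simp
  finally show ?thesis by simp
qed

lemma eigsys_scale:
  assumes "eigsys I \<alpha> u p" "c \<ge> 0"
  shows "eigsys I (\<lambda>a b. of_real c * \<alpha> a b) u (\<lambda>i. c * p i)"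
  using assms unfolding eigsys_def by (auto simp: sum_distrib_left mult_ac)

text \<open>A matrix \<open>M\<close> that intertwines two lists of eigenvalues is nonzero only
  where they agree, so its squared entries can be counted by rows or by columns. Constant weights
  \<open>f\<close> compare two diagonalisations of one operator. Weights \<open>f x = x\<close>
  ignore zero eigenvalues and so compare operators in different dimensions.\<close>

lemma spectral_sum_transfer:
  fixes p :: "'a \<Rightarrow> real" and r :: "'b \<Rightarrow> real" and M :: "'a \<Rightarrow> 'b \<Rightarrow> complex"
  assumes row: "\<And>j. j \<in> I \<Longrightarrow> (\<Sum>l\<in>C. (cmod (M j l))\<^sup>2) = f (p j)"
    and col: "\<And>l. l \<in> C \<Longrightarrow> (\<Sum>j\<in>I. (cmod (M j l))\<^sup>2) = f (r l)"
    and eq: "\<And>j l. j \<in> I \<Longrightarrow> l \<in> C \<Longrightarrow> of_real (p j) * M j l = of_real (r l) * M j l"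
  shows "(\<Sum>j\<in>I. f (p j) * h (p j)) = (\<Sum>l\<in>C. f (r l) * h (r l))"
proof -
  have "(\<Sum>j\<in>I. f (p j) * h (p j)) = (\<Sum>j\<in>I. \<Sum>l\<in>C. (cmod (M j l))\<^sup>2 * h (p j))"
    by (simp add: row[symmetric] sum_distrib_right)
  also have "\<dots> = (\<Sum>j\<in>I. \<Sum>l\<in>C. (cmod (M j l))\<^sup>2 * h (r l))"
  proof (intro sum.cong refl)
    fix j l assume "j \<in> I" "l \<in> C"
    from eq[OF this] have "M j l = 0 \<or> p j = r l" by auto
    thus "(cmod (M j l))\<^sup>2 * h (p j) = (cmod (M j l))\<^sup>2 * h (r l)" by auto
  qed
  also have "\<dots> = (\<Sum>l\<in>C. \<Sum>j\<in>I. (cmod (M j l))\<^sup>2 * h (r l))" by (rule sum.swap)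
  also have "\<dots> = (\<Sum>l\<in>C. f (r l) * h (r l))"
    by (simp add: col[symmetric] sum_distrib_right)
  finally show ?thesis .
qed

text \<open>The matrix of overlaps between the two eigenbases is the intertwiner, because
  \<open>\<alpha>\<close> is Hermitian. This makes the choice in \<open>ent\<close>
  harmless.\<close>

lemma eigsys_entropy_unique:
  assumes fin: "finite I" and u: "eigsys I \<alpha> u p" and v: "eigsys I \<alpha> v q"
  shows "(\<Sum>j\<in>I. p j * ln (p j)) = (\<Sum>j\<in>I. q j * ln (q j))"
proof -
  note ou = eigsys_onb[OF u] and ov = eigsys_onb[OF v]
  have "(\<Sum>j\<in>I. 1 * (p j * ln (p j))) = (\<Sum>l\<in>I. 1 * (q l * ln (q l)))"
  proof (rule spectral_sum_transfer[where M = "\<lambda>j l. cip I (u j) (v l)" and f = "\<lambda>_. 1" and h = "\<lambda>x. x * ln x"])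
    fix j assume j: "j \<in> I"
    have "cmod (cip I (u j) (v l)) = cmod (cip I (v l) (u j))" for l
      by (metis cip_cnj complex_mod_cnj)
    thus "(\<Sum>l\<in>I. (cmod (cip I (u j) (v l)))\<^sup>2) = 1"
      by (simp add: sum_overlap_right[OF fin ou ov j])
    show "(\<Sum>l\<in>I. (cmod (cip I (u l) (v j)))\<^sup>2) = 1"
      by (rule sum_overlap_right[OF fin ov ou j])
  next
    fix j l assume jl: "j \<in> I" "l \<in> I"
    have "of_real (p j) * cip I (u j) (v l) = cip I (\<lambda>a. of_real (p j) * u j a) (v l)"
      by (simp add: cip_scale_left)
    also have "\<dots> = cip I (mv I \<alpha> (u j)) (v l)"
      by (rule cip_cong) (simp_all add: mv_eigsys[OF fin u jl(1)])
    also have "\<dots> = cip I (u j) (mv I \<alpha> (v l))"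
      by (rule cip_mv_hermitian[symmetric]) (rule eigsys_hermitian[OF u])
    also have "\<dots> = cip I (u j) (\<lambda>a. of_real (q l) * v l a)"
      by (rule cip_cong) (simp_all add: mv_eigsys[OF fin v jl(2)])
    finally show "of_real (p j) * cip I (u j) (v l) = of_real (q l) * cip I (u j) (v l)"
      by (simp add: cip_scale_right)
  qed
  thus ?thesis by simp
qed

text \<open>Natural logarithm, and an unspecified value unless \<open>\<alpha>\<close> is positive semidefinite.\<close>

definition ent :: "'a set \<Rightarrow> ('a \<Rightarrow> 'a \<Rightarrow> complex) \<Rightarrow> real" where
  "ent I \<alpha> = (SOME s. \<exists>u p. eigsys I \<alpha> u p \<and> s = - (\<Sum>j\<in>I. p j * ln (p j)))"

lemma ent_eq:
  assumes "finite I" and "eigsys I \<alpha> u p"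
  shows "ent I \<alpha> = - (\<Sum>j\<in>I. p j * ln (p j))"
proof -
  have "\<exists>u p. eigsys I \<alpha> u p \<and> ent I \<alpha> = - (\<Sum>j\<in>I. p j * ln (p j))"
    unfolding ent_def by (rule someI_ex) (use assms(2) in blast)
  thus ?thesis using eigsys_entropy_unique[OF assms(1) _ assms(2)] by auto
qed

lemma ent_cong:
  assumes "\<And>a b. a \<in> I \<Longrightarrow> b \<in> I \<Longrightarrow> \<alpha> a b = \<beta> a b"
  shows "ent I \<alpha> = ent I \<beta>"
proof -
  have "eigsys I \<alpha> u p = eigsys I \<beta> u p" for u p by (rule eigsys_cong[OF assms])
  thus ?thesis by (simp add: ent_def)
qed

text \<open>The two marginals of a pure state have the same nonzero spectrum.\<close>

lemma ent_gram_swap: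
  assumes finI: "finite I" and finC: "finite C"
  shows "ent I (\<lambda>a a'. \<Sum>c\<in>C. \<Phi> a c * cnj (\<Phi> a' c)) = ent C (\<lambda>c c'. \<Sum>a\<in>I. \<Phi> a c * cnj (\<Phi> a c'))"
proof -
  let ?\<alpha> = "\<lambda>a a'. \<Sum>c\<in>C. \<Phi> a c * cnj (\<Phi> a' c)" and ?\<gamma> = "\<lambda>c c'. \<Sum>a\<in>I. \<Phi> a c * cnj (\<Phi> a c')"
  obtain u p where u: "eigsys I ?\<alpha> u p"
    using psd_imp_eigsys[OF finI psd_gram[of I "\<lambda>c a. \<Phi> a c" C]] by blast
  obtain g r where g: "eigsys C ?\<gamma> g r"
    using psd_imp_eigsys[OF finC psd_gram[of C \<Phi> I]] by blast
  \<comment> \<open>The matrix \<open>\<Phi>\<close> maps the conjugate of \<open>g l\<close> to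
    \<open>f l\<close>, which satisfies the eigenvalue equation of \<open>?\<alpha>\<close> for
    \<open>r l\<close> and has squared norm \<open>r l\<close>. The vectors \<open>h j\<close> play
    the mirrored role and have squared norm \<open>p j\<close>.\<close>
  define f where "f l a = (\<Sum>c\<in>C. \<Phi> a c * cnj (g l c))" for l a
  define h where "h j c = (\<Sum>a\<in>I. cnj (u j a) * \<Phi> a c)" for j c
  have M: "cip I (u j) (f l) = cip C (g l) (h j)" for j l
  proof -
    have "cip I (u j) (f l) = (\<Sum>a\<in>I. \<Sum>c\<in>C. cnj (u j a) * \<Phi> a c * cnj (g l c))"
      by (simp add: cip_def f_def sum_distrib_left mult.assoc)
    also have "\<dots> = (\<Sum>c\<in>C. \<Sum>a\<in>I. cnj (u j a) * \<Phi> a c * cnj (g l c))" by (rule sum.swap)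
    finally show ?thesis by (simp add: cip_def h_def sum_distrib_left mult_ac)
  qed
  have ff: "cip I (f l) (f l) = qform C ?\<gamma> (g l)" for l
  proof -
    have "cip I (f l) (f l) = (\<Sum>a\<in>I. \<Sum>c\<in>C. \<Sum>c'\<in>C. cnj (g l c) * (\<Phi> a c * cnj (\<Phi> a c')) * g l c')"
      unfolding cip_def f_def
      by (intro sum.cong refl, subst mult.commute, unfold cnj_sum sum_product, intro sum.cong refl) simp
    also have "\<dots> = (\<Sum>c\<in>C. \<Sum>a\<in>I. \<Sum>c'\<in>C. cnj (g l c) * (\<Phi> a c * cnj (\<Phi> a c')) * g l c')" by (rule sum.swap)
    also have "\<dots> = (\<Sum>c\<in>C. \<Sum>c'\<in>C. \<Sum>a\<in>I. cnj (g l c) * (\<Phi> a c * cnj (\<Phi> a c')) * g l c')"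
      by (intro sum.cong refl sum.swap)
    finally show ?thesis by (simp add: qform_def sum_distrib_left sum_distrib_right)
  qed
  have hh: "cip C (h j) (h j) = qform I ?\<alpha> (u j)" for j
  proof -
    have "cip C (h j) (h j) = (\<Sum>c\<in>C. \<Sum>a\<in>I. \<Sum>a'\<in>I. cnj (u j a) * (\<Phi> a c * cnj (\<Phi> a' c)) * u j a')"
      unfolding cip_def h_def
      by (intro sum.cong refl, subst mult.commute, unfold cnj_sum sum_product, intro sum.cong refl) simp
    also have "\<dots> = (\<Sum>a\<in>I. \<Sum>c\<in>C. \<Sum>a'\<in>I. cnj (u j a) * (\<Phi> a c * cnj (\<Phi> a' c)) * u j a')" by (rule sum.swap)
    also have "\<dots> = (\<Sum>a\<in>I. \<Sum>a'\<in>I. \<Sum>c\<in>C. cnj (u j a) * (\<Phi> a c * cnj (\<Phi> a' c)) * u j a')"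
      by (intro sum.cong refl sum.swap)
    finally show ?thesis by (simp add: qform_def sum_distrib_left sum_distrib_right)
  qed
  have ev: "mv I ?\<alpha> (f l) a = of_real (r l) * f l a" if l: "l \<in> C" and a: "a \<in> I" for l a
  proof -
    have "mv I ?\<alpha> (f l) a = (\<Sum>a'\<in>I. \<Sum>c\<in>C. \<Sum>c'\<in>C. \<Phi> a c * cnj (\<Phi> a' c) * (\<Phi> a' c' * cnj (g l c')))"
      by (simp add: mv_def f_def sum_product)
    also have "\<dots> = (\<Sum>c\<in>C. \<Sum>a'\<in>I. \<Sum>c'\<in>C. \<Phi> a c * cnj (\<Phi> a' c) * (\<Phi> a' c' * cnj (g l c')))" by (rule sum.swap)
    also have "\<dots> = (\<Sum>c\<in>C. \<Sum>c'\<in>C. \<Sum>a'\<in>I. \<Phi> a c * cnj (\<Phi> a' c) * (\<Phi> a' c' * cnj (g l c')))"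
      by (intro sum.cong refl sum.swap)
    also have "\<dots> = (\<Sum>c\<in>C. \<Phi> a c * cnj (mv C ?\<gamma> (g l) c))"
      by (simp add: mv_def sum_distrib_left sum_distrib_right mult_ac)
    also have "\<dots> = of_real (r l) * f l a"
      using mv_eigsys[OF finC g l] by (simp add: f_def sum_distrib_left mult_ac)
    finally show ?thesis .
  qed
  \<comment> \<open>Rows and columns of the overlap matrix have the eigenvalues themselves as their
    weights, so the different numbers of zero eigenvalues do no harm.\<close>
  have "(\<Sum>j\<in>I. p j * ln (p j)) = (\<Sum>l\<in>C. r l * ln (r l))"
  proof (rule spectral_sum_transfer[where M = "\<lambda>j l. cip I (u j) (f l)" and f = "\<lambda>x. x"])
    fix j assume j: "j \<in> I"
    have "complex_of_real (\<Sum>l\<in>C. (cmod (cip C (g l) (h j)))\<^sup>2) = p j"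
      unfolding parseval_norm[OF finC eigsys_onb[OF g]] hh by (rule qform_eigenvector[OF finI u j])
    thus "(\<Sum>l\<in>C. (cmod (cip I (u j) (f l)))\<^sup>2) = p j" unfolding M by (simp only: of_real_eq_iff)
  next
    fix l assume l: "l \<in> C"
    have "complex_of_real (\<Sum>j\<in>I. (cmod (cip I (u j) (f l)))\<^sup>2) = r l"
      unfolding parseval_norm[OF finI eigsys_onb[OF u]] ff by (rule qform_eigenvector[OF finC g l])
    thus "(\<Sum>j\<in>I. (cmod (cip I (u j) (f l)))\<^sup>2) = r l" by (simp only: of_real_eq_iff)
  next
    fix j l assume jl: "j \<in> I" "l \<in> C"
    have "of_real (p j) * cip I (u j) (f l) = cip I (\<lambda>a. of_real (p j) * u j a) (f l)"
      by (simp add: cip_scale_left)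
    also have "\<dots> = cip I (mv I ?\<alpha> (u j)) (f l)"
      by (rule cip_cong) (simp_all only: mv_eigsys[OF finI u jl(1)])
    also have "\<dots> = cip I (u j) (mv I ?\<alpha> (f l))"
      by (rule cip_mv_hermitian[symmetric]) (rule eigsys_hermitian[OF u])
    also have "\<dots> = cip I (u j) (\<lambda>a. of_real (r l) * f l a)"
      by (rule cip_cong) (simp_all only: ev[OF jl(2)])
    finally show "of_real (p j) * cip I (u j) (f l) = of_real (r l) * cip I (u j) (f l)"
      by (simp add: cip_scale_right)
  qed
  thus ?thesis using ent_eq[OF finI u] ent_eq[OF finC g] by simp
qed

text \<open>Each \<open>\<alpha> k\<close> is dominated by the total, which yields the support
  condition. The cross terms with the logarithm of the total add up to the entropy term of the
  total, so a sum of relative entropies becomes a negative conditional entropy.\<close>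

lemma relative_entropy_to_sum:
  assumes fin: "finite I" "finite K"
    and \<alpha>: "\<And>k. k \<in> K \<Longrightarrow> psd I (\<alpha> k)" and \<beta>: "eigsys I (\<lambda>a b. \<Sum>k\<in>K. \<alpha> k a b) v q"
  shows "\<And>k j. k \<in> K \<Longrightarrow> j \<in> I \<Longrightarrow> q j = 0 \<Longrightarrow> Re (qform I (\<alpha> k) (v j)) = 0"
    and "(\<Sum>k\<in>K. \<Sum>j\<in>I. Re (qform I (\<alpha> k) (v j)) * h j) = (\<Sum>j\<in>I. q j * h j)"
proof -
  have q: "(\<Sum>k\<in>K. Re (qform I (\<alpha> k) (v j))) = q j" if "j \<in> I" for j
    using qform_eigenvector[OF fin(1) \<beta> that] unfolding qform_sum
    by (metis Re_complex_of_real Re_sum)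
  show "Re (qform I (\<alpha> k) (v j)) = 0" if "k \<in> K" "j \<in> I" "q j = 0" for k j
    using q[OF that(2)] that sum_nonneg_eq_0_iff[OF fin(2), of "\<lambda>k. Re (qform I (\<alpha> k) (v j))"] psdD(2)[OF \<alpha>]
    by simp
  have "(\<Sum>k\<in>K. \<Sum>j\<in>I. Re (qform I (\<alpha> k) (v j)) * h j) = (\<Sum>j\<in>I. \<Sum>k\<in>K. Re (qform I (\<alpha> k) (v j)) * h j)"
    by (rule sum.swap)
  also have "\<dots> = (\<Sum>j\<in>I. q j * h j)" using q by (simp add: sum_distrib_right[symmetric])
  finally show "(\<Sum>k\<in>K. \<Sum>j\<in>I. Re (qform I (\<alpha> k) (v j)) * h j) = (\<Sum>j\<in>I. q j * h j)" .
qed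

text \<open>Joint convexity of the relative entropy: the same test operator serves every summand.\<close>

theorem conditional_entropy_superadditive:
  assumes fin: "finite I" "finite R" "finite K"
    and \<sigma>: "\<And>r k. r \<in> R \<Longrightarrow> k \<in> K \<Longrightarrow> psd I (\<sigma> r k)"
  shows "(\<Sum>r\<in>R. (\<Sum>k\<in>K. ent I (\<sigma> r k)) - ent I (\<lambda>a b. \<Sum>k\<in>K. \<sigma> r k a b))
     \<le> (\<Sum>k\<in>K. ent I (\<lambda>a b. \<Sum>r\<in>R. \<sigma> r k a b)) - ent I (\<lambda>a b. \<Sum>k\<in>K. \<Sum>r\<in>R. \<sigma> r k a b)"
proof -
  let ?\<beta> = "\<lambda>r a b. \<Sum>k\<in>K. \<sigma> r k a b" and ?\<alpha>' = "\<lambda>k a b. \<Sum>r\<in>R. \<sigma> r k a b"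
  let ?\<beta>' = "\<lambda>a b. \<Sum>k\<in>K. \<Sum>r\<in>R. \<sigma> r k a b"
  have "\<forall>r k. \<exists>u p. r \<in> R \<longrightarrow> k \<in> K \<longrightarrow> eigsys I (\<sigma> r k) u p"
    using psd_imp_eigsys[OF fin(1) \<sigma>] by blast
  then obtain u p where u: "\<And>r k. r \<in> R \<Longrightarrow> k \<in> K \<Longrightarrow> eigsys I (\<sigma> r k) (u r k) (p r k)" by metis
  have "\<forall>r. \<exists>v q. r \<in> R \<longrightarrow> eigsys I (?\<beta> r) v q"
    using psd_imp_eigsys[OF fin(1) psd_sum[of K I "\<sigma> r" for r, OF \<sigma>]] by blast
  then obtain v q where v: "\<And>r. r \<in> R \<Longrightarrow> eigsys I (?\<beta> r) (v r) (q r)" by metis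
  have psd': "psd I (?\<alpha>' k)" if "k \<in> K" for k using \<sigma> that by (intro psd_sum) auto
  have "\<forall>k. \<exists>u p. k \<in> K \<longrightarrow> eigsys I (?\<alpha>' k) u p"
    using psd_imp_eigsys[OF fin(1) psd'] by blast
  then obtain u' p' where u': "\<And>k. k \<in> K \<Longrightarrow> eigsys I (?\<alpha>' k) (u' k) (p' k)" by metis
  obtain v' q' where v': "eigsys I ?\<beta>' v' q'"
    using psd_imp_eigsys[OF fin(1) psd_sum[of K I ?\<alpha>', OF psd']] by blast
  note src = relative_entropy_to_sum[OF fin(1,3) \<sigma> v]
  note tgt = relative_entropy_to_sum[OF fin(1,3) psd' v']
  \<comment> \<open>Both sides are sums of relative entropies of parts with respect to their total.
    The sources are numbered by pairs \<open>(r, k)\<close> and the targets by \<open>k\<close>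
    alone.\<close>
  have "(\<Sum>k\<in>K. (\<Sum>i\<in>I. p' k i * ln (p' k i)) - (\<Sum>j\<in>I. Re (qform I (?\<alpha>' k) (v' j)) * ln (q' j)))
     \<le> (\<Sum>(r, k)\<in>R \<times> K. (\<Sum>i\<in>I. p r k i * ln (p r k i)) - (\<Sum>j\<in>I. Re (qform I (\<sigma> r k) (v r j)) * ln (q r j)))"
    unfolding case_prod_beta
  proof (rule relative_entropy_monotone[where \<beta> = "\<lambda>x. ?\<beta> (fst x)" and u = "\<lambda>x. u (fst x) (snd x)"
        and \<beta>' = "\<lambda>_. ?\<beta>'" and u' = u'])
    show "(\<Sum>x\<in>R \<times> K. \<Sum>i\<in>I. p (fst x) (snd x) i) = (\<Sum>k\<in>K. \<Sum>i\<in>I. p' k i)"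
    proof -
      have "(\<Sum>x\<in>R \<times> K. \<Sum>i\<in>I. p (fst x) (snd x) i) = (\<Sum>r\<in>R. \<Sum>k\<in>K. Re (\<Sum>a\<in>I. \<sigma> r k a a))"
        by (subst sum.cartesian_product[symmetric, of "\<lambda>r k. \<Sum>i\<in>I. p r k i", unfolded case_prod_beta])
          (intro sum.cong refl eigsys_trace[OF u])
      also have "\<dots> = (\<Sum>k\<in>K. Re (\<Sum>r\<in>R. \<Sum>a\<in>I. \<sigma> r k a a))" unfolding Re_sum by (rule sum.swap)
      also have "\<dots> = (\<Sum>k\<in>K. Re (\<Sum>a\<in>I. ?\<alpha>' k a a))"
        by (intro sum.cong refl arg_cong[of _ _ Re] sum.swap)
      also have "\<dots> = (\<Sum>k\<in>K. \<Sum>i\<in>I. p' k i)" by (intro sum.cong refl eigsys_trace[OF u', symmetric])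
      finally show ?thesis .
    qed
    fix t :: real and Y :: "'c \<Rightarrow> 'a \<Rightarrow> 'a \<Rightarrow> complex"
    have "(\<Sum>x\<in>R \<times> K. test_functional I t (\<sigma> (fst x) (snd x)) (?\<beta> (fst x)) (Y (snd x)))
        = (\<Sum>r\<in>R. \<Sum>k\<in>K. test_functional I t (\<sigma> r k) (?\<beta> r) (Y k))"
      by (simp add: sum.cartesian_product case_prod_beta)
    also have "\<dots> = (\<Sum>k\<in>K. \<Sum>r\<in>R. test_functional I t (\<sigma> r k) (?\<beta> r) (Y k))" by (rule sum.swap)
    also have "\<dots> = (\<Sum>k\<in>K. test_functional I t (?\<alpha>' k) (\<lambda>a b. \<Sum>r\<in>R. ?\<beta> r a b) (Y k))"
      by (simp add: test_functional_def trp_sum_left sum_subtractf sum_distrib_left)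
    also have "(\<lambda>a b. \<Sum>r\<in>R. ?\<beta> r a b) = ?\<beta>'" by (intro ext sum.swap)
    finally show "\<exists>X. (\<Sum>k\<in>K. test_functional I t (?\<alpha>' k) ?\<beta>' (Y k)) \<le>
       (\<Sum>x\<in>R \<times> K. test_functional I t (\<sigma> (fst x) (snd x)) (?\<beta> (fst x)) (X x))"
      by (intro exI[of _ "\<lambda>x. Y (snd x)"]) simp
  qed (use fin u v u' v' src(1) tgt(1) in auto)
  also have "\<dots> = (\<Sum>r\<in>R. (\<Sum>k\<in>K. \<Sum>i\<in>I. p r k i * ln (p r k i)) - (\<Sum>j\<in>I. q r j * ln (q r j)))"
    unfolding sum.cartesian_product[symmetric] sum_subtractf by (simp add: src(2) cong: sum.cong)
  also have "\<dots> = (\<Sum>r\<in>R. ent I (?\<beta> r) - (\<Sum>k\<in>K. ent I (\<sigma> r k)))"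
    by (intro sum.cong refl) (simp add: ent_eq[OF fin(1) u] ent_eq[OF fin(1) v] sum_negf)
  finally show ?thesis
    by (simp add: sum_subtractf tgt(2) ent_eq[OF fin(1) u'] ent_eq[OF fin(1) v'] sum_negf)
qed

subsection \<open>Uncertainty relations with quantum memory\<close>

text \<open>The unnormalised state of the second subsystem after outcome \<open>z\<close> on the first one.\<close>

definition blk :: "'a set \<Rightarrow> ('a \<Rightarrow> complex) \<Rightarrow> ('a \<times> 'b \<Rightarrow> 'a \<times> 'b \<Rightarrow> complex) \<Rightarrow> 'b \<Rightarrow> 'b \<Rightarrow> complex" where
  "blk A z \<alpha> b b' = (\<Sum>a\<in>A. \<Sum>a'\<in>A. cnj (z a) * \<alpha> (a, b) (a', b') * z a')"

definition ptr :: "'a set \<Rightarrow> ('a \<times> 'b \<Rightarrow> 'a \<times> 'b \<Rightarrow> complex) \<Rightarrow> 'b \<Rightarrow> 'b \<Rightarrow> complex" where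
  "ptr A \<alpha> b b' = (\<Sum>a\<in>A. \<alpha> (a, b) (a, b'))"

text \<open>For \<open>Y k = blk A (x k) \<alpha>\<close> this is \<open>\<alpha>\<close> after the measurement in the basis \<open>x\<close>; as a test operator
  it lifts a family of operators on the second subsystem to the block-diagonal algebra.\<close>

definition dil :: "'a set \<Rightarrow> ('a \<Rightarrow> 'a \<Rightarrow> complex) \<Rightarrow> ('a \<Rightarrow> 'b \<Rightarrow> 'b \<Rightarrow> complex) \<Rightarrow> 'a \<times> 'b \<Rightarrow> 'a \<times> 'b \<Rightarrow> complex" where
  "dil A x Y s s' = (\<Sum>k\<in>A. x k (fst s) * cnj (x k (fst s')) * Y k (snd s) (snd s'))"

section \<open>Block-diagonal operators and conditional states\<close>

lemma sum_blk_onb: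
  assumes fin: "finite A" and x: "onb A x"
  shows "(\<Sum>k\<in>A. blk A (x k) \<alpha> b b') = ptr A \<alpha> b b'"
proof -
  have "(\<Sum>k\<in>A. blk A (x k) \<alpha> b b') = (\<Sum>k\<in>A. \<Sum>a\<in>A. \<Sum>a'\<in>A. \<alpha> (a, b) (a', b') * (x k a' * cnj (x k a)))"
    by (simp add: blk_def mult_ac)
  also have "\<dots> = (\<Sum>a\<in>A. \<Sum>k\<in>A. \<Sum>a'\<in>A. \<alpha> (a, b) (a', b') * (x k a' * cnj (x k a)))" by (rule sum.swap)
  also have "\<dots> = (\<Sum>a\<in>A. \<Sum>a'\<in>A. \<Sum>k\<in>A. \<alpha> (a, b) (a', b') * (x k a' * cnj (x k a)))"
    by (intro sum.cong refl sum.swap)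
  also have "\<dots> = (\<Sum>a\<in>A. \<Sum>a'\<in>A. \<alpha> (a, b) (a', b') * of_bool (a' = a))"
    unfolding sum_distrib_left[symmetric] by (intro sum.cong refl) (simp add: onb_complete[OF x])
  also have "\<dots> = ptr A \<alpha> b b'" using fin by (simp add: ptr_def)
  finally show ?thesis .
qed

lemma qform_blk: "qform B (blk A z \<alpha>) v = qform (A \<times> B) \<alpha> (\<lambda>s. z (fst s) * v (snd s))"
proof -
  have "qform B (blk A z \<alpha>) v = (\<Sum>b\<in>B. \<Sum>b'\<in>B. \<Sum>a\<in>A. \<Sum>a'\<in>A. cnj (z a * v b) * \<alpha> (a, b) (a', b') * (z a' * v b'))"
    by (simp add: qform_def blk_def sum_distrib_left sum_distrib_right mult_ac)
  also have "\<dots> = (\<Sum>b\<in>B. \<Sum>a\<in>A. \<Sum>b'\<in>B. \<Sum>a'\<in>A. cnj (z a * v b) * \<alpha> (a, b) (a', b') * (z a' * v b'))"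
    by (intro sum.cong refl sum.swap)
  also have "\<dots> = (\<Sum>a\<in>A. \<Sum>b\<in>B. \<Sum>b'\<in>B. \<Sum>a'\<in>A. cnj (z a * v b) * \<alpha> (a, b) (a', b') * (z a' * v b'))"
    by (rule sum.swap)
  also have "\<dots> = (\<Sum>a\<in>A. \<Sum>b\<in>B. \<Sum>a'\<in>A. \<Sum>b'\<in>B. cnj (z a * v b) * \<alpha> (a, b) (a', b') * (z a' * v b'))"
    by (intro sum.cong refl sum.swap)
  finally show ?thesis
    by (simp only: qform_def sum.cartesian_product' fst_conv snd_conv)
qed

lemma psd_blk:
  assumes "psd (A \<times> B) \<alpha>"
  shows "psd B (blk A z \<alpha>)"
  unfolding psd_def
proof (intro conjI ballI allI)
  fix b b' assume b: "b \<in> B" "b' \<in> B"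
  have "blk A z \<alpha> b' b = (\<Sum>a'\<in>A. \<Sum>a\<in>A. cnj (z a') * \<alpha> (a', b') (a, b) * z a)" by (simp add: blk_def)
  also have "\<dots> = (\<Sum>a\<in>A. \<Sum>a'\<in>A. cnj (z a') * \<alpha> (a', b') (a, b) * z a)" by (rule sum.swap)
  also have "\<dots> = (\<Sum>a\<in>A. \<Sum>a'\<in>A. cnj (cnj (z a) * \<alpha> (a, b) (a', b') * z a'))"
  proof (intro sum.cong refl)
    fix a a' assume "a \<in> A" "a' \<in> A"
    with b have "\<alpha> (a', b') (a, b) = cnj (\<alpha> (a, b) (a', b'))" by (intro psdD(1)[OF assms]) auto
    thus "cnj (z a') * \<alpha> (a', b') (a, b) * z a = cnj (cnj (z a) * \<alpha> (a, b) (a', b') * z a')"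
      by simp
  qed
  finally show "blk A z \<alpha> b' b = cnj (blk A z \<alpha> b b')" by (simp add: blk_def)
qed (simp add: qform_blk psdD(2)[OF assms])

lemma psd_ptr:
  assumes "finite A" "onb A x" "psd (A \<times> B) \<alpha>"
  shows "psd B (ptr A \<alpha>)"
proof -
  have "ptr A \<alpha> = (\<lambda>b b'. \<Sum>k\<in>A. blk A (x k) \<alpha> b b')"
    by (intro ext) (simp add: sum_blk_onb[OF assms(1,2)])
  thus ?thesis using psd_sum[of A B "\<lambda>k. blk A (x k) \<alpha>"] psd_blk[OF assms(3)] by simp
qed

text \<open>The eigenvectors are the products of \<open>z k\<close> with the eigenvectors of block
  \<open>k\<close>. Different blocks are orthogonal through \<open>z\<close>, vectors of one block
  through \<open>e k\<close>.\<close>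

lemma eigsys_dil:
  assumes fin: "finite A" "finite B" and z: "onb A z"
    and e: "\<And>k. k \<in> A \<Longrightarrow> eigsys B (\<beta> k) (e k) (q k)"
  shows "eigsys (A \<times> B) (dil A z \<beta>) (\<lambda>s t. z (fst s) (fst t) * e (fst s) (snd s) (snd t)) (\<lambda>s. q (fst s) (snd s))"
proof -
  have "onb (A \<times> B) (\<lambda>s t. z (fst s) (fst t) * e (fst s) (snd s) (snd t))"
  proof (rule orthonormal_imp_onb)
    fix s s' assume s: "s \<in> A \<times> B" "s' \<in> A \<times> B"
    have "(\<Sum>t\<in>A \<times> B. cnj (z (fst s) (fst t) * e (fst s) (snd s) (snd t)) * (z (fst s') (fst t) * e (fst s') (snd s') (snd t)))
      = (\<Sum>a\<in>A. cnj (z (fst s) a) * z (fst s') a) * (\<Sum>b\<in>B. cnj (e (fst s) (snd s) b) * e (fst s') (snd s') b)"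
      unfolding sum_product sum.cartesian_product' by (simp add: mult_ac)
    also have "\<dots> = of_bool (s = s')"
    proof (cases "fst s = fst s'")
      case True
      thus ?thesis using s onb_orthonormal[OF z] onb_orthonormal[OF eigsys_onb[OF e]]
        by (auto simp: prod_eq_iff)
    next
      case False
      thus ?thesis using s onb_orthonormal[OF z] by (auto simp: prod_eq_iff)
    qed
    finally show "(\<Sum>t\<in>A \<times> B. cnj (z (fst s) (fst t) * e (fst s) (snd s) (snd t)) * (z (fst s') (fst t) * e (fst s') (snd s') (snd t))) = of_bool (s = s')" .
  qed (use fin in simp)
  moreover have "dil A z \<beta> s t = (\<Sum>j\<in>A \<times> B. of_real (q (fst j) (snd j)) *
      (z (fst j) (fst s) * e (fst j) (snd j) (snd s) * cnj (z (fst j) (fst t) * e (fst j) (snd j) (snd t))))"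
    if "s \<in> A \<times> B" "t \<in> A \<times> B" for s t
  proof -
    have "dil A z \<beta> s t = (\<Sum>k\<in>A. \<Sum>l\<in>B. z k (fst s) * cnj (z k (fst t)) * (q k l * (e k l (snd s) * cnj (e k l (snd t)))))"
      unfolding dil_def sum_distrib_left[symmetric] using that
      by (intro sum.cong refl arg_cong2[of _ _ _ _ "(*)"] eigsys_eq[OF e]) auto
    thus ?thesis unfolding sum.cartesian_product' by (simp add: mult_ac)
  qed
  ultimately show ?thesis using eigsys_nonneg[OF e] unfolding eigsys_def by auto
qed

lemma adj_dil: "adj (dil A x Y) = dil A x (\<lambda>k. adj (Y k))"
  by (intro ext) (simp add: adj_def dil_def mult_ac)

text \<open>The projections onto the vectors of an orthonormal basis annihilate each other, so the
  lift respects products. With \<open>adj_dil\<close> it is a homomorphism of star-algebras.\<close>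

lemma mm_dil:
  assumes x: "onb A x" and fin: "finite A"
  shows "mm (A \<times> B) (dil A x Y) (dil A x Z) = dil A x (\<lambda>k. mm B (Y k) (Z k))"
proof (intro ext)
  fix s t
  have "mm (A \<times> B) (dil A x Y) (dil A x Z) s t =
    (\<Sum>a\<in>A. \<Sum>b\<in>B. \<Sum>k\<in>A. \<Sum>l\<in>A. x k (fst s) * cnj (x l (fst t)) * (Y k (snd s) b * Z l b (snd t)) * (cnj (x k a) * x l a))"
    unfolding mm_def dil_def sum_product sum.cartesian_product' by (simp add: mult_ac)
  also have "\<dots> = (\<Sum>b\<in>B. \<Sum>a\<in>A. \<Sum>k\<in>A. \<Sum>l\<in>A. x k (fst s) * cnj (x l (fst t)) * (Y k (snd s) b * Z l b (snd t)) * (cnj (x k a) * x l a))"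
    by (rule sum.swap)
  also have "\<dots> = (\<Sum>b\<in>B. \<Sum>k\<in>A. \<Sum>a\<in>A. \<Sum>l\<in>A. x k (fst s) * cnj (x l (fst t)) * (Y k (snd s) b * Z l b (snd t)) * (cnj (x k a) * x l a))"
    by (intro sum.cong refl sum.swap)
  also have "\<dots> = (\<Sum>b\<in>B. \<Sum>k\<in>A. \<Sum>l\<in>A. \<Sum>a\<in>A. x k (fst s) * cnj (x l (fst t)) * (Y k (snd s) b * Z l b (snd t)) * (cnj (x k a) * x l a))"
    by (intro sum.cong refl sum.swap)
  also have "\<dots> = (\<Sum>b\<in>B. \<Sum>k\<in>A. \<Sum>l\<in>A. x k (fst s) * cnj (x l (fst t)) * (Y k (snd s) b * Z l b (snd t)) * of_bool (k = l))"
    unfolding sum_distrib_left[symmetric] by (intro sum.cong refl) (simp add: onb_orthonormal[OF x])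
  also have "\<dots> = (\<Sum>b\<in>B. \<Sum>k\<in>A. x k (fst s) * cnj (x k (fst t)) * (Y k (snd s) b * Z k b (snd t)))"
    using fin by simp
  also have "\<dots> = (\<Sum>k\<in>A. \<Sum>b\<in>B. x k (fst s) * cnj (x k (fst t)) * (Y k (snd s) b * Z k b (snd t)))"
    by (rule sum.swap)
  finally show "mm (A \<times> B) (dil A x Y) (dil A x Z) s t = dil A x (\<lambda>k. mm B (Y k) (Z k)) s t"
    by (simp add: dil_def mm_def sum_distrib_left)
qed

text \<open>The lift is dual to conditioning on the outcomes. This turns the test functional at a
  lifted operator into a sum over outcomes.\<close>

lemma trp_dil: "trp (A \<times> B) \<alpha> (dil A x Y) = (\<Sum>k\<in>A. trp B (blk A (x k) \<alpha>) (Y k))"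
proof -
  let ?f = "\<lambda>a b a' b' k. cnj (x k a) * \<alpha> (a, b) (a', b') * x k a' * Y k b' b"
  have "trp (A \<times> B) \<alpha> (dil A x Y) = (\<Sum>a\<in>A. \<Sum>b\<in>B. \<Sum>a'\<in>A. \<Sum>b'\<in>B. \<Sum>k\<in>A. ?f a b a' b' k)"
    unfolding trp_def dil_def sum.cartesian_product' by (simp add: sum_distrib_left mult_ac)
  also have "\<dots> = (\<Sum>a\<in>A. \<Sum>b\<in>B. \<Sum>a'\<in>A. \<Sum>k\<in>A. \<Sum>b'\<in>B. ?f a b a' b' k)" by (intro sum.cong refl sum.swap)
  also have "\<dots> = (\<Sum>a\<in>A. \<Sum>b\<in>B. \<Sum>k\<in>A. \<Sum>a'\<in>A. \<Sum>b'\<in>B. ?f a b a' b' k)" by (intro sum.cong refl sum.swap)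
  also have "\<dots> = (\<Sum>a\<in>A. \<Sum>k\<in>A. \<Sum>b\<in>B. \<Sum>a'\<in>A. \<Sum>b'\<in>B. ?f a b a' b' k)" by (intro sum.cong refl sum.swap)
  also have "\<dots> = (\<Sum>k\<in>A. \<Sum>a\<in>A. \<Sum>b\<in>B. \<Sum>a'\<in>A. \<Sum>b'\<in>B. ?f a b a' b' k)" by (rule sum.swap)
  also have "\<dots> = (\<Sum>k\<in>A. \<Sum>b\<in>B. \<Sum>a\<in>A. \<Sum>a'\<in>A. \<Sum>b'\<in>B. ?f a b a' b' k)" by (intro sum.cong refl sum.swap)
  also have "\<dots> = (\<Sum>k\<in>A. \<Sum>b\<in>B. \<Sum>a\<in>A. \<Sum>b'\<in>B. \<Sum>a'\<in>A. ?f a b a' b' k)" by (intro sum.cong refl sum.swap)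
  also have "\<dots> = (\<Sum>k\<in>A. \<Sum>b\<in>B. \<Sum>b'\<in>B. \<Sum>a\<in>A. \<Sum>a'\<in>A. ?f a b a' b' k)" by (intro sum.cong refl sum.swap)
  finally show ?thesis by (simp add: trp_def blk_def sum_distrib_right)
qed

text \<open>Conditioning a \<open>z\<close>-pinched operator on \<open>w\<close> mixes the blocks
  with the transition probabilities from \<open>z\<close> to \<open>w\<close>. This is where the
  overlaps of the two bases enter the uncertainty relation.\<close>

lemma blk_dil:
  "blk A w (dil A z \<beta>) b b' = (\<Sum>l\<in>A. of_real ((cmod (cip A w (z l)))\<^sup>2) * \<beta> l b b')"
proof -
  have "blk A w (dil A z \<beta>) b b' = (\<Sum>a\<in>A. \<Sum>a'\<in>A. \<Sum>l\<in>A. (z l a * cnj (w a)) * (cnj (z l a') * w a') * \<beta> l b b')"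
    by (simp add: blk_def dil_def sum_distrib_left sum_distrib_right mult_ac)
  also have "\<dots> = (\<Sum>a\<in>A. \<Sum>l\<in>A. \<Sum>a'\<in>A. (z l a * cnj (w a)) * (cnj (z l a') * w a') * \<beta> l b b')"
    by (intro sum.cong refl sum.swap)
  also have "\<dots> = (\<Sum>l\<in>A. \<Sum>a\<in>A. \<Sum>a'\<in>A. (z l a * cnj (w a)) * (cnj (z l a') * w a') * \<beta> l b b')" by (rule sum.swap)
  also have "\<dots> = (\<Sum>l\<in>A. cnj (cip A (z l) w) * cip A (z l) w * \<beta> l b b')"
    unfolding cip_def cnj_sum sum_product by (simp add: sum_distrib_right)
  also have "\<dots> = (\<Sum>l\<in>A. of_real ((cmod (cip A w (z l)))\<^sup>2) * \<beta> l b b')"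
    unfolding cnj_mult_self cip_cnj[of A "z _" w, symmetric] complex_mod_cnj by (simp add: cip_cnj[symmetric, of A w])
  finally show ?thesis .
qed

text \<open>Used to see that a larger second operator can only lower the test functional.\<close>

lemma trp_square_nonneg:
  assumes fin: "finite I" and "psd I \<alpha>"
  shows "0 \<le> Re (trp I \<alpha> (mm I Y (adj Y)))"
proof -
  obtain u p where u: "eigsys I \<alpha> u p" using psd_imp_eigsys[OF assms] by blast
  have "qform I (mm I Y (adj Y)) f = cip I (mv I (adj Y) f) (mv I (adj Y) f)" for f
    by (simp add: qform_eq_cip mv_mm cip_mv_adj)
  hence "0 \<le> Re (qform I (mm I Y (adj Y)) f)" for f by (simp add: cip_self sum_nonneg)
  thus ?thesis unfolding trp_eigsys[OF u] by (simp add: sum_nonneg eigsys_nonneg[OF u])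
qed

text \<open>
  With \<open>\<beta>\<close> the pinching of \<open>\<alpha>\<close> in the basis \<open>z\<close>, monotonicity of \<open>D(\<alpha> \<parallel> \<beta>)\<close> under the pinching
  in the basis \<open>x\<close> gives the claim, since the \<open>x\<close>-pinching of \<open>\<beta>\<close> is at most \<open>c\<close> times the identity
  tensor the marginal of \<open>\<alpha>\<close>.
\<close>

theorem bipartite_uncertainty:
  assumes fin: "finite A" "finite B" and \<alpha>: "psd (A \<times> B) \<alpha>"
    and x: "onb A x" and z: "onb A z"
    and c: "c > 0" and ov: "\<And>k l. k \<in> A \<Longrightarrow> l \<in> A \<Longrightarrow> (cmod (cip A (x k) (z l)))\<^sup>2 \<le> c"
  shows "ent (A \<times> B) \<alpha> + ent B (ptr A \<alpha>) - Re (\<Sum>s\<in>A \<times> B. \<alpha> s s) * ln c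
    \<le> (\<Sum>k\<in>A. ent B (blk A (x k) \<alpha>)) + (\<Sum>k\<in>A. ent B (blk A (z k) \<alpha>))"
proof -
  note finAB = finite_cartesian_product[OF fin]
  obtain u p where u: "eigsys (A \<times> B) \<alpha> u p" using psd_imp_eigsys[OF finAB \<alpha>] by blast
  have "\<forall>k. \<exists>e q. eigsys B (blk A (z k) \<alpha>) e q"
    using psd_imp_eigsys[OF fin(2) psd_blk[OF \<alpha>]] by blast
  then obtain e q where e: "\<And>k. eigsys B (blk A (z k) \<alpha>) (e k) (q k)" by metis
  have "\<forall>k. \<exists>f r. eigsys B (blk A (x k) \<alpha>) f r"
    using psd_imp_eigsys[OF fin(2) psd_blk[OF \<alpha>]] by blast
  then obtain f r where f: "\<And>k. eigsys B (blk A (x k) \<alpha>) (f k) (r k)" by metis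
  obtain g s where g: "eigsys B (ptr A \<alpha>) g s"
    using psd_imp_eigsys[OF fin(2) psd_ptr[OF fin(1) x \<alpha>]] by blast
  have sum_x: "(\<lambda>b b'. \<Sum>k\<in>A. blk A (x k) \<alpha> b b') = ptr A \<alpha>"
    by (intro ext) (simp add: sum_blk_onb[OF fin(1) x])
  have g': "eigsys B (\<lambda>b b'. \<Sum>k\<in>A. blk A (x k) \<alpha> b b') g s" unfolding sum_x by (rule g)
  note tgt = relative_entropy_to_sum[OF fin(2,1) psd_blk[OF \<alpha>] g']
  define \<beta> where "\<beta> = dil A z (\<lambda>k. blk A (z k) \<alpha>)"
  define v where "v = (\<lambda>s t. z (fst s) (fst t) * e (fst s) (snd s) (snd t))"
  have v: "eigsys (A \<times> B) \<beta> v (\<lambda>s. q (fst s) (snd s))"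
    unfolding \<beta>_def v_def by (rule eigsys_dil[OF fin z e])
  \<comment> \<open>In the eigenbasis of its pinching \<open>\<beta>\<close>, the diagonal of
    \<open>\<alpha>\<close> is the spectrum of \<open>\<beta>\<close>. The cross term of the
    relative entropy is thereby an entropy of blocks, and the support condition is
    immediate.\<close>
  have qv: "Re (qform (A \<times> B) \<alpha> (v j)) = q (fst j) (snd j)" if "j \<in> A \<times> B" for j
  proof -
    have "qform (A \<times> B) \<alpha> (v j) = qform B (blk A (z (fst j)) \<alpha>) (e (fst j) (snd j))"
      unfolding v_def qform_blk ..
    also have "\<dots> = q (fst j) (snd j)" using that by (intro qform_eigenvector[OF fin(2) e]) auto
    finally show ?thesis by simp
  qed
  \<comment> \<open>An upper bound for every \<open>x\<close>-block of \<open>\<beta>\<close>: the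
    transition probabilities are at most \<open>c\<close>, and the \<open>z\<close>-blocks add up to
    the marginal.\<close>
  let ?\<beta>' = "\<lambda>b b'. of_real c * ptr A \<alpha> b b'"
  have gc: "eigsys B ?\<beta>' g (\<lambda>j. c * s j)" using eigsys_scale[OF g] c by simp
  \<comment> \<open>At a lifted operator the two terms in \<open>\<alpha>\<close> agree exactly; the
    inequality comes from the term in \<open>\<beta>\<close> alone.\<close>
  have test: "(\<Sum>k\<in>A. test_functional B t (blk A (x k) \<alpha>) ?\<beta>' (Y k)) \<le> test_functional (A \<times> B) t \<alpha> \<beta> (dil A x Y)" for t Y
  proof -
    have le: "Re (trp B (blk A (x k) \<beta>) (mm B (Y k) (adj (Y k)))) \<le> Re (trp B ?\<beta>' (mm B (Y k) (adj (Y k))))"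
      if k: "k \<in> A" for k
    proof -
      let ?T = "\<lambda>l. trp B (blk A (z l) \<alpha>) (mm B (Y k) (adj (Y k)))"
      have 1: "trp B (blk A (x k) \<beta>) (mm B (Y k) (adj (Y k))) = (\<Sum>l\<in>A. of_real ((cmod (cip A (x k) (z l)))\<^sup>2) * ?T l)"
        unfolding trp_scale_left[symmetric] trp_sum_left[symmetric]
        by (rule trp_cong) (simp only: \<beta>_def blk_dil)
      have 2: "trp B ?\<beta>' (mm B (Y k) (adj (Y k))) = (\<Sum>l\<in>A. of_real c * ?T l)"
        unfolding sum_blk_onb[OF fin(1) z, symmetric] trp_scale_left trp_sum_left sum_distrib_left ..
      have "(\<Sum>l\<in>A. (cmod (cip A (x k) (z l)))\<^sup>2 * Re (?T l)) \<le> (\<Sum>l\<in>A. c * Re (?T l))"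
        by (intro sum_mono mult_right_mono ov k trp_square_nonneg[OF fin(2)] psd_blk[OF \<alpha>])
      thus ?thesis unfolding 1 2 Re_sum by simp
    qed
    have "test_functional (A \<times> B) t \<alpha> \<beta> (dil A x Y) = (\<Sum>k\<in>A. 2 * Re (trp B (blk A (x k) \<alpha>) (adj (Y k)))
        - Re (trp B (blk A (x k) \<beta>) (mm B (Y k) (adj (Y k)))) - t * Re (trp B (blk A (x k) \<alpha>) (mm B (adj (Y k)) (Y k))))"
      unfolding test_functional_def adj_dil mm_dil[OF x fin(1)] trp_dil Re_sum sum_subtractf sum_distrib_left ..
    also have "(\<Sum>k\<in>A. test_functional B t (blk A (x k) \<alpha>) ?\<beta>' (Y k)) \<le> \<dots>"
      unfolding test_functional_def by (intro sum_mono diff_right_mono diff_left_mono le)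
    finally show ?thesis .
  qed
  have tr: "(\<Sum>k\<in>A. \<Sum>j\<in>B. r k j) = (\<Sum>j\<in>B. s j)" "(\<Sum>j\<in>A \<times> B. p j) = (\<Sum>j\<in>B. s j)"
  proof -
    have "(\<Sum>k\<in>A. \<Sum>j\<in>B. r k j) = Re (\<Sum>k\<in>A. \<Sum>b\<in>B. blk A (x k) \<alpha> b b)"
      unfolding Re_sum[of _ A] by (intro sum.cong refl eigsys_trace[OF f])
    also have "(\<Sum>k\<in>A. \<Sum>b\<in>B. blk A (x k) \<alpha> b b) = (\<Sum>b\<in>B. ptr A \<alpha> b b)"
      unfolding sum_blk_onb[OF fin(1) x, symmetric] by (rule sum.swap)
    finally show "(\<Sum>k\<in>A. \<Sum>j\<in>B. r k j) = (\<Sum>j\<in>B. s j)" unfolding eigsys_trace[OF g] .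
    have "(\<Sum>s\<in>A \<times> B. \<alpha> s s) = (\<Sum>b\<in>B. ptr A \<alpha> b b)"
      unfolding sum.cartesian_product' ptr_def by (rule sum.swap)
    thus "(\<Sum>j\<in>A \<times> B. p j) = (\<Sum>j\<in>B. s j)" unfolding eigsys_trace[OF g] eigsys_trace[OF u] by simp
  qed
  have "(\<Sum>k\<in>A. (\<Sum>i\<in>B. r k i * ln (r k i)) - (\<Sum>j\<in>B. Re (qform B (blk A (x k) \<alpha>) (g j)) * ln (c * s j)))
     \<le> (\<Sum>_\<in>{()}. (\<Sum>i\<in>A \<times> B. p i * ln (p i)) - (\<Sum>j\<in>A \<times> B. Re (qform (A \<times> B) \<alpha> (v j)) * ln (q (fst j) (snd j))))"
  proof (rule relative_entropy_monotone[where u' = f])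
    show "\<exists>X. (\<Sum>k\<in>A. test_functional B t (blk A (x k) \<alpha>) ?\<beta>' (Y k))
        \<le> (\<Sum>r\<in>{()}. test_functional (A \<times> B) t \<alpha> \<beta> (X r))" for t Y
      using test[of t Y] by (intro exI[of _ "\<lambda>_. dil A x Y"]) simp
    show "Re (qform (A \<times> B) \<alpha> (v j)) = 0" if "j \<in> A \<times> B" "q (fst j) (snd j) = 0" for j
      using qv that by simp
    show "Re (qform B (blk A (x k) \<alpha>) (g j)) = 0" if "k \<in> A" "j \<in> B" "c * s j = 0" for k j
      using tgt(1) that c by simp
  qed (use fin finAB u v f gc tr in auto)
  also have "\<dots> = - ent (A \<times> B) \<alpha> + (\<Sum>k\<in>A. ent B (blk A (z k) \<alpha>))"
    using qv by (simp add: ent_eq[OF finAB u] ent_eq[OF fin(2) e] sum_negf sum.cartesian_product' cong: sum.cong)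
  also have "(\<Sum>k\<in>A. (\<Sum>i\<in>B. r k i * ln (r k i)) - (\<Sum>j\<in>B. Re (qform B (blk A (x k) \<alpha>) (g j)) * ln (c * s j)))
      = - (\<Sum>k\<in>A. ent B (blk A (x k) \<alpha>)) - (\<Sum>j\<in>B. s j * ln (c * s j))"
    by (simp add: sum_subtractf ent_eq[OF fin(2) f] sum_negf tgt(2))
  \<comment> \<open>The factor \<open>c\<close> splits off as the trace times \<open>ln c\<close>;
    indices with \<open>s j = 0\<close> contribute zero on both sides.\<close>
  also have "(\<Sum>j\<in>B. s j * ln (c * s j)) = (\<Sum>j\<in>B. s j) * ln c - ent B (ptr A \<alpha>)"
  proof -
    have "s j * ln (c * s j) = s j * ln c + s j * ln (s j)" if "j \<in> B" for j
      using c eigsys_nonneg[OF g that] by (cases "s j = 0") (simp_all add: ln_mult algebra_simps)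
    thus ?thesis by (simp add: ent_eq[OF fin(2) g] sum.distrib sum_distrib_right)
  qed
  finally show ?thesis using tr(2) unfolding eigsys_trace[OF u] by simp
qed

text \<open>For each pure component of \<open>\<alpha>\<close> the bipartite relation on
  \<open>A \<times> B\<close> is rewritten in terms of \<open>C\<close> by means of complementary
  marginals. Superadditivity of the conditional entropy then passes from the components to their
  sum, separately for \<open>B\<close> and for \<open>C\<close>.\<close>

theorem tripartite_uncertainty:
  fixes \<alpha> :: "'a \<times> 'b \<times> 'c \<Rightarrow> 'a \<times> 'b \<times> 'c \<Rightarrow> complex"
  assumes fin: "finite A" "finite B" "finite C" and \<alpha>: "psd (A \<times> B \<times> C) \<alpha>"
    and x: "onb A x" and z: "onb A z"
    and c: "c > 0" and ov: "\<And>k l. k \<in> A \<Longrightarrow> l \<in> A \<Longrightarrow> (cmod (cip A (x k) (z l)))\<^sup>2 \<le> c"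
    and \<beta>: "\<And>s t. s \<in> A \<times> B \<Longrightarrow> t \<in> A \<times> B \<Longrightarrow> \<beta> s t = (\<Sum>c\<in>C. \<alpha> (fst s, snd s, c) (fst t, snd t, c))"
    and \<gamma>: "\<And>s t. s \<in> A \<times> C \<Longrightarrow> t \<in> A \<times> C \<Longrightarrow> \<gamma> s t = (\<Sum>b\<in>B. \<alpha> (fst s, b, snd s) (fst t, b, snd t))"
  shows "- Re (\<Sum>s\<in>A \<times> B \<times> C. \<alpha> s s) * ln c \<le>
     ((\<Sum>k\<in>A. ent B (blk A (x k) \<beta>)) - ent B (ptr A \<beta>)) +
     ((\<Sum>k\<in>A. ent C (blk A (z k) \<gamma>)) - ent C (ptr A \<gamma>))"
proof -
  let ?I = "A \<times> B \<times> C"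
  have finI: "finite ?I" and finAB: "finite (A \<times> B)" using fin by auto
  obtain u p where u: "eigsys ?I \<alpha> u p" using psd_imp_eigsys[OF finI \<alpha>] by blast
  \<comment> \<open>Eigenvectors scaled by the root of their eigenvalue, so that
    \<open>\<alpha>\<close> is the plain sum of the rank-one operators of the
    \<open>\<phi> r\<close>. Their marginals on the two pairs of subsystems are \<open>b r\<close>
    and \<open>g r\<close>.\<close>
  define \<phi> where "\<phi> r s = complex_of_real (sqrt (p r)) * u r s" for r s
  have gram: "\<alpha> s t = (\<Sum>r\<in>?I. \<phi> r s * cnj (\<phi> r t))" if "s \<in> ?I" "t \<in> ?I" for s t
    unfolding eigsys_eq[OF u that]
  proof (intro sum.cong refl)
    fix r assume "r \<in> ?I"
    hence "complex_of_real (p r) = complex_of_real (sqrt (p r)) * complex_of_real (sqrt (p r))"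
      using eigsys_nonneg[OF u, of r] by (simp flip: of_real_mult)
    thus "of_real (p r) * (u r s * cnj (u r t)) = \<phi> r s * cnj (\<phi> r t)" by (simp add: \<phi>_def)
  qed
  define b where "b r s t = (\<Sum>c\<in>C. \<phi> r (fst s, snd s, c) * cnj (\<phi> r (fst t, snd t, c)))" for r s t
  define g where "g r s t = (\<Sum>b\<in>B. \<phi> r (fst s, b, snd s) * cnj (\<phi> r (fst t, b, snd t)))" for r s t
  have psd_b: "psd (A \<times> B) (b r)" for r unfolding b_def by (rule psd_gram)
  have psd_g: "psd (A \<times> C) (g r)" for r unfolding g_def by (rule psd_gram)
  have \<beta>_sum: "\<beta> s t = (\<Sum>r\<in>?I. b r s t)" if "s \<in> A \<times> B" "t \<in> A \<times> B" for s t
  proof -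
    have "\<beta> s t = (\<Sum>c\<in>C. \<Sum>r\<in>?I. \<phi> r (fst s, snd s, c) * cnj (\<phi> r (fst t, snd t, c)))"
      unfolding \<beta>[OF that] using that by (intro sum.cong refl gram) auto
    thus ?thesis unfolding b_def by (simp only: sum.swap[of _ ?I C])
  qed
  have \<gamma>_sum: "\<gamma> s t = (\<Sum>r\<in>?I. g r s t)" if "s \<in> A \<times> C" "t \<in> A \<times> C" for s t
  proof -
    have "\<gamma> s t = (\<Sum>b\<in>B. \<Sum>r\<in>?I. \<phi> r (fst s, b, snd s) * cnj (\<phi> r (fst t, b, snd t)))"
      unfolding \<gamma>[OF that] using that by (intro sum.cong refl gram) auto
    thus ?thesis unfolding g_def by (simp only: sum.swap[of _ ?I B])
  qed
  have pure: "- Re (\<Sum>s\<in>A \<times> B. b r s s) * ln c \<le>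
     ((\<Sum>k\<in>A. ent B (blk A (x k) (b r))) - ent B (ptr A (b r))) +
     ((\<Sum>k\<in>A. ent C (blk A (z k) (g r))) - ent C (ptr A (g r)))" for r
  proof -
    have "ent (A \<times> B) (b r) = ent C (\<lambda>c c'. \<Sum>s\<in>A \<times> B. \<phi> r (fst s, snd s, c) * cnj (\<phi> r (fst s, snd s, c')))"
      unfolding b_def by (rule ent_gram_swap[OF finAB fin(3)])
    also have "\<dots> = ent C (ptr A (g r))"
      by (rule ent_cong) (simp add: ptr_def g_def sum.cartesian_product')
    finally have 1: "ent (A \<times> B) (b r) = ent C (ptr A (g r))" .
    \<comment> \<open>Once the first subsystem is projected onto \<open>z k\<close>, a single vector
      \<open>h\<close> on the other two remains, and its two marginals have the same
      entropy.\<close>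
    have 2: "ent B (blk A (z k) (b r)) = ent C (blk A (z k) (g r))" for k
    proof -
      define h where "h b c = (\<Sum>a\<in>A. cnj (z k a) * \<phi> r (a, b, c))" for b c
      have "blk A (z k) (b r) b1 b2 = (\<Sum>c\<in>C. h b1 c * cnj (h b2 c))" for b1 b2
      proof -
        have "blk A (z k) (b r) b1 b2 = (\<Sum>a\<in>A. \<Sum>a'\<in>A. \<Sum>c\<in>C. cnj (z k a) * \<phi> r (a, b1, c) * (z k a' * cnj (\<phi> r (a', b2, c))))"
          by (simp add: blk_def b_def sum_distrib_left sum_distrib_right mult_ac)
        also have "\<dots> = (\<Sum>a\<in>A. \<Sum>c\<in>C. \<Sum>a'\<in>A. cnj (z k a) * \<phi> r (a, b1, c) * (z k a' * cnj (\<phi> r (a', b2, c))))"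
          by (intro sum.cong refl sum.swap)
        also have "\<dots> = (\<Sum>c\<in>C. \<Sum>a\<in>A. \<Sum>a'\<in>A. cnj (z k a) * \<phi> r (a, b1, c) * (z k a' * cnj (\<phi> r (a', b2, c))))"
          by (rule sum.swap)
        finally show ?thesis unfolding h_def cnj_sum sum_product by simp
      qed
      hence "ent B (blk A (z k) (b r)) = ent B (\<lambda>b1 b2. \<Sum>c\<in>C. h b1 c * cnj (h b2 c))"
        by (intro ent_cong)
      also have "\<dots> = ent C (\<lambda>c c'. \<Sum>b\<in>B. h b c * cnj (h b c'))" by (rule ent_gram_swap[OF fin(2,3)])
      also have "\<dots> = ent C (blk A (z k) (g r))"
      proof (rule ent_cong)
        fix c c'
        have "blk A (z k) (g r) c c' = (\<Sum>a\<in>A. \<Sum>a'\<in>A. \<Sum>b\<in>B. cnj (z k a) * \<phi> r (a, b, c) * (z k a' * cnj (\<phi> r (a', b, c'))))"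
          by (simp add: blk_def g_def sum_distrib_left sum_distrib_right mult_ac)
        also have "\<dots> = (\<Sum>a\<in>A. \<Sum>b\<in>B. \<Sum>a'\<in>A. cnj (z k a) * \<phi> r (a, b, c) * (z k a' * cnj (\<phi> r (a', b, c'))))"
          by (intro sum.cong refl sum.swap)
        also have "\<dots> = (\<Sum>b\<in>B. \<Sum>a\<in>A. \<Sum>a'\<in>A. cnj (z k a) * \<phi> r (a, b, c) * (z k a' * cnj (\<phi> r (a', b, c'))))"
          by (rule sum.swap)
        finally show "(\<Sum>b\<in>B. h b c * cnj (h b c')) = blk A (z k) (g r) c c'"
          unfolding h_def cnj_sum sum_product by simp
      qed
      finally show ?thesis .
    qed
    show ?thesis
      using bipartite_uncertainty[OF fin(1,2) psd_b[of r] x z c ov] unfolding 1 2 by simp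
  qed
  have blk_sum: "blk A w \<delta> d d' = (\<Sum>r\<in>?I. blk A w (\<delta>' r) d d')"
    if "\<And>s t. s \<in> A \<times> D \<Longrightarrow> t \<in> A \<times> D \<Longrightarrow> \<delta> s t = (\<Sum>r\<in>?I. \<delta>' r s t)" "d \<in> D" "d' \<in> D"
    for w and D :: "'d set" and \<delta> \<delta>' d d'
  proof -
    have "blk A w \<delta> d d' = (\<Sum>a\<in>A. \<Sum>a'\<in>A. \<Sum>r\<in>?I. cnj (w a) * \<delta>' r (a, d) (a', d') * w a')"
      using that by (simp add: blk_def sum_distrib_left sum_distrib_right)
    also have "\<dots> = (\<Sum>a\<in>A. \<Sum>r\<in>?I. \<Sum>a'\<in>A. cnj (w a) * \<delta>' r (a, d) (a', d') * w a')"
      by (intro sum.cong refl sum.swap)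
    also have "\<dots> = (\<Sum>r\<in>?I. \<Sum>a\<in>A. \<Sum>a'\<in>A. cnj (w a) * \<delta>' r (a, d) (a', d') * w a')" by (rule sum.swap)
    finally show ?thesis by (simp add: blk_def)
  qed
  \<comment> \<open>Stated for an arbitrary second subsystem \<open>D\<close>, as it is applied both
    to \<open>B\<close> and to \<open>C\<close>.\<close>
  have superadd: "(\<Sum>r\<in>?I. (\<Sum>k\<in>A. ent D (blk A (w k) (\<delta>' r))) - ent D (ptr A (\<delta>' r)))
      \<le> (\<Sum>k\<in>A. ent D (blk A (w k) \<delta>)) - ent D (ptr A \<delta>)"
    if \<delta>: "\<And>s t. s \<in> A \<times> D \<Longrightarrow> t \<in> A \<times> D \<Longrightarrow> \<delta> s t = (\<Sum>r\<in>?I. \<delta>' r s t)"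
      and finD: "finite D" and w: "onb A w" and psd: "\<And>r. psd (A \<times> D) (\<delta>' r)"
    for w and D :: "'d set" and \<delta> \<delta>'
  proof -
    have ptr_eq: "(\<lambda>d d'. \<Sum>k\<in>A. blk A (w k) \<epsilon> d d') = ptr A \<epsilon>" for \<epsilon> :: "'a \<times> 'd \<Rightarrow> _"
      by (intro ext) (rule sum_blk_onb[OF fin(1) w])
    have "ent D (\<lambda>d d'. \<Sum>k\<in>A. \<Sum>r\<in>?I. blk A (w k) (\<delta>' r) d d') = ent D (ptr A \<delta>)"
      unfolding ptr_eq[symmetric] by (rule ent_cong) (simp add: blk_sum[OF \<delta>])
    moreover have "ent D (\<lambda>d d'. \<Sum>r\<in>?I. blk A (w k) (\<delta>' r) d d') = ent D (blk A (w k) \<delta>)" for k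
      by (rule ent_cong) (simp add: blk_sum[OF \<delta>])
    ultimately show ?thesis
      using conditional_entropy_superadditive[OF finD finI fin(1), of "\<lambda>r k. blk A (w k) (\<delta>' r)"]
      by (simp add: psd_blk[OF psd] ptr_eq)
  qed
  \<comment> \<open>The components are unnormalised and their traces add up to that of
    \<open>\<alpha>\<close>, so the bounds for the components add up to the required one.\<close>
  have "(\<Sum>s\<in>?I. \<alpha> s s) = (\<Sum>s\<in>A \<times> B. \<Sum>c\<in>C. \<alpha> (fst s, snd s, c) (fst s, snd s, c))"
    by (simp add: sum.cartesian_product')
  also have "\<dots> = (\<Sum>s\<in>A \<times> B. \<Sum>r\<in>?I. b r s s)"
    by (rule sum.cong[OF refl]) (rule trans[OF \<beta>[symmetric] \<beta>_sum])
  also have "\<dots> = (\<Sum>r\<in>?I. \<Sum>s\<in>A \<times> B. b r s s)" by (rule sum.swap)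
  finally have "- Re (\<Sum>s\<in>?I. \<alpha> s s) * ln c = (\<Sum>r\<in>?I. - Re (\<Sum>s\<in>A \<times> B. b r s s) * ln c)"
    by (simp add: sum_distrib_right sum_negf del: Re_sum) (simp add: sum_distrib_right)
  also have "\<dots> \<le> (\<Sum>r\<in>?I. ((\<Sum>k\<in>A. ent B (blk A (x k) (b r))) - ent B (ptr A (b r))) +
     ((\<Sum>k\<in>A. ent C (blk A (z k) (g r))) - ent C (ptr A (g r))))"
    by (intro sum_mono pure)
  also have "\<dots> \<le> ((\<Sum>k\<in>A. ent B (blk A (x k) \<beta>)) - ent B (ptr A \<beta>)) +
     ((\<Sum>k\<in>A. ent C (blk A (z k) \<gamma>)) - ent C (ptr A \<gamma>))"
    unfolding sum.distrib
    by (intro add_mono superadd \<beta>_sum \<gamma>_sum fin x z psd_b psd_g)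
  finally show ?thesis .
qed

subsection \<open>Marginals of multipartite states\<close>

text \<open>A partial trace in terms of labels: \<open>g\<close> reads off what is kept of a global
  index and \<open>e\<close> what is traced out. Leaving both abstract lets the same lemmas serve
  every choice of subsystems.\<close>

definition marg :: "nat \<Rightarrow> (nat \<Rightarrow> 'x) \<Rightarrow> (nat \<Rightarrow> 'e) \<Rightarrow> (nat \<Rightarrow> nat \<Rightarrow> complex) \<Rightarrow> 'x \<Rightarrow> 'x \<Rightarrow> complex" where
  "marg N g e R x y = (\<Sum>i<N. \<Sum>j<N. if g i = x \<and> g j = y \<and> e i = e j then R i j else 0)"

text \<open>The quadratic form at \<open>v\<close> is the sum, over the values of the traced-out
  label, of the forms of \<open>R\<close> at the pullbacks of \<open>v\<close> restricted to that
  value.\<close>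

lemma psd_marg:
  fixes I :: "'x set"
  assumes fin: "finite I" and g: "\<And>i. i < N \<Longrightarrow> g i \<in> I" and R: "psd {..<N} R"
  shows "psd I (marg N g e R)"
  unfolding psd_def
proof (intro conjI ballI allI)
  fix x y
  have "marg N g e R y x = (\<Sum>j<N. \<Sum>i<N. if g i = y \<and> g j = x \<and> e i = e j then R i j else 0)"
    unfolding marg_def by (rule sum.swap)
  also have "\<dots> = (\<Sum>j<N. \<Sum>i<N. cnj (if g j = x \<and> g i = y \<and> e j = e i then R j i else 0))"
  proof (intro sum.cong refl)
    fix i j assume "i \<in> {..<N}" "j \<in> {..<N}"
    hence "R i j = cnj (R j i)" by (intro psdD(1)[OF R]) auto
    thus "(if g i = y \<and> g j = x \<and> e i = e j then R i j else 0) = cnj (if g j = x \<and> g i = y \<and> e j = e i then R j i else 0)"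
      by auto
  qed
  also have "\<dots> = cnj (marg N g e R x y)" by (simp add: marg_def)
  finally show "marg N g e R y x = cnj (marg N g e R x y)" .
next
  fix v :: "'x \<Rightarrow> complex"
  define w where "w \<epsilon> i = (if e i = \<epsilon> then v (g i) else 0)" for \<epsilon> i
  have "qform I (marg N g e R) v = (\<Sum>x\<in>I. \<Sum>y\<in>I. \<Sum>i<N. \<Sum>j<N.
      of_bool (g i = x) * (of_bool (g j = y) * (of_bool (e i = e j) * (cnj (v x) * R i j * v y))))"
    unfolding qform_def marg_def sum_distrib_left sum_distrib_right by (intro sum.cong refl) auto
  also have "\<dots> = (\<Sum>x\<in>I. \<Sum>i<N. \<Sum>y\<in>I. \<Sum>j<N.
      of_bool (g i = x) * (of_bool (g j = y) * (of_bool (e i = e j) * (cnj (v x) * R i j * v y))))"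
    by (intro sum.cong refl sum.swap)
  also have "\<dots> = (\<Sum>i<N. \<Sum>x\<in>I. \<Sum>y\<in>I. \<Sum>j<N.
      of_bool (g i = x) * (of_bool (g j = y) * (of_bool (e i = e j) * (cnj (v x) * R i j * v y))))"
    by (rule sum.swap)
  also have "\<dots> = (\<Sum>i<N. \<Sum>x\<in>I. \<Sum>j<N. \<Sum>y\<in>I.
      of_bool (g i = x) * (of_bool (g j = y) * (of_bool (e i = e j) * (cnj (v x) * R i j * v y))))"
    by (intro sum.cong refl sum.swap)
  also have "\<dots> = (\<Sum>i<N. \<Sum>j<N. \<Sum>x\<in>I. \<Sum>y\<in>I.
      of_bool (g i = x) * (of_bool (g j = y) * (of_bool (e i = e j) * (cnj (v x) * R i j * v y))))"
    by (intro sum.cong refl sum.swap)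
  also have "\<dots> = (\<Sum>i<N. \<Sum>j<N. of_bool (e i = e j) * (cnj (v (g i)) * R i j * v (g j)))"
  proof (intro sum.cong refl)
    fix i j assume ij: "i \<in> {..<N}" "j \<in> {..<N}"
    have pick: "(\<Sum>x\<in>I. of_bool (g k = x) * f x) = f (g k)" if "k < N" for k and f :: "'x \<Rightarrow> complex"
    proof -
      have "(\<Sum>x\<in>I. of_bool (g k = x) * f x) = (\<Sum>x\<in>I. if g k = x then f x else 0)"
        by (intro sum.cong) auto
      thus ?thesis using fin g[OF that] by simp
    qed
    show "(\<Sum>x\<in>I. \<Sum>y\<in>I. of_bool (g i = x) * (of_bool (g j = y) * (of_bool (e i = e j) * (cnj (v x) * R i j * v y))))
      = of_bool (e i = e j) * (cnj (v (g i)) * R i j * v (g j))"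
      unfolding sum_distrib_left[symmetric] using ij by (simp only: pick lessThan_iff)
  qed
  also have "\<dots> = (\<Sum>i<N. \<Sum>j<N. \<Sum>\<epsilon>\<in>e ` {..<N}. cnj (w \<epsilon> i) * R i j * w \<epsilon> j)"
  proof (intro sum.cong refl)
    fix i j assume ij: "i \<in> {..<N}" "j \<in> {..<N}"
    have "(\<Sum>\<epsilon>\<in>e ` {..<N}. cnj (w \<epsilon> i) * R i j * w \<epsilon> j)
      = (\<Sum>\<epsilon>\<in>e ` {..<N}. if e i = \<epsilon> then of_bool (e i = e j) * (cnj (v (g i)) * R i j * v (g j)) else 0)"
      by (intro sum.cong) (auto simp: w_def)
    thus "of_bool (e i = e j) * (cnj (v (g i)) * R i j * v (g j)) = (\<Sum>\<epsilon>\<in>e ` {..<N}. cnj (w \<epsilon> i) * R i j * w \<epsilon> j)"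
      using ij by simp
  qed
  also have "\<dots> = (\<Sum>i<N. \<Sum>\<epsilon>\<in>e ` {..<N}. \<Sum>j<N. cnj (w \<epsilon> i) * R i j * w \<epsilon> j)"
    by (intro sum.cong refl sum.swap)
  also have "\<dots> = (\<Sum>\<epsilon>\<in>e ` {..<N}. qform {..<N} R (w \<epsilon>))"
    unfolding qform_def by (rule sum.swap)
  finally show "0 \<le> Re (qform I (marg N g e R) v)"
    using psdD(2)[OF R] by (simp add: sum_nonneg)
qed

text \<open>Partial traces can be taken in stages: \<open>k x c\<close> is the finer label made of
  \<open>x\<close> and the value \<open>c\<close> of \<open>f\<close>, and summing over
  \<open>c\<close> traces \<open>f\<close> out.\<close>

lemma marg_split:
  assumes fin: "finite C" and f: "\<And>i. i < N \<Longrightarrow> f i \<in> C"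
    and k: "\<And>i c. i < N \<Longrightarrow> g' i = k x c \<longleftrightarrow> g i = x \<and> f i = c"
      "\<And>i c. i < N \<Longrightarrow> g' i = k y c \<longleftrightarrow> g i = y \<and> f i = c"
    and e: "\<And>i j. i < N \<Longrightarrow> j < N \<Longrightarrow> e i = e j \<longleftrightarrow> f i = f j \<and> e' i = e' j"
  shows "marg N g e R x y = (\<Sum>c\<in>C. marg N g' e' R (k x c) (k y c))"
proof -
  have "(\<Sum>c\<in>C. marg N g' e' R (k x c) (k y c))
    = (\<Sum>i<N. \<Sum>c\<in>C. \<Sum>j<N. if g' i = k x c \<and> g' j = k y c \<and> e' i = e' j then R i j else 0)"
    unfolding marg_def by (rule sum.swap)
  also have "\<dots> = (\<Sum>i<N. \<Sum>j<N. \<Sum>c\<in>C. if g' i = k x c \<and> g' j = k y c \<and> e' i = e' j then R i j else 0)"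
    by (intro sum.cong refl sum.swap)
  also have "\<dots> = marg N g e R x y"
    unfolding marg_def
  proof (intro sum.cong refl)
    fix i j assume ij: "i \<in> {..<N}" "j \<in> {..<N}"
    have "(\<Sum>c\<in>C. if g' i = k x c \<and> g' j = k y c \<and> e' i = e' j then R i j else 0)
      = (\<Sum>c\<in>C. if f i = c then (if g i = x \<and> g j = y \<and> e i = e j then R i j else 0) else 0)"
      using ij by (intro sum.cong refl) (auto simp: k e)
    thus "(\<Sum>c\<in>C. if g' i = k x c \<and> g' j = k y c \<and> e' i = e' j then R i j else 0)
      = (if g i = x \<and> g j = y \<and> e i = e j then R i j else 0)"
      using ij fin f by simp
  qed
  finally show ?thesis by simp
qed

text \<open>Kept and traced-out label together determine the index, so diagonal entries of the
  marginal only collect diagonal entries of \<open>R\<close>.\<close>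

lemma marg_trace:
  assumes fin: "finite I" and g: "\<And>i. i < N \<Longrightarrow> g i \<in> I"
    and inj: "\<And>i j. i < N \<Longrightarrow> j < N \<Longrightarrow> g i = g j \<Longrightarrow> e i = e j \<Longrightarrow> i = j"
  shows "(\<Sum>x\<in>I. marg N g e R x x) = (\<Sum>i<N. R i i)"
proof -
  have "(\<Sum>x\<in>I. marg N g e R x x) = (\<Sum>i<N. \<Sum>x\<in>I. \<Sum>j<N. if g i = x \<and> g j = x \<and> e i = e j then R i j else 0)"
    unfolding marg_def by (rule sum.swap)
  also have "\<dots> = (\<Sum>i<N. \<Sum>x\<in>I. if g i = x then R i i else 0)"
  proof (intro sum.cong refl)
    fix i x assume i: "i \<in> {..<N}"
    have "(\<Sum>j<N. if g i = x \<and> g j = x \<and> e i = e j then R i j else 0) = (\<Sum>j<N. if i = j then (if g i = x then R i i else 0) else 0)"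
      using i by (intro sum.cong refl) (auto dest: inj)
    thus "(\<Sum>j<N. if g i = x \<and> g j = x \<and> e i = e j then R i j else 0) = (if g i = x then R i i else 0)"
      using i by simp
  qed
  also have "\<dots> = (\<Sum>i<N. R i i)" using fin g by simp
  finally show ?thesis .
qed

text \<open>The conclusion is modulo the product because the induction passes to the tail, whose
  digits ignore the leading part of the index.\<close>

lemma digits_determine_mod:
  assumes "\<And>k. k < length ds \<Longrightarrow> digit ds k i = digit ds k j"
  shows "i mod prod_list ds = j mod prod_list ds"
  using assms
proof (induction ds)
  case (Cons x ds)
  have "digit ds k i = digit ds k j" if "k < length ds" for k
    using Cons.prems[of "Suc k"] that by (simp add: digit_def)
  hence "i mod prod_list ds = j mod prod_list ds" by (rule Cons.IH)
  moreover have "(i div prod_list ds) mod x = (j div prod_list ds) mod x"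
    using Cons.prems[of 0] by (simp add: digit_def)
  ultimately show ?case
    by (simp add: mult.commute[of x] mod_mult2_eq)
qed simp

lemma digit_less: "k < length ds \<Longrightarrow> 0 < ds ! k \<Longrightarrow> digit ds k i < ds ! k"
  by (simp add: digit_def)

text \<open>The digits of the traced-out subsystems, with those in \<open>K\<close> masked by zero.\<close>

definition env :: "nat list \<Rightarrow> nat set \<Rightarrow> nat \<Rightarrow> nat \<Rightarrow> nat" where
  "env ds K i = (\<lambda>k. if k < length ds \<and> k \<notin> K then digit ds k i else 0)"

lemma env_eq_iff: "env ds K i = env ds K j \<longleftrightarrow> (\<forall>k<length ds. k \<notin> K \<longrightarrow> digit ds k i = digit ds k j)"
  by (auto simp: env_def fun_eq_iff)

text \<open>Tracing out \<open>k\<close> as well adds one digit to be matched. This is the splitting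
  of environments that \<open>marg_split\<close> asks for.\<close>

lemma env_insert:
  assumes "k < length ds" "k \<notin> K"
  shows "env ds K i = env ds K j \<longleftrightarrow> digit ds k i = digit ds k j \<and> env ds (insert k K) i = env ds (insert k K) j"
  unfolding env_eq_iff using assms by auto

lemma reduced_eq_marg:
  assumes "a < sub_dim ds K" "b < sub_dim ds K"
  shows "reduced ds K \<rho> $$ (a, b) = marg (prod_list ds) (restr ds K) (env ds K) (\<lambda>i j. \<rho> $$ (i, j)) a b"
  using assms by (simp add: reduced_def marg_def env_eq_iff)

section \<open>Pair indices and post-measurement states\<close>

lemma bij_div_mod:
  "bij_betw (\<lambda>s. fst s * m + snd s) ({..<d} \<times> {..<m}) {..<d * (m::nat)}"
proof (rule bij_betw_byWitness[where f' = "\<lambda>i. (i div m, i mod m)"])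
  show "\<forall>a\<in>{..<d} \<times> {..<m}. ((fst a * m + snd a) div m, (fst a * m + snd a) mod m) = a"
    by auto
  show "(\<lambda>s. fst s * m + snd s) ` ({..<d} \<times> {..<m}) \<subseteq> {..<d * m}"
  proof clarsimp
    fix a b assume ab: "a < d" "b < m"
    hence "a * m + b < Suc a * m" by simp
    also have "\<dots> \<le> d * m" using ab by (intro mult_right_mono) auto
    finally show "a * m + b < d * m" .
  qed
  show "(\<lambda>i. (i div m, i mod m)) ` {..<d * m} \<subseteq> {..<d} \<times> {..<m}"
    by (auto simp: less_mult_imp_div_less intro!: mod_less_divisor gr0I)
qed auto

lemma pair_index_less: "a < d \<Longrightarrow> b < m \<Longrightarrow> a * m + b < d * (m::nat)"
  using bij_betwE[OF bij_div_mod[of m d]] by force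

lemma sum_pair_index:
  "(\<Sum>i<d * m. f i) = (\<Sum>a<d. \<Sum>b<m. f (a * m + b))" for f :: "nat \<Rightarrow> 'a::comm_monoid_add"
  using sum.reindex_bij_betw[OF bij_div_mod[of m d], of f] by (simp add: sum.cartesian_product case_prod_beta)

lemma eta_eq: "eta x = - (x * ln x) / ln 2"
  by (simp add: eta_def log_def)

lemma vn_entropy_eq_ent:
  assumes "finite I" "bij_betw h I {..<N}" "A \<in> carrier_mat N N"
    and "\<And>a b. a \<in> I \<Longrightarrow> b \<in> I \<Longrightarrow> A $$ (h a, h b) = \<alpha> a b" and "psd I \<alpha>"
  shows "vn_entropy A = ent I \<alpha> / ln 2"
proof -
  obtain u p where u: "eigsys I \<alpha> u p" using psd_imp_eigsys[OF assms(1,5)] by blast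
  have "vn_entropy A = (\<Sum>j\<in>I. eta (p j))"
    by (rule vn_entropy_eigsys[OF assms(1-3) _ u]) (rule assms(4))
  thus ?thesis
    unfolding ent_eq[OF assms(1) u] eta_eq
    by (simp only: sum_negf[symmetric] sum_divide_distrib)
qed

text \<open>The projectors change only the first component of a pair index, which turns the products
  around \<open>\<sigma>\<close> into the pinching \<open>dil\<close> of the conditional
  blocks.\<close>

lemma post_meas_entry:
  assumes \<psi>: "\<And>k. k < d \<Longrightarrow> \<psi> k \<in> carrier_vec d"
    and \<sigma>: "\<sigma> \<in> carrier_mat (d * m) (d * m)"
    and s: "a < d" "b < m" "a' < d" "b' < m"
  shows "post_meas d m \<psi> \<sigma> $$ (a * m + b, a' * m + b')
    = dil {..<d} (\<lambda>k a. \<psi> k $ a) (\<lambda>k. blk {..<d} (\<lambda>a. \<psi> k $ a) (\<lambda>s t. \<sigma> $$ (fst s * m + snd s, fst t * m + snd t))) (a, b) (a', b')"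
proof -
  have entry: "(kron (proj (\<psi> k)) (1\<^sub>m m) * \<sigma> * kron (proj (\<psi> k)) (1\<^sub>m m)) $$ (a * m + b, a' * m + b')
    = \<psi> k $ a * cnj (\<psi> k $ a') * blk {..<d} (\<lambda>a. \<psi> k $ a) (\<lambda>s t. \<sigma> $$ (fst s * m + snd s, fst t * m + snd t)) b b'"
    if k: "k < d" for k
  proof -
    let ?P = "kron (proj (\<psi> k)) (1\<^sub>m m)"
    have dim: "dim_vec (\<psi> k) = d" using \<psi>[OF k] by simp
    have PC: "?P \<in> carrier_mat (d * m) (d * m)" by (simp add: kron_def proj_def dim carrier_matI)
    have P: "?P $$ (x * m + y, x' * m + y') = \<psi> k $ x * cnj (\<psi> k $ x') * of_bool (y = y')"
      if "x < d" "y < m" "x' < d" "y' < m" for x y x' y'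
      using that pair_index_less[OF that(1,2)] pair_index_less[OF that(3,4)]
      by (simp add: kron_def proj_def dim)
    have left: "(?P * \<sigma>) $$ (a * m + b, j) = (\<Sum>x<d. \<psi> k $ a * cnj (\<psi> k $ x) * \<sigma> $$ (x * m + b, j))"
      if j: "j < d * m" for j
    proof -
      have "(?P * \<sigma>) $$ (a * m + b, j) = (\<Sum>l<d * m. ?P $$ (a * m + b, l) * \<sigma> $$ (l, j))"
        by (rule index_mult_mat_sum[OF PC \<sigma> pair_index_less[OF s(1,2)] j])
      also have "\<dots> = (\<Sum>x<d. \<Sum>y<m. \<psi> k $ a * cnj (\<psi> k $ x) * of_bool (b = y) * \<sigma> $$ (x * m + y, j))"
        unfolding sum_pair_index using s by (intro sum.cong refl) (simp add: P)
      also have "\<dots> = (\<Sum>x<d. \<Sum>y<m. if b = y then \<psi> k $ a * cnj (\<psi> k $ x) * \<sigma> $$ (x * m + y, j) else 0)"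
        by (intro sum.cong refl) auto
      also have "\<dots> = (\<Sum>x<d. \<psi> k $ a * cnj (\<psi> k $ x) * \<sigma> $$ (x * m + b, j))"
        using s by simp
      finally show ?thesis .
    qed
    have "(?P * \<sigma> * ?P) $$ (a * m + b, a' * m + b') = (\<Sum>l<d * m. (?P * \<sigma>) $$ (a * m + b, l) * ?P $$ (l, a' * m + b'))"
      by (rule index_mult_mat_sum[OF mult_carrier_mat[OF PC \<sigma>] PC pair_index_less[OF s(1,2)] pair_index_less[OF s(3,4)]])
    also have "\<dots> = (\<Sum>x'<d. \<Sum>y'<m. if y' = b' then
        (\<Sum>x<d. \<psi> k $ a * cnj (\<psi> k $ x) * \<sigma> $$ (x * m + b, x' * m + y')) * (\<psi> k $ x' * cnj (\<psi> k $ a')) else 0)"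
      unfolding sum_pair_index using s
    proof (intro sum.cong refl)
      fix x' y' assume xy: "x' \<in> {..<d}" "y' \<in> {..<m}"
      have "?P $$ (x' * m + y', a' * m + b') = \<psi> k $ x' * cnj (\<psi> k $ a') * of_bool (y' = b')"
        using xy s by (intro P) auto
      moreover have "x' * m + y' < d * m" using xy by (intro pair_index_less) auto
      ultimately show "(?P * \<sigma>) $$ (a * m + b, x' * m + y') * ?P $$ (x' * m + y', a' * m + b') =
        (if y' = b' then (\<Sum>x<d. \<psi> k $ a * cnj (\<psi> k $ x) * \<sigma> $$ (x * m + b, x' * m + y')) * (\<psi> k $ x' * cnj (\<psi> k $ a')) else 0)"
        using left by (simp del: index_mult_mat)
    qed
    also have "\<dots> = (\<Sum>x'<d. (\<Sum>x<d. \<psi> k $ a * cnj (\<psi> k $ x) * \<sigma> $$ (x * m + b, x' * m + b')) * (\<psi> k $ x' * cnj (\<psi> k $ a')))"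
      using s by simp
    also have "\<dots> = (\<Sum>x'<d. \<Sum>x<d. \<psi> k $ a * cnj (\<psi> k $ a') * (cnj (\<psi> k $ x) * \<sigma> $$ (x * m + b, x' * m + b') * \<psi> k $ x'))"
      by (simp add: sum_distrib_right sum_distrib_left mult_ac)
    also have "\<dots> = (\<Sum>x<d. \<Sum>x'<d. \<psi> k $ a * cnj (\<psi> k $ a') * (cnj (\<psi> k $ x) * \<sigma> $$ (x * m + b, x' * m + b') * \<psi> k $ x'))"
      by (rule sum.swap)
    finally show ?thesis by (simp add: blk_def sum_distrib_left)
  qed
  show ?thesis
    using pair_index_less[OF s(1,2)] pair_index_less[OF s(3,4)]
    by (simp add: post_meas_def Let_def dil_def del: index_mult_mat) (rule sum.cong[OF refl], rule entry, simp)
qed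

lemma reduced_pair_entry:
  assumes a: "a < d" "a' < d"
  shows "reduced [d, m] {0} X $$ (a, a') = (\<Sum>b<m. X $$ (a * m + b, a' * m + b))"
proof -
  have less2: "(\<forall>k<2. k \<notin> {0} \<longrightarrow> P k) \<longleftrightarrow> P (Suc 0)" for P by (auto simp: less_2_cases_iff)
  have const2: "(\<forall>k<2::nat. 0 < k \<longrightarrow> Q) \<longleftrightarrow> Q" for Q by (auto dest: spec[of _ "1::nat"])
  have "reduced [d, m] {0} X $$ (a, a') = (\<Sum>i<d * m. \<Sum>j<d * m.
      if i div m mod d = a \<and> j div m mod d = a' \<and> i mod m = j mod m then X $$ (i, j) else 0)"
    using a by (simp add: reduced_def sub_dim_def restr_def digit_def less2 const2 numeral_2_eq_2[symmetric])
  also have "\<dots> = (\<Sum>x<d. \<Sum>y<m. \<Sum>x'<d. \<Sum>y'<m.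
      if x' = a' then (if y' = y then (if x = a then X $$ (x * m + y, x' * m + y') else 0) else 0) else 0)"
    unfolding sum_pair_index by (intro sum.cong refl) auto
  also have "\<dots> = (\<Sum>x<d. \<Sum>y<m. if x = a then X $$ (x * m + y, a' * m + y) else 0)"
  proof (intro sum.cong refl)
    fix x y assume xy: "x \<in> {..<d}" "y \<in> {..<m}"
    have "(\<Sum>x'<d. \<Sum>y'<m. if x' = a' then (if y' = y then (if x = a then X $$ (x * m + y, x' * m + y') else 0) else 0) else 0)
      = (\<Sum>x'<d. if x' = a' then (if x = a then X $$ (x * m + y, x' * m + y) else 0) else 0)"
      using xy by (intro sum.cong refl) auto
    thus "(\<Sum>x'<d. \<Sum>y'<m. if x' = a' then (if y' = y then (if x = a then X $$ (x * m + y, x' * m + y') else 0) else 0) else 0)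
      = (if x = a then X $$ (x * m + y, a' * m + y) else 0)" using a by simp
  qed
  also have "\<dots> = (\<Sum>y<m. \<Sum>x<d. if x = a then X $$ (x * m + y, a' * m + y) else 0)" by (rule sum.swap)
  also have "\<dots> = (\<Sum>y<m. X $$ (a * m + y, a' * m + y))" using a by simp
  finally show ?thesis .
qed

lemma sum_strict_pairs_symmetric:
  fixes g :: "nat \<Rightarrow> nat \<Rightarrow> real"
  assumes "\<And>i j. g i j = g j i"
  shows "2 * (\<Sum>i<m. \<Sum>j\<in>{i<..<m}. g i j) = (\<Sum>i<m. \<Sum>j<m. g i j) - (\<Sum>i<m. g i i)"
proof (induction m)
  case (Suc m)
  have "{i<..<Suc m} = insert m {i<..<m}" if "i < m" for i using that by auto
  hence "(\<Sum>i<m. \<Sum>j\<in>{i<..<Suc m}. g i j) = (\<Sum>i<m. (\<Sum>j\<in>{i<..<m}. g i j) + g i m)"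
    by (intro sum.cong) auto
  moreover have "{m<..<Suc m} = {}" by auto
  moreover have "(\<Sum>j<m. g m j) = (\<Sum>i<m. g i m)" using assms by simp
  ultimately show ?case using Suc.IH by (simp add: sum.distrib)
qed simp

subsection \<open>Entropies of measured states\<close>

lemma braket_eq_cip:
  assumes "w \<in> carrier_vec d"
  shows "braket v w = cip {..<d} (\<lambda>a. v $ a) (\<lambda>a. w $ a)"
  using assms by (simp add: braket_def cip_def)

lemma onb_of_braket:
  assumes "\<And>k. k < d \<Longrightarrow> \<psi> k \<in> carrier_vec d"
    and "\<And>k l. k < d \<Longrightarrow> l < d \<Longrightarrow> braket (\<psi> k) (\<psi> l) = (if k = l then 1 else 0)"
  shows "onb {..<d} (\<lambda>k a. \<psi> k $ a)"
proof (rule orthonormal_imp_onb)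
  fix i j assume "i \<in> {..<d}" "j \<in> {..<d}"
  thus "(\<Sum>a<d. cnj (\<psi> i $ a) * \<psi> j $ a) = of_bool (i = j)"
    using braket_eq_cip[of "\<psi> j" d "\<psi> i"] assms by (auto simp: cip_def)
qed simp

lemma braket_quadratic:
  assumes A: "A \<in> carrier_mat d d" and v: "v \<in> carrier_vec d"
  shows "braket v (A *\<^sub>v v) = qform {..<d} (\<lambda>i j. A $$ (i, j)) (\<lambda>a. v $ a)"
proof -
  have "(A *\<^sub>v v) $ a = (\<Sum>b<d. A $$ (a, b) * v $ b)" if "a < d" for a
    using that A v by (simp add: scalar_prod_def atLeast0LessThan)
  thus ?thesis using A v by (simp add: braket_def qform_def sum_distrib_left mult.assoc del: index_mult_mat_vec)
qed

lemma density_op_psd: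
  assumes "density_op N \<rho>"
  shows "psd {..<N} (\<lambda>i j. \<rho> $$ (i, j))"
proof -
  have \<rho>: "\<rho> \<in> carrier_mat N N" "hermitian_mat \<rho>"
    and nn: "\<And>v. v \<in> carrier_vec N \<Longrightarrow> 0 \<le> Re (braket v (\<rho> *\<^sub>v v))"
    using assms by (auto simp: density_op_def)
  have "0 \<le> Re (qform {..<N} (\<lambda>i j. \<rho> $$ (i, j)) v)" for v
  proof -
    have "qform {..<N} (\<lambda>i j. \<rho> $$ (i, j)) v = qform {..<N} (\<lambda>i j. \<rho> $$ (i, j)) (\<lambda>a. vec N v $ a)"
      by (simp add: qform_def)
    thus ?thesis using nn[of "vec N v"] braket_quadratic[OF \<rho>(1), of "vec N v"] by simp
  qed
  moreover have "\<rho> $$ (j, i) = cnj (\<rho> $$ (i, j))" if "i < N" "j < N" for i j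
    using \<rho> that unfolding hermitian_mat_def by blast
  ultimately show ?thesis unfolding psd_def by blast
qed

text \<open>The spectrum of the pinched state is made of the spectra of its blocks. Its marginal on
  the first subsystem is diagonal in \<open>\<psi>\<close> with the outcome probabilities as
  eigenvalues.\<close>

lemma vn_entropy_post_meas:
  assumes \<psi>: "\<And>k. k < d \<Longrightarrow> \<psi> k \<in> carrier_vec d"
    and x: "onb {..<d} (\<lambda>k a. \<psi> k $ a)"
    and \<sigma>: "\<sigma> \<in> carrier_mat (d * m) (d * m)"
    and eq: "\<And>a b a' b'. a < d \<Longrightarrow> b < m \<Longrightarrow> a' < d \<Longrightarrow> b' < m \<Longrightarrow>
        \<sigma> $$ (a * m + b, a' * m + b') = \<alpha> (a, b) (a', b')"
    and \<alpha>: "psd ({..<d} \<times> {..<m}) \<alpha>"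
  shows "vn_entropy (post_meas d m \<psi> \<sigma>) = (\<Sum>k<d. ent {..<m} (blk {..<d} (\<lambda>a. \<psi> k $ a) \<alpha>)) / ln 2"
    and "\<rho>A \<in> carrier_mat d d \<Longrightarrow>
      (\<And>a a'. a < d \<Longrightarrow> a' < d \<Longrightarrow> \<rho>A $$ (a, a') = (\<Sum>b<m. \<alpha> (a, b) (a', b))) \<Longrightarrow>
      vn_entropy (reduced [d, m] {0} (post_meas d m \<psi> \<sigma>)) = shannon_meas d \<psi> \<rho>A"
proof -
  let ?x = "\<lambda>k a. \<psi> k $ a"
  let ?X = "post_meas d m \<psi> \<sigma>"
  define \<beta> where "\<beta> k = blk {..<d} (?x k) \<alpha>" for k
  have X: "?X $$ (fst s * m + snd s, fst t * m + snd t) = dil {..<d} ?x \<beta> s t"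
    if "s \<in> {..<d} \<times> {..<m}" "t \<in> {..<d} \<times> {..<m}" for s t
  proof -
    have "blk {..<d} (?x k) (\<lambda>s t. \<sigma> $$ (fst s * m + snd s, fst t * m + snd t)) (snd s) (snd t) = \<beta> k (snd s) (snd t)" for k
      unfolding \<beta>_def blk_def using that by (intro sum.cong refl) (auto simp: eq)
    thus ?thesis
      using post_meas_entry[of d \<psi> \<sigma> m "fst s" "snd s" "fst t" "snd t"] \<psi> \<sigma> that
      by (auto simp: dil_def)
  qed
  have XC: "?X \<in> carrier_mat (d * m) (d * m)" by (simp add: post_meas_def Let_def)
  have psd\<beta>: "psd {..<m} (\<beta> k)" for k unfolding \<beta>_def by (rule psd_blk[OF \<alpha>])
  have "\<forall>k. \<exists>e q. eigsys {..<m} (\<beta> k) e q" using psd_imp_eigsys[OF finite_lessThan psd\<beta>] by blast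
  then obtain e q where e: "\<And>k. eigsys {..<m} (\<beta> k) (e k) (q k)" by metis
  have "vn_entropy ?X = (\<Sum>j\<in>{..<d} \<times> {..<m}. eta (q (fst j) (snd j)))"
    by (rule vn_entropy_eigsys[OF _ bij_div_mod XC X eigsys_dil[OF finite_lessThan finite_lessThan x e]]) auto
  also have "\<dots> = (\<Sum>k<d. \<Sum>l<m. eta (q k l))" by (simp add: sum.cartesian_product')
  also have "\<dots> = (\<Sum>k<d. ent {..<m} (\<beta> k)) / ln 2"
    by (simp only: eta_eq ent_eq[OF finite_lessThan e] sum_divide_distrib sum_negf[symmetric])
  finally show "vn_entropy ?X = (\<Sum>k<d. ent {..<m} (blk {..<d} (\<lambda>a. \<psi> k $ a) \<alpha>)) / ln 2"
    unfolding \<beta>_def .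
  \<comment> \<open>The trace of block \<open>k\<close>, shown below to be the probability of
    outcome \<open>k\<close>.\<close>
  define p where "p k = (\<Sum>b<m. q k b)" for k
  have tr\<beta>: "(\<Sum>b<m. \<beta> k b b) = of_real (p k)" for k
  proof -
    have "cnj (\<beta> k b b) = \<beta> k b b" if "b < m" for b
      by (rule psdD(1)[OF psd\<beta>, symmetric]) (use that in auto)
    hence "cnj (\<Sum>b<m. \<beta> k b b) = (\<Sum>b<m. \<beta> k b b)" by simp
    hence "(\<Sum>b<m. \<beta> k b b) = of_real (Re (\<Sum>b<m. \<beta> k b b))" by (metis Reals_cnj_iff of_real_Re)
    thus ?thesis unfolding p_def eigsys_trace[OF e] .
  qed
  assume \<rho>A: "\<rho>A \<in> carrier_mat d d"
    and \<rho>A_eq: "\<And>a a'. a < d \<Longrightarrow> a' < d \<Longrightarrow> \<rho>A $$ (a, a') = (\<Sum>b<m. \<alpha> (a, b) (a', b))"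
  have prob: "Re (braket (\<psi> k) (\<rho>A *\<^sub>v \<psi> k)) = p k" if k: "k < d" for k
  proof -
    have "braket (\<psi> k) (\<rho>A *\<^sub>v \<psi> k) = (\<Sum>a<d. \<Sum>a'<d. \<Sum>b<m. cnj (\<psi> k $ a) * \<alpha> (a, b) (a', b) * \<psi> k $ a')"
      unfolding braket_quadratic[OF \<rho>A \<psi>[OF k]] qform_def
      by (simp add: \<rho>A_eq sum_distrib_left sum_distrib_right)
    also have "\<dots> = (\<Sum>a<d. \<Sum>b<m. \<Sum>a'<d. cnj (\<psi> k $ a) * \<alpha> (a, b) (a', b) * \<psi> k $ a')"
      by (intro sum.cong refl sum.swap)
    also have "\<dots> = (\<Sum>b<m. \<Sum>a<d. \<Sum>a'<d. cnj (\<psi> k $ a) * \<alpha> (a, b) (a', b) * \<psi> k $ a')"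
      by (rule sum.swap)
    also have "\<dots> = of_real (p k)" unfolding tr\<beta>[symmetric] \<beta>_def blk_def ..
    finally show ?thesis by simp
  qed
  let ?M = "reduced [d, m] {0} ?X"
  have sd: "sub_dim [d, m] {0} = d" by (simp add: sub_dim_def)
  have M: "?M $$ (a, a') = (\<Sum>k<d. of_real (p k) * (?x k a * cnj (?x k a')))" if a: "a < d" "a' < d" for a a'
  proof -
    have "?M $$ (a, a') = (\<Sum>b<m. dil {..<d} ?x \<beta> (a, b) (a', b))"
      unfolding reduced_pair_entry[OF a] using a X[of "(a, b)" "(a', b)" for b] by (intro sum.cong) auto
    also have "\<dots> = (\<Sum>b<m. \<Sum>k<d. ?x k a * cnj (?x k a') * \<beta> k b b)" by (simp add: dil_def)
    also have "\<dots> = (\<Sum>k<d. \<Sum>b<m. ?x k a * cnj (?x k a') * \<beta> k b b)" by (rule sum.swap)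
    also have "\<dots> = (\<Sum>k<d. of_real (p k) * (?x k a * cnj (?x k a')))"
      unfolding sum_distrib_left[symmetric] tr\<beta> by (simp add: mult.commute)
    finally show ?thesis .
  qed
  have MC: "?M \<in> carrier_mat d d" by (simp add: reduced_def sd)
  have "eigsys {..<d} (\<lambda>a a'. ?M $$ (a, a')) ?x p"
    unfolding eigsys_def using x M eigsys_nonneg[OF e] by (auto simp: p_def intro!: sum_nonneg)
  from vn_entropy_eigsys[OF finite_lessThan bij_betw_id MC _ this, unfolded id_apply]
  show "vn_entropy ?M = shannon_meas d \<psi> \<rho>A" by (simp add: shannon_meas_def prob)
qed

lemma overlap_ge:
  assumes "k < d" "l < d"
  shows "(cmod (braket (\<psi> i k) (\<psi> j l)))\<^sup>2 \<le> overlap d \<psi> i j"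
proof -
  have "{(cmod (braket (\<psi> i k) (\<psi> j l)))\<^sup>2 | k l. k < d \<and> l < d}
      = (\<lambda>(k, l). (cmod (braket (\<psi> i k) (\<psi> j l)))\<^sup>2) ` ({..<d} \<times> {..<d})" by auto
  hence "finite {(cmod (braket (\<psi> i k) (\<psi> j l)))\<^sup>2 | k l. k < d \<and> l < d}" by simp
  thus ?thesis unfolding overlap_def using assms by (intro Max_ge) auto
qed

text \<open>Otherwise the vector \<open>\<psi> j 0\<close> would be orthogonal to a whole
  orthonormal basis. Positivity is what allows logarithms of overlaps to be added.\<close>

lemma overlap_pos:
  assumes "d > 0" and i: "onb {..<d} (\<lambda>k a. \<psi> i k $ a)" and j: "onb {..<d} (\<lambda>k a. \<psi> j k $ a)"
    and \<psi>: "\<And>k. k < d \<Longrightarrow> \<psi> j k \<in> carrier_vec d"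
  shows "overlap d \<psi> i j > 0"
proof (rule ccontr)
  assume neg: "\<not> ?thesis"
  have "(cmod (cip {..<d} (\<lambda>a. \<psi> i k $ a) (\<lambda>a. \<psi> j 0 $ a)))\<^sup>2 = 0" if "k < d" for k
  proof -
    have "(cmod (braket (\<psi> i k) (\<psi> j 0)))\<^sup>2 \<le> 0"
      using overlap_ge[of k d 0 \<psi> i j] neg that assms(1) by linarith
    thus ?thesis using braket_eq_cip[OF \<psi>[OF assms(1)], of "\<psi> i k"] by simp
  qed
  thus False using sum_overlap_right[OF finite_lessThan j i, of 0] assms(1) by simp
qed

subsection \<open>The uncertainty relation for several memories\<close>

lemma reduced_single:
  assumes k: "k < length ds"
  shows "reduced ds {k} \<rho> \<in> carrier_mat (ds ! k) (ds ! k)"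
    and "a < ds ! k \<Longrightarrow> b < ds ! k \<Longrightarrow>
      reduced ds {k} \<rho> $$ (a, b) = marg (prod_list ds) (digit ds k) (env ds {k}) (\<lambda>i j. \<rho> $$ (i, j)) a b"
proof -
  have K: "{k} \<inter> {..<length ds} = {k}" "{k} \<inter> {Suc k..<length ds} = {}" using k by auto
  have sd: "sub_dim ds {k} = ds ! k" unfolding sub_dim_def K by simp
  have "restr ds {k} = digit ds k" unfolding restr_def K by (simp add: K)
  thus "a < ds ! k \<Longrightarrow> b < ds ! k \<Longrightarrow>
      reduced ds {k} \<rho> $$ (a, b) = marg (prod_list ds) (digit ds k) (env ds {k}) (\<lambda>i j. \<rho> $$ (i, j)) a b"
    by (simp add: reduced_eq_marg sd)
  show "reduced ds {k} \<rho> \<in> carrier_mat (ds ! k) (ds ! k)" by (simp add: reduced_def sd)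
qed

text \<open>Since \<open>k < l\<close>, subsystem \<open>k\<close> supplies the more significant
  digit of the reduced index; both digits are recovered from it by division by
  \<open>ds ! l\<close>.\<close>

lemma reduced_pair:
  assumes kl: "k < l" "l < length ds" and pos: "0 < ds ! l"
  shows "reduced ds {k, l} \<rho> \<in> carrier_mat (ds ! k * ds ! l) (ds ! k * ds ! l)"
    and "a < ds ! k \<Longrightarrow> b < ds ! l \<Longrightarrow> a' < ds ! k \<Longrightarrow> b' < ds ! l \<Longrightarrow>
      reduced ds {k, l} \<rho> $$ (a * ds ! l + b, a' * ds ! l + b')
        = marg (prod_list ds) (\<lambda>i. (digit ds k i, digit ds l i)) (env ds {k, l}) (\<lambda>i j. \<rho> $$ (i, j)) (a, b) (a', b')"
proof -
  have K: "{k, l} \<inter> {..<length ds} = {k, l}" "{k, l} \<inter> {Suc k..<length ds} = {l}"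
    "{k, l} \<inter> {Suc l..<length ds} = {}" and ne: "k \<noteq> l" using kl by auto
  have sd: "sub_dim ds {k, l} = ds ! k * ds ! l" unfolding sub_dim_def K using ne by simp
  have restr: "restr ds {k, l} i = digit ds k i * ds ! l + digit ds l i" for i
    unfolding restr_def K using ne by (simp add: K)
  show "reduced ds {k, l} \<rho> \<in> carrier_mat (ds ! k * ds ! l) (ds ! k * ds ! l)"
    by (simp add: reduced_def sd)
  assume ab: "a < ds ! k" "b < ds ! l" "a' < ds ! k" "b' < ds ! l"
  have eq: "restr ds {k, l} i = x * ds ! l + y \<longleftrightarrow> (digit ds k i, digit ds l i) = (x, y)" if y: "y < ds ! l" for i x y
  proof
    assume "restr ds {k, l} i = x * ds ! l + y"
    hence h: "digit ds k i * ds ! l + digit ds l i = x * ds ! l + y" by (simp add: restr)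
    have "digit ds l i < ds ! l" by (rule digit_less[OF kl(2) pos])
    thus "(digit ds k i, digit ds l i) = (x, y)"
      using arg_cong[OF h, of "\<lambda>i. i div ds ! l"] arg_cong[OF h, of "\<lambda>i. i mod ds ! l"] y by simp
  qed (simp add: restr)
  show "reduced ds {k, l} \<rho> $$ (a * ds ! l + b, a' * ds ! l + b')
        = marg (prod_list ds) (\<lambda>i. (digit ds k i, digit ds l i)) (env ds {k, l}) (\<lambda>i j. \<rho> $$ (i, j)) (a, b) (a', b')"
    using ab by (simp add: reduced_eq_marg sd pair_index_less) (simp add: marg_def eq)
qed

theorem theorem3:
  fixes m n d :: nat
    and db :: "nat \<Rightarrow> nat"
    and \<rho> :: "complex mat"
    and \<psi> :: "nat \<Rightarrow> nat \<Rightarrow> complex vec"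
    and S :: "nat \<Rightarrow> nat set"
    and U :: real
  defines "ds \<equiv> d # map db [0..<n]"
  defines "\<rho>A \<equiv> reduced ds {0} \<rho>"
  defines "\<rho>AB \<equiv> (\<lambda>t. reduced ds {0, Suc t} \<rho>)"
  defines "\<rho>B \<equiv> (\<lambda>t. reduced ds {Suc t} \<rho>)"
  defines "\<rho>MB \<equiv> (\<lambda>i t. post_meas d (db t) (\<psi> i) (\<rho>AB t))"
  defines "\<rho>M \<equiv> (\<lambda>i t. reduced [d, db t] {0} (\<rho>MB i t))"
  defines "condS_MB \<equiv> (\<lambda>i t. vn_entropy (\<rho>MB i t) - vn_entropy (\<rho>B t))"
  defines "mutI_MB \<equiv> (\<lambda>i t. vn_entropy (\<rho>M i t) + vn_entropy (\<rho>B t) - vn_entropy (\<rho>MB i t))"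
  defines "condS_AB \<equiv> (\<lambda>t. vn_entropy (\<rho>AB t) - vn_entropy (\<rho>B t))"
  defines "U_SCB \<equiv>
     - (1 / (real m - 1)) * log 2 (\<Prod>i<m. \<Prod>j\<in>{i<..<m}. overlap d \<psi> i j)
     + (1 / (real m - 1)) *
       (\<Sum>t<n. real (card (S t)) * (real (card (S t)) - 1) / 2 * condS_AB t)"
  assumes "m \<ge> 2" and "1 \<le> n" and "n \<le> m"
    and "density_op (prod_list ds) \<rho>"
    and "\<forall>i<m. \<forall>k<d. \<psi> i k \<in> carrier_vec d"
    and "\<forall>i<m. \<forall>k<d. \<forall>l<d. braket (\<psi> i k) (\<psi> i l) = (if k = l then 1 else 0)"
    and "\<forall>t<n. S t \<noteq> {}"
    and "\<forall>t<n. \<forall>t'<n. t \<noteq> t' \<longrightarrow> S t \<inter> S t' = {}"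
    and "(\<Union>t<n. S t) = {..<m}"
    and "(\<Sum>i<m. shannon_meas d (\<psi> i) \<rho>A) \<ge> U"
  shows "(\<Sum>t<n. \<Sum>i\<in>S t. condS_MB i t) \<ge>
     U_SCB + max 0 (U - U_SCB - (\<Sum>t<n. \<Sum>i\<in>S t. mutI_MB i t))"
proof -
  note dens = \<open>density_op (prod_list ds) \<rho>\<close> and cover = \<open>(\<Union>t<n. S t) = {..<m}\<close>
  have \<psi>C: "\<psi> i k \<in> carrier_vec d" if "i < m" "k < d" for i k
    using \<open>\<forall>i<m. \<forall>k<d. \<psi> i k \<in> carrier_vec d\<close> that by blast
  have onb: "onb {..<d} (\<lambda>k a. \<psi> i k $ a)" if i: "i < m" for i
    using i \<open>\<forall>i<m. \<forall>k<d. \<forall>l<d. braket (\<psi> i k) (\<psi> i l) = (if k = l then 1 else 0)\<close>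
    by (intro onb_of_braket \<psi>C[OF i]) auto

  \<comment> \<open>Marginals of the given state and their entropies\<close>
  define N where "N = prod_list ds"
  define R where "R = (\<lambda>i j. \<rho> $$ (i, j))"
  have psdR: "psd {..<N} R" unfolding R_def N_def by (rule density_op_psd[OF dens])
  have trR: "(\<Sum>i<N. R i i) = 1"
    using dens by (auto simp: density_op_def mtrace_def R_def N_def)
  \<comment> \<open>Trace one rules out an empty index set, so every local dimension is
    positive.\<close>
  have "N \<noteq> 0" using trR by (intro notI) simp
  hence pos: "0 < ds ! k" if "k < length ds" for k
    using that unfolding N_def prod_list_zero_iff by (metis gr0I nth_mem)
  have len: "length ds = Suc n" and ds0: "ds ! 0 = d" by (simp_all add: ds_def)
  have dsS: "ds ! Suc t = db t" if "t < n" for t using that by (simp add: ds_def)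
  have d: "d > 0" using pos[of 0] len ds0 by simp
  let ?dig = "digit ds"
  have dig0: "?dig 0 i \<in> {..<d}" for i using digit_less[of 0 ds i] pos[of 0] len ds0 by simp
  have digS: "?dig (Suc t) i \<in> {..<db t}" if "t < n" for t i
    using digit_less[of "Suc t" ds i] pos[of "Suc t"] len dsS[OF that] that by simp
  have inj: "i = j" if "i < N" "j < N" and K: "\<forall>k\<in>K. ?dig k i = ?dig k j" and e: "env ds K i = env ds K j" for i j K
  proof -
    have "?dig k i = ?dig k j" if "k < length ds" for k
      using K e[unfolded env_eq_iff] that by (cases "k \<in> K") auto
    thus ?thesis using digits_determine_mod[of ds i j] that(1,2) unfolding N_def by simp
  qed
  \<comment> \<open>The state of the measured system and memory \<open>t\<close>, indexed by pairs.
    Subsystem \<open>0\<close> is the measured one, which shifts the memories by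
    \<open>Suc\<close>.\<close>
  define AB where "AB t = marg N (\<lambda>i. (?dig 0 i, ?dig (Suc t) i)) (env ds {0, Suc t}) R" for t
  have psdAB: "psd ({..<d} \<times> {..<db t}) (AB t)" if "t < n" for t
    unfolding AB_def using dig0 digS[OF that] by (intro psd_marg psdR) auto
  have trAB: "(\<Sum>s\<in>{..<d} \<times> {..<db t}. AB t s s) = 1" if t: "t < n" for t
    unfolding AB_def trR[symmetric]
  proof (rule marg_trace)
    fix i j assume ij: "i < N" "j < N" and g: "(?dig 0 i, ?dig (Suc t) i) = (?dig 0 j, ?dig (Suc t) j)"
      and e: "env ds {0, Suc t} i = env ds {0, Suc t} j"
    show "i = j" by (rule inj[OF ij _ e]) (use g in auto)
  qed (use dig0 digS[OF t] in auto)
  have \<rho>AB: "\<rho>AB t \<in> carrier_mat (d * db t) (d * db t)"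
    "\<And>a b a' b'. a < d \<Longrightarrow> b < db t \<Longrightarrow> a' < d \<Longrightarrow> b' < db t \<Longrightarrow>
        \<rho>AB t $$ (a * db t + b, a' * db t + b') = AB t (a, b) (a', b')" if t: "t < n" for t
    using reduced_pair[where \<rho> = \<rho> and ds = ds and k = 0 and l = "Suc t"] t len pos[of "Suc t"]
    by (simp_all add: \<rho>AB_def AB_def N_def R_def ds0 dsS[OF t])
  have ptrAB: "ptr {..<d} (AB t) b b' = marg N (?dig (Suc t)) (env ds {Suc t}) R b b'" if t: "t < n" for t b b'
    unfolding AB_def ptr_def
  proof (rule marg_split[symmetric])
    show "env ds {Suc t} i = env ds {Suc t} j \<longleftrightarrow> ?dig 0 i = ?dig 0 j \<and> env ds {0, Suc t} i = env ds {0, Suc t} j" for i j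
      using len by (intro env_insert) auto
  qed (use dig0 in auto)
  \<comment> \<open>Every memory gives the same reduced state of the measured system, so the outcome
    distributions do not depend on \<open>t\<close>.\<close>
  have \<rho>A: "\<rho>A \<in> carrier_mat d d"
    "\<And>a a'. a < d \<Longrightarrow> a' < d \<Longrightarrow> \<rho>A $$ (a, a') = (\<Sum>b<db t. AB t (a, b) (a', b))" if t: "t < n" for t
  proof -
    show "\<rho>A \<in> carrier_mat d d" using reduced_single(1)[where \<rho> = \<rho> and ds = ds and k = 0] len ds0 by (simp add: \<rho>A_def)
    fix a a' assume a: "a < d" "a' < d"
    have "\<rho>A $$ (a, a') = marg N (?dig 0) (env ds {0}) R a a'"
      using reduced_single(2)[where \<rho> = \<rho> and ds = ds and k = 0 and a = a and b = a'] a len ds0 by (simp add: \<rho>A_def N_def R_def)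
    also have "\<dots> = (\<Sum>b<db t. AB t (a, b) (a', b))"
      unfolding AB_def
    proof (rule marg_split)
      show "env ds {0} i = env ds {0} j \<longleftrightarrow> ?dig (Suc t) i = ?dig (Suc t) j \<and> env ds {0, Suc t} i = env ds {0, Suc t} j" for i j
        using env_insert[of "Suc t" ds "{0}" i j] len t by (simp add: insert_commute)
    qed (use digS[OF t] in auto)
    finally show "\<rho>A $$ (a, a') = (\<Sum>b<db t. AB t (a, b) (a', b))" .
  qed
  have entB: "vn_entropy (\<rho>B t) = ent {..<db t} (ptr {..<d} (AB t)) / ln 2" if t: "t < n" for t
  proof (rule vn_entropy_eq_ent[OF _ bij_betw_id])
    \<comment> \<open>Any of the measured bases writes the partial trace as a sum of positive
      blocks; the first one is taken.\<close>
    have "0 < m" using \<open>m \<ge> 2\<close> by simp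
    show "psd {..<db t} (ptr {..<d} (AB t))"
      by (rule psd_ptr[OF finite_lessThan onb[OF \<open>0 < m\<close>] psdAB[OF t]])
    show "\<rho>B t \<in> carrier_mat (db t) (db t)"
      using reduced_single(1)[where \<rho> = \<rho> and ds = ds and k = "Suc t"] t len dsS[OF t] by (simp add: \<rho>B_def)
    fix b b' assume "b \<in> {..<db t}" "b' \<in> {..<db t}"
    thus "\<rho>B t $$ (id b, id b') = ptr {..<d} (AB t) b b'"
      using reduced_single(2)[where \<rho> = \<rho> and ds = ds and k = "Suc t" and a = b and b = b'] t len dsS[OF t] ptrAB[OF t]
      by (simp add: \<rho>B_def N_def R_def)
  qed simp
  have entAB: "vn_entropy (\<rho>AB t) = ent ({..<d} \<times> {..<db t}) (AB t) / ln 2" if t: "t < n" for t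
    by (rule vn_entropy_eq_ent[OF _ bij_div_mod \<rho>AB(1)[OF t] _ psdAB[OF t]]) (auto simp: \<rho>AB(2)[OF t])
  let ?blk = "\<lambda>i t k. blk {..<d} (\<lambda>a. \<psi> i k $ a) (AB t)"
  have entMB: "vn_entropy (\<rho>MB i t) = (\<Sum>k<d. ent {..<db t} (?blk i t k)) / ln 2" if i: "i < m" and t: "t < n" for i t
    unfolding \<rho>MB_def
    by (rule vn_entropy_post_meas(1)[OF \<psi>C[OF i] onb[OF i] \<rho>AB[OF t] psdAB[OF t]])
  have entM: "vn_entropy (\<rho>M i t) = shannon_meas d (\<psi> i) \<rho>A" if i: "i < m" and t: "t < n" for i t
    unfolding \<rho>M_def \<rho>MB_def
    by (rule vn_entropy_post_meas(2)[OF \<psi>C[OF i] onb[OF i] \<rho>AB[OF t] psdAB[OF t] \<rho>A[OF t]])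

  \<comment> \<open>Bounds for pairs of observables\<close>
  have ov: "(cmod (cip {..<d} (\<lambda>a. \<psi> i k $ a) (\<lambda>a. \<psi> j l $ a)))\<^sup>2 \<le> overlap d \<psi> i j"
    if "j < m" "k \<in> {..<d}" "l \<in> {..<d}" for i j k l
    using overlap_ge[of k d l \<psi> i j] braket_eq_cip[OF \<psi>C[of j l], of "\<psi> i k"] that by simp
  have ov_pos: "overlap d \<psi> i j > 0" if "i < m" "j < m" for i j
    by (rule overlap_pos[OF d onb[OF that(1)] onb[OF that(2)] \<psi>C[OF that(2)]])
  \<comment> \<open>Subtracting the entropy of the memory twice turns the bipartite relation into
    one between conditional entropies; dividing by \<open>ln 2\<close> changes the base.\<close>
  have same: "- log 2 (overlap d \<psi> i j) + condS_AB t \<le> condS_MB i t + condS_MB j t"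
    if "i < m" "j < m" and t: "t < n" for i j t
  proof -
    have "ent ({..<d} \<times> {..<db t}) (AB t) + ent {..<db t} (ptr {..<d} (AB t)) - ln (overlap d \<psi> i j)
       \<le> (\<Sum>k<d. ent {..<db t} (?blk i t k)) + (\<Sum>k<d. ent {..<db t} (?blk j t k))"
      using bipartite_uncertainty[OF finite_lessThan finite_lessThan psdAB[OF t] onb[OF that(1)] onb[OF that(2)]
          ov_pos[OF that(1,2)] ov[OF that(2)]] unfolding trAB[OF t] by simp
    hence "(ent ({..<d} \<times> {..<db t}) (AB t) + ent {..<db t} (ptr {..<d} (AB t)) - ln (overlap d \<psi> i j)) / ln 2
       \<le> ((\<Sum>k<d. ent {..<db t} (?blk i t k)) + (\<Sum>k<d. ent {..<db t} (?blk j t k))) / ln 2"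
      by (rule divide_right_mono) simp
    thus ?thesis
      unfolding condS_AB_def condS_MB_def entAB[OF t] entB[OF t] entMB[OF that(1) t] entMB[OF that(2) t] log_def
      by (simp add: add_divide_distrib diff_divide_distrib)
  qed
  have different: "- log 2 (overlap d \<psi> i j) \<le> condS_MB i t + condS_MB j t'"
    if "i < m" "j < m" and t: "t < n" "t' < n" "t \<noteq> t'" for i j t t'
  proof -
    \<comment> \<open>The joint state of the measured system and both memories, whose two partial
      traces are \<open>AB t\<close> and \<open>AB t'\<close>.\<close>
    define G where "G = marg N (\<lambda>i. (?dig 0 i, ?dig (Suc t) i, ?dig (Suc t') i)) (env ds {0, Suc t, Suc t'}) R"
    have psdG: "psd ({..<d} \<times> {..<db t} \<times> {..<db t'}) G"
      unfolding G_def using dig0 digS t by (intro psd_marg psdR) auto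
    have trG: "(\<Sum>s\<in>{..<d} \<times> {..<db t} \<times> {..<db t'}. G s s) = 1"
      unfolding G_def trR[symmetric]
    proof (rule marg_trace)
      fix i j assume ij: "i < N" "j < N"
        and g: "(?dig 0 i, ?dig (Suc t) i, ?dig (Suc t') i) = (?dig 0 j, ?dig (Suc t) j, ?dig (Suc t') j)"
        and e: "env ds {0, Suc t, Suc t'} i = env ds {0, Suc t, Suc t'} j"
      show "i = j" by (rule inj[OF ij _ e]) (use g in auto)
    qed (use dig0 digS t in auto)
    have G1: "AB t x y = (\<Sum>c<db t'. G (fst x, snd x, c) (fst y, snd y, c))" for x y
      unfolding AB_def G_def
    proof (rule marg_split)
      have "insert (Suc t') {0, Suc t} = {0, Suc t, Suc t'}" by auto
      thus "env ds {0, Suc t} i = env ds {0, Suc t} j \<longleftrightarrow>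
          ?dig (Suc t') i = ?dig (Suc t') j \<and> env ds {0, Suc t, Suc t'} i = env ds {0, Suc t, Suc t'} j" for i j
        using env_insert[of "Suc t'" ds "{0, Suc t}" i j] t len by simp
    qed (use digS t in auto)
    have G2: "AB t' x y = (\<Sum>b<db t. G (fst x, b, snd x) (fst y, b, snd y))" for x y
      unfolding AB_def G_def
    proof (rule marg_split)
      have "insert (Suc t) {0, Suc t'} = {0, Suc t, Suc t'}" by auto
      thus "env ds {0, Suc t'} i = env ds {0, Suc t'} j \<longleftrightarrow>
          ?dig (Suc t) i = ?dig (Suc t) j \<and> env ds {0, Suc t, Suc t'} i = env ds {0, Suc t, Suc t'} j" for i j
        using env_insert[of "Suc t" ds "{0, Suc t'}" i j] t len by simp
    qed (use digS t in auto)
    have "- ln (overlap d \<psi> i j) \<le>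
       ((\<Sum>k<d. ent {..<db t} (?blk i t k)) - ent {..<db t} (ptr {..<d} (AB t))) +
       ((\<Sum>k<d. ent {..<db t'} (?blk j t' k)) - ent {..<db t'} (ptr {..<d} (AB t')))"
      using tripartite_uncertainty[OF finite_lessThan finite_lessThan finite_lessThan psdG onb[OF that(1)] onb[OF that(2)]
          ov_pos[OF that(1,2)] ov[OF that(2)] G1 G2] unfolding trG by simp
    hence "- ln (overlap d \<psi> i j) / ln 2 \<le>
       (((\<Sum>k<d. ent {..<db t} (?blk i t k)) - ent {..<db t} (ptr {..<d} (AB t))) +
       ((\<Sum>k<d. ent {..<db t'} (?blk j t' k)) - ent {..<db t'} (ptr {..<d} (AB t')))) / ln 2"
      by (rule divide_right_mono) simp
    thus ?thesis
      unfolding condS_MB_def entB[OF t(1)] entB[OF t(2)] entMB[OF that(1) t(1)] entMB[OF that(2) t(2)] log_def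
      by (simp add: add_divide_distrib diff_divide_distrib)
  qed

  \<comment> \<open>Summation over all pairs of observables\<close>
  define \<tau> where "\<tau> i = (THE t. t < n \<and> i \<in> S t)" for i
  have \<tau>_eq: "\<tau> i = t" if "t < n" "i \<in> S t" for i t
    unfolding \<tau>_def
    using that \<open>\<forall>t<n. \<forall>t'<n. t \<noteq> t' \<longrightarrow> S t \<inter> S t' = {}\<close> by (intro the_equality) blast+
  have \<tau>: "\<tau> i < n" "i \<in> S (\<tau> i)" if "i < m" for i
  proof -
    obtain t where "t < n" "i \<in> S t" using cover \<open>i < m\<close> by blast
    thus "\<tau> i < n" "i \<in> S (\<tau> i)" using \<tau>_eq by auto
  qed
  have S_eq: "S t = {i \<in> {..<m}. \<tau> i = t}" if "t < n" for t
    using \<tau>_eq \<tau> cover that by blast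
  have finS: "finite (S t)" if "t < n" for t unfolding S_eq[OF that] by simp
  have regroup: "(\<Sum>t<n. \<Sum>i\<in>S t. f i t) = (\<Sum>i<m. f i (\<tau> i))" for f :: "nat \<Rightarrow> nat \<Rightarrow> real"
  proof -
    have "(\<Sum>t<n. \<Sum>i\<in>S t. f i t) = (\<Sum>t<n. \<Sum>i\<in>{i \<in> {..<m}. \<tau> i = t}. f i (\<tau> i))"
      by (intro sum.cong) (auto simp: S_eq)
    also have "\<dots> = (\<Sum>i<m. f i (\<tau> i))" using \<tau>(1) by (intro sum.group) auto
    finally show ?thesis .
  qed
  define cond where "cond i = condS_MB i (\<tau> i)" for i
  \<comment> \<open>A pair of observables gains the conditional entropy of the state exactly when
    both are assigned to the same memory.\<close>
  let ?s = "\<lambda>i j. if \<tau> i = \<tau> j then condS_AB (\<tau> i) else 0"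
  have "(\<Sum>i<m. \<Sum>j\<in>{i<..<m}. - log 2 (overlap d \<psi> i j) + ?s i j) \<le> (\<Sum>i<m. \<Sum>j\<in>{i<..<m}. cond i + cond j)"
  proof (intro sum_mono)
    fix i j assume "i \<in> {..<m}" "j \<in> {i<..<m}"
    hence ij: "i < m" "j < m" by auto
    show "- log 2 (overlap d \<psi> i j) + ?s i j \<le> cond i + cond j"
      using same[OF ij \<tau>(1)[OF ij(1)]] different[OF ij \<tau>(1)[OF ij(1)] \<tau>(1)[OF ij(2)]]
      by (auto simp: cond_def)
  qed
  \<comment> \<open>Every observable occurs in \<open>m - 1\<close> unordered pairs: the sum over
    all ordered pairs counts it \<open>2 * m\<close> times, the diagonal twice, and half the
    difference is taken.\<close>
  moreover have "(\<Sum>i<m. \<Sum>j\<in>{i<..<m}. cond i + cond j) = (real m - 1) * (\<Sum>i<m. cond i)"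
  proof -
    have "(\<Sum>i<m. \<Sum>j<m. cond i + cond j) = 2 * real m * (\<Sum>i<m. cond i)"
      by (simp add: sum.distrib sum_distrib_left mult.assoc)
    moreover have "(\<Sum>i<m. cond i + cond i) = 2 * (\<Sum>i<m. cond i)" by (simp add: sum_distrib_left)
    moreover have "2 * (\<Sum>i<m. \<Sum>j\<in>{i<..<m}. cond i + cond j)
        = (\<Sum>i<m. \<Sum>j<m. cond i + cond j) - (\<Sum>i<m. cond i + cond i)"
      by (rule sum_strict_pairs_symmetric) simp
    ultimately show ?thesis unfolding left_diff_distrib by linarith
  qed
  \<comment> \<open>Among the pairs, those assigned to memory \<open>t\<close> number half of
    \<open>card (S t)\<close> squared minus \<open>card (S t)\<close>, which is the coefficient in
    \<open>U_SCB\<close>.\<close>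
  moreover have "(\<Sum>i<m. \<Sum>j\<in>{i<..<m}. ?s i j)
      = (\<Sum>t<n. real (card (S t)) * (real (card (S t)) - 1) / 2 * condS_AB t)"
  proof -
    have "(\<Sum>j<m. ?s i j) = real (card (S (\<tau> i))) * condS_AB (\<tau> i)" if i: "i < m" for i
    proof -
      have "(\<Sum>j<m. ?s i j) = (\<Sum>j\<in>{j \<in> {..<m}. \<tau> j = \<tau> i}. condS_AB (\<tau> i))"
        by (subst sum.inter_filter) (auto intro!: sum.cong)
      thus ?thesis unfolding S_eq[OF \<tau>(1)[OF i]] by simp
    qed
    hence "(\<Sum>i<m. \<Sum>j<m. ?s i j) = (\<Sum>i<m. real (card (S (\<tau> i))) * condS_AB (\<tau> i))" by simp
    also have "\<dots> = (\<Sum>t<n. \<Sum>i\<in>S t. real (card (S t)) * condS_AB t)"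
      by (rule regroup[symmetric, of "\<lambda>i t. real (card (S t)) * condS_AB t"])
    finally have 1: "(\<Sum>i<m. \<Sum>j<m. ?s i j) = (\<Sum>t<n. real (card (S t)) * (real (card (S t)) * condS_AB t))"
      by simp
    have 2: "(\<Sum>i<m. ?s i i) = (\<Sum>t<n. real (card (S t)) * condS_AB t)"
      using regroup[of "\<lambda>i t. condS_AB t"] by simp
    have "2 * (\<Sum>i<m. \<Sum>j\<in>{i<..<m}. ?s i j)
        = (\<Sum>t<n. real (card (S t)) * (real (card (S t)) * condS_AB t) - real (card (S t)) * condS_AB t)"
      using sum_strict_pairs_symmetric[of ?s m] unfolding 1 2 sum_subtractf by auto
    also have "\<dots> = 2 * (\<Sum>t<n. real (card (S t)) * (real (card (S t)) - 1) / 2 * condS_AB t)"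
      unfolding sum_distrib_left by (intro sum.cong refl) (simp add: field_simps)
    finally show ?thesis by simp
  qed
  moreover have "(\<Sum>i<m. \<Sum>j\<in>{i<..<m}. log 2 (overlap d \<psi> i j)) = log 2 (\<Prod>i<m. \<Prod>j\<in>{i<..<m}. overlap d \<psi> i j)"
  proof -
    have "ln (\<Prod>i<m. \<Prod>j\<in>{i<..<m}. overlap d \<psi> i j) = (\<Sum>i<m. ln (\<Prod>j\<in>{i<..<m}. overlap d \<psi> i j))"
      using ov_pos by (intro ln_prod) (auto simp: less_imp_neq[symmetric])
    also have "\<dots> = (\<Sum>i<m. \<Sum>j\<in>{i<..<m}. ln (overlap d \<psi> i j))"
      using ov_pos by (intro sum.cong refl ln_prod) (auto simp: less_imp_neq[symmetric])
    finally show ?thesis by (simp add: log_def sum_divide_distrib)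
  qed
  ultimately have "- log 2 (\<Prod>i<m. \<Prod>j\<in>{i<..<m}. overlap d \<psi> i j)
      + (\<Sum>t<n. real (card (S t)) * (real (card (S t)) - 1) / 2 * condS_AB t) \<le> (real m - 1) * (\<Sum>i<m. cond i)"
    by (simp add: sum.distrib sum_negf sum_subtractf)
  moreover have "(real m - 1) * U_SCB = - log 2 (\<Prod>i<m. \<Prod>j\<in>{i<..<m}. overlap d \<psi> i j)
      + (\<Sum>t<n. real (card (S t)) * (real (card (S t)) - 1) / 2 * condS_AB t)"
  proof -
    have "M * (- (1 / M) * a + 1 / M * b) = - a + b" if "M \<noteq> 0" for M a b :: real
      using that by (simp add: field_simps)
    thus ?thesis unfolding U_SCB_def by this (use \<open>m \<ge> 2\<close> in simp)
  qed
  ultimately have "(real m - 1) * U_SCB \<le> (real m - 1) * (\<Sum>i<m. cond i)" by simp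
  hence scb: "U_SCB \<le> (\<Sum>i<m. cond i)"
    using \<open>m \<ge> 2\<close> by (subst (asm) mult_le_cancel_left_pos) auto
  \<comment> \<open>The entropy of the measured system after the measurement is the Shannon entropy
    of the outcomes, so each conditional entropy is that minus the mutual information.\<close>
  have "(\<Sum>i<m. cond i) = (\<Sum>i<m. shannon_meas d (\<psi> i) \<rho>A - mutI_MB i (\<tau> i))"
    by (intro sum.cong refl) (simp add: cond_def condS_MB_def mutI_MB_def entM \<tau>(1))
  hence "U - (\<Sum>i<m. mutI_MB i (\<tau> i)) \<le> (\<Sum>i<m. cond i)"
    using \<open>(\<Sum>i<m. shannon_meas d (\<psi> i) \<rho>A) \<ge> U\<close> by (simp add: sum_subtractf)
  \<comment> \<open>The claimed bound is the larger of \<open>U_SCB\<close> and of \<open>U\<close>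
    minus the total mutual information, and both have been established.\<close>
  with scb show ?thesis unfolding regroup cond_def[symmetric] by simp
qed

end
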